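(* Let $T_a:[0,1]\to[0,1]$, $a\in I$, be a piecewise expanding one-parameter family as described in the context, satisfying properties (i), (ii), (iii) and conditions (II) and (III) written out there. If $X:I\to[0,1]$ is a piecewise $C^1$ map for which condition (I) written out in the context is fulfilled, then $X(a)$ is typical for $\mu_a$ for Lebesgue almost every $a\in I$.
   Context: $C^{1,1}(L)$ means $C^1$ with derivative Lipschitz with constant at most $L$; $\mathrm{Lip}(L)$ means Lipschitz with constant at most $L$. Family. $I\subset\mathbb R$ is an interval of finite length, $0<L<\infty$, $1<\lambda\le\Lambda<\infty$, and for each $a\in I$, $T_a:[0,1]\to[0,1]$ is a map with a partition $0=b_0(a)<b_1(a)<\dots<b_{p(a)}(a)=1$ such that $T_a$ is $C^{1,1}(L)$ on each $(b_{k-1}(a),b_k(a))$ and $\lambda\le|\partial_xT_a(x)|\le\Lambda$ for all $x$ outside the partition points. For each $a\in I$, $T_a$ has a unique absolutely continuous invariant probability measure $\mu_a$; $K(a)=\mathrm{supp}(\mu_a)$ (a finite union of intervals), and $\varphi_a$ is the density of $\mu_a$. Properties: (i) $p(a)\equiv p_0$ is constant, each $b_k$ is $\mathrm{Lip}(L)$ on $I$, and there is $\delta_0>0$ with $b_k(a)-b_{k-1}(a)\ge\delta_0$ for all $1\le k\le p_0$, $a\in I$. (ii) If $x\in[0,1]$ and $J\subset I$ is an interval with $b_k(a)\ne x$ for all $a\in J$, $0\le k\le p_0$, then $a\mapsto T_a(x)$ is $C^1(J)$ and both $a\mapsto T_a(x)$ and $a\mapsto\partial_xT_a(x)$ are $\mathrm{Lip}(L)$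 on $J$. (iii) Let $D_1(a),\dots,D_{p_1(a)}(a)$ be the connected components of $K(a)\setminus\{b_0(a),\dots,b_{p_0}(a)\}$. The number $p_1(a)\equiv p_1$ is constant and the boundary points of each $D_k(a)$ change continuously in $a\in I$. Partitions. For $j\ge1$, $\mathcal P_j(a)$ is the set of maximal open intervals $\omega\subset K(a)$ such that $T_a^i(\omega)\cap\{b_0(a),\dots,b_{p_0}(a)\}=\emptyset$ for all $0\le i<j$ (maximal intervals of smooth monotonicity of $T_a^j:K(a)\to K(a)$). If a set $H\subset D_k(a)$, put $\mathrm{symb}_a(H)=k$. Given a piecewise $C^1$ map $X:I\to[0,1]$ (finitely many pieces), let $x_j(a)=T_a^j(X(a))$, $j\ge0$, and let $\mathcal C$ be the finite set of $a$ where $X$ is not differentiable. $\mathcal P_j|I$ is the set of maximal open intervals $\omega\subset \mathrm{int}(I)\setminus\mathcal C$ such that $x_i(a)\in K(a)\setminus\{b_0(a),\dots,b_{p_0}(a)\}$ for all $a\in\omega$ and $0\le i<j$. Write $x_j'(a)=D_ax_j(a)$ and $(T_a^j)'=\partial_xT_a^j$. Condition (I): there is $C_0\ge1$ such that for all $j\ge1$, $\omega\in\mathcal P_j|I$ and $a\in\omega$: $C_0^{-1}\le|x_j'(a)/(T_a^j)'(X(a))|\le C_0$; moreover for each $j\ge1$ the number of $a\in I$ not contained in any $\omega\in\mathcal P_j|I$ is finite. Condition (II): there is $C_1\ge1$ such that for each $a\in I$, $C_1^{-1}\le\varphi_a(x)\le C_1$ for $\mu_a$-a.e. $x\in[0,1]$.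 Condition (III): there is a constant $C_2$ such that for all $a_1,a_2\in I$ with $a_1\le a_2$ and all $j\ge1$ there is a map $\mathcal U_{a_1,a_2,j}:\mathcal P_j(a_1)\to\mathcal P_j(a_2)$ such that for every $\omega\in\mathcal P_j(a_1)$, with $\omega'=\mathcal U_{a_1,a_2,j}(\omega)$: $\mathrm{symb}_{a_1}(T_{a_1}^i(\omega))=\mathrm{symb}_{a_2}(T_{a_2}^i(\omega'))$ for $0\le i<j$; $\mathrm{dist}(T_{a_1}^j(\omega),T_{a_2}^j(\omega'))\le C_2|a_1-a_2|$; and $|T_{a_1}^j(\omega)|\le C_2|T_{a_2}^j(\omega')|$. Here $\mathrm{dist}(A_1,A_2)$ is the infimum of $|s-t|$ over $s\in A_1$, $t\in A_2$, and $|\cdot|$ is length. Typical: $x$ is typical for $\mu_a$ if $\frac1n\sum_{i=0}^{n-1}\delta_{T_a^i(x)}\to\mu_a$ weak-$*$ as $n\to\infty$. *)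

theory Defs
  imports "HOL-Probability.Probability"
begin

text \<open>Throughout, a parametrised map \<open>T a\<close> is a function on all reals of which only the
  restriction to the unit interval matters; \<open>b k a\<close>, \<open>0 \<le> k \<le> p\<close>, are the partition points
  of \<open>T a\<close>.\<close>

text \<open>The derivative is taken within \<open>S\<close>, so that it is one-sided at an end point of an interval
  \<open>S\<close> that belongs to \<open>S\<close>.\<close>

definition C1_on :: "(real \<Rightarrow> real) \<Rightarrow> real set \<Rightarrow> bool" where
  "C1_on f S \<longleftrightarrow>
     (\<exists>g. (\<forall>x\<in>S. (f has_real_derivative g x) (at x within S)) \<and> continuous_on S g)"

text \<open>Only used for open \<open>S\<close>, where \<open>deriv f\<close> is the derivative.\<close>

definition C11_on :: "real \<Rightarrow> (real \<Rightarrow> real) \<Rightarrow> real set \<Rightarrow> bool" where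
  "C11_on L f S \<longleftrightarrow> C1_on f S \<and> L-lipschitz_on S (deriv f)"

text \<open>Jumps are allowed, unlike in \<open>piecewise_C1_differentiable_on\<close>.\<close>

definition piecewise_C1 :: "(real \<Rightarrow> real) \<Rightarrow> real set \<Rightarrow> bool" where
  "piecewise_C1 f S \<longleftrightarrow> (\<exists>F. finite F \<and> C1_on f (S - F))"

definition cuts :: "(nat \<Rightarrow> real \<Rightarrow> real) \<Rightarrow> nat \<Rightarrow> real \<Rightarrow> real set" where
  "cuts b p a = {b k a | k. k \<le> p}"


subsection \<open>Invariant measures\<close>

definition lborel01 :: "real measure" where
  "lborel01 = restrict_space lborel {0..1}"

definition acip :: "(real \<Rightarrow> real) \<Rightarrow> real measure \<Rightarrow> bool" where
  "acip f M \<longleftrightarrow> prob_space M \<and> sets M = sets lborel01 \<and> absolutely_continuous lborel01 M \<and>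
     f \<in> measurable M M \<and> distr M M f = M"

definition density_of :: "real measure \<Rightarrow> (real \<Rightarrow> real) \<Rightarrow> bool" where
  "density_of M \<phi> \<longleftrightarrow> \<phi> \<in> borel_measurable lborel01 \<and> (\<forall>x\<in>{0..1}. 0 \<le> \<phi> x) \<and>
     M = density lborel01 (\<lambda>x. ennreal (\<phi> x))"

definition supp :: "real measure \<Rightarrow> real set" where
  "supp M = {x \<in> space M. \<forall>U. open U \<and> x \<in> U \<longrightarrow> emeasure M (U \<inter> space M) > 0}"

definition empirical_measure :: "(real \<Rightarrow> real) \<Rightarrow> real \<Rightarrow> nat \<Rightarrow> real measure" where
  "empirical_measure f x n = distr (uniform_count_measure {..<n}) lborel01 (\<lambda>i. (f ^^ i) x)"

definition weak_star_conv :: "(nat \<Rightarrow> real measure) \<Rightarrow> real measure \<Rightarrow> bool" where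
  "weak_star_conv N M \<longleftrightarrow> (\<forall>g :: real \<Rightarrow> real. continuous_on {0..1} g \<longrightarrow>
     (\<lambda>n. integral\<^sup>L (N n) g) \<longlonglongrightarrow> integral\<^sup>L M g)"

definition typical :: "(real \<Rightarrow> real) \<Rightarrow> real measure \<Rightarrow> real \<Rightarrow> bool" where
  "typical f M x \<longleftrightarrow> weak_star_conv (empirical_measure f x) M"


subsection \<open>The family\<close>

definition expanding_map ::
  "real \<Rightarrow> real \<Rightarrow> real \<Rightarrow> (real \<Rightarrow> real) \<Rightarrow> nat \<Rightarrow> (nat \<Rightarrow> real) \<Rightarrow> bool" where
  "expanding_map L lam Lam f p c \<longleftrightarrow>
     f \<in> {0..1} \<rightarrow> {0..1} \<and>
     c 0 = 0 \<and> c p = 1 \<and> (\<forall>k\<in>{1..p}. c (k - 1) < c k) \<and>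
     (\<forall>k\<in>{1..p}. C11_on L f {c (k - 1) <..< c k}) \<and>
     (\<forall>x\<in>{0..1} - {c k | k. k \<le> p}. lam \<le> \<bar>deriv f x\<bar> \<and> \<bar>deriv f x\<bar> \<le> Lam)"

definition property_i :: "real set \<Rightarrow> real \<Rightarrow> nat \<Rightarrow> (nat \<Rightarrow> real \<Rightarrow> real) \<Rightarrow> bool" where
  "property_i I L p b \<longleftrightarrow>
     (\<forall>k\<le>p. L-lipschitz_on I (b k)) \<and>
     (\<exists>\<delta>>0. \<forall>k\<in>{1..p}. \<forall>a\<in>I. b k a - b (k - 1) a \<ge> \<delta>)"

definition property_ii ::
  "real set \<Rightarrow> real \<Rightarrow> (real \<Rightarrow> real \<Rightarrow> real) \<Rightarrow> nat \<Rightarrow> (nat \<Rightarrow> real \<Rightarrow> real) \<Rightarrow> bool" where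
  "property_ii I L T p b \<longleftrightarrow>
     (\<forall>x\<in>{0..1}. \<forall>J. is_interval J \<and> J \<subseteq> I \<and> (\<forall>a\<in>J. \<forall>k\<le>p. b k a \<noteq> x) \<longrightarrow>
        C1_on (\<lambda>a. T a x) J \<and>
        L-lipschitz_on J (\<lambda>a. T a x) \<and>
        L-lipschitz_on J (\<lambda>a. deriv (T a) x))"

text \<open>\<open>D 1 a, \<dots>, D p\<^sub>1 a\<close> is an enumeration without repetition of the components of
  \<open>K a - cuts b p a\<close>. These are bounded intervals, so their boundary points are their infimum and
  supremum.\<close>

definition property_iii ::
  "real set \<Rightarrow> (real \<Rightarrow> real set) \<Rightarrow> nat \<Rightarrow> (nat \<Rightarrow> real \<Rightarrow> real) \<Rightarrow>
   nat \<Rightarrow> (nat \<Rightarrow> real \<Rightarrow> real set) \<Rightarrow> bool" where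
  "property_iii I K p b p\<^sub>1 D \<longleftrightarrow>
     (\<forall>a\<in>I. bij_betw (\<lambda>k. D k a) {1..p\<^sub>1} (components (K a - cuts b p a))) \<and>
     (\<forall>k\<in>{1..p\<^sub>1}. continuous_on I (\<lambda>a. Inf (D k a)) \<and> continuous_on I (\<lambda>a. Sup (D k a)))"


subsection \<open>Partitions\<close>

definition maximal_open_intervals :: "(real set \<Rightarrow> bool) \<Rightarrow> real set set" where
  "maximal_open_intervals Q = {\<omega>. (\<exists>s t. s < t \<and> \<omega> = {s<..<t}) \<and> Q \<omega> \<and>
     (\<forall>s t. Q {s<..<t} \<and> \<omega> \<subseteq> {s<..<t} \<longrightarrow> {s<..<t} = \<omega>)}"

definition phase_partition ::
  "(real \<Rightarrow> real \<Rightarrow> real) \<Rightarrow> (real \<Rightarrow> real set) \<Rightarrow> nat \<Rightarrow> (nat \<Rightarrow> real \<Rightarrow> real) \<Rightarrow>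
   nat \<Rightarrow> real \<Rightarrow> real set set" where
  "phase_partition T K p b j a = maximal_open_intervals
     (\<lambda>\<omega>. \<omega> \<subseteq> K a \<and> (\<forall>i<j. (T a ^^ i) ` \<omega> \<inter> cuts b p a = {}))"

definition orbit :: "(real \<Rightarrow> real \<Rightarrow> real) \<Rightarrow> (real \<Rightarrow> real) \<Rightarrow> nat \<Rightarrow> real \<Rightarrow> real" where
  "orbit T X j a = (T a ^^ j) (X a)"

definition nondiff_set :: "real set \<Rightarrow> (real \<Rightarrow> real) \<Rightarrow> real set" where
  "nondiff_set I X = {a \<in> I. \<not> X differentiable (at a within I)}"

definition parameter_partition ::
  "real set \<Rightarrow> (real \<Rightarrow> real \<Rightarrow> real) \<Rightarrow> (real \<Rightarrow> real set) \<Rightarrow> nat \<Rightarrow> (nat \<Rightarrow> real \<Rightarrow> real) \<Rightarrow>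
   (real \<Rightarrow> real) \<Rightarrow> nat \<Rightarrow> real set set" where
  "parameter_partition I T K p b X j = maximal_open_intervals
     (\<lambda>\<omega>. \<omega> \<subseteq> interior I - nondiff_set I X \<and>
          (\<forall>a\<in>\<omega>. \<forall>i<j. orbit T X i a \<in> K a - cuts b p a))"

text \<open>Well defined for nonempty \<open>H\<close> contained in some \<open>D k a\<close>. This includes the images
  \<open>(T a ^^ i) ` \<omega>\<close>, \<open>i < j\<close>, of an element \<open>\<omega>\<close> of the \<open>j\<close>-th partition: they are connected and
  contained in \<open>K a - cuts b p a\<close>, since \<open>T a\<close> maps \<open>K a - cuts b p a\<close> into \<open>K a\<close>.\<close>

definition symb :: "nat \<Rightarrow> (nat \<Rightarrow> real \<Rightarrow> real set) \<Rightarrow> real \<Rightarrow> real set \<Rightarrow> nat" where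
  "symb p\<^sub>1 D a H = (THE k. k \<in> {1..p\<^sub>1} \<and> H \<subseteq> D k a)"


subsection \<open>Conditions\<close>

definition condition_I ::
  "real set \<Rightarrow> (real \<Rightarrow> real \<Rightarrow> real) \<Rightarrow> (real \<Rightarrow> real set) \<Rightarrow> nat \<Rightarrow> (nat \<Rightarrow> real \<Rightarrow> real) \<Rightarrow>
   (real \<Rightarrow> real) \<Rightarrow> bool" where
  "condition_I I T K p b X \<longleftrightarrow>
     (\<exists>C\<^sub>0\<ge>1. \<forall>j\<ge>1. \<forall>\<omega>\<in>parameter_partition I T K p b X j. \<forall>a\<in>\<omega>.
        1 / C\<^sub>0 \<le> \<bar>deriv (orbit T X j) a / deriv (T a ^^ j) (X a)\<bar> \<and>
        \<bar>deriv (orbit T X j) a / deriv (T a ^^ j) (X a)\<bar> \<le> C\<^sub>0) \<and>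
     (\<forall>j\<ge>1. finite (I - \<Union>(parameter_partition I T K p b X j)))"

definition condition_II ::
  "real set \<Rightarrow> (real \<Rightarrow> real measure) \<Rightarrow> (real \<Rightarrow> real \<Rightarrow> real) \<Rightarrow> bool" where
  "condition_II I \<mu> \<phi> \<longleftrightarrow>
     (\<exists>C\<^sub>1\<ge>1. \<forall>a\<in>I. AE x in \<mu> a. 1 / C\<^sub>1 \<le> \<phi> a x \<and> \<phi> a x \<le> C\<^sub>1)"

definition condition_III ::
  "real set \<Rightarrow> (real \<Rightarrow> real \<Rightarrow> real) \<Rightarrow> (real \<Rightarrow> real set) \<Rightarrow> nat \<Rightarrow> (nat \<Rightarrow> real \<Rightarrow> real) \<Rightarrow>
   nat \<Rightarrow> (nat \<Rightarrow> real \<Rightarrow> real set) \<Rightarrow> bool" where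
  "condition_III I T K p b p\<^sub>1 D \<longleftrightarrow>
     (\<exists>C\<^sub>2. \<forall>a\<^sub>1\<in>I. \<forall>a\<^sub>2\<in>I. a\<^sub>1 \<le> a\<^sub>2 \<longrightarrow> (\<forall>j\<ge>1.
        \<exists>\<U> \<in> phase_partition T K p b j a\<^sub>1 \<rightarrow> phase_partition T K p b j a\<^sub>2.
          \<forall>\<omega> \<in> phase_partition T K p b j a\<^sub>1.
            (\<forall>i<j. symb p\<^sub>1 D a\<^sub>1 ((T a\<^sub>1 ^^ i) ` \<omega>) = symb p\<^sub>1 D a\<^sub>2 ((T a\<^sub>2 ^^ i) ` \<U> \<omega>)) \<and>
            setdist ((T a\<^sub>1 ^^ j) ` \<omega>) ((T a\<^sub>2 ^^ j) ` \<U> \<omega>) \<le> C\<^sub>2 * \<bar>a\<^sub>1 - a\<^sub>2\<bar> \<and>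
            measure lborel ((T a\<^sub>1 ^^ j) ` \<omega>) \<le> C\<^sub>2 * measure lborel ((T a\<^sub>2 ^^ j) ` \<U> \<omega>)))"

end

theory Submission
  imports Defs
begin

text \<open>
  By uniqueness of the absolutely continuous invariant measure and weak compactness, \<open>X a\<close> is
  typical as soon as every limit of the empirical measures along the orbit \<open>x j a\<close> is absolutely
  continuous. Condition (I) makes \<open>x j\<close> a map of bounded distortion on each cell \<open>U\<close> of the
  \<open>j\<close>-th parameter partition, so within a cell whose image is not short, \<open>x j a\<close> falls into an
  interval with conditional probability at most a constant times its length. It remains to see
  that short images are rare along almost every orbit. Over a fixed number \<open>M\<close> of steps, images
  expand by much more than the factor lost by cutting, provided that a short image is cut at most
  once. The latter holds for the single map \<open>T a\<close>, and it is inherited by the family because the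
  parameters in a cell of level \<open>j\<close> differ by exponentially less than the length of its image: up
  to a set of parameters to which the Borel-Cantelli lemma applies, all maps in the cell produce
  the same pieces. Both frequency estimates come from products of one-step factors of conditional
  mean at most one, which almost surely grow at most quadratically.
\<close>

text \<open>What counts as a short image cannot be fixed in advance: it depends on the gaps between
  the finitely many points of \<open>precuts M a\<close>, and no bound on them uniform in
  \<open>a\<close> is at hand. So the growth estimate is proved almost surely for all natural
  numbers \<open>\<kappa>\<close> at once; \<open>\<kappa>\<close> is then chosen for each
  \<open>a\<close>, and the threshold \<open>H\<close> after it. Only \<open>M\<close> is fixed at
  the start, by \<open>4 * distort \<le> lam ^ M\<close>: two pieces, each stretched at least
  fourfold after paying for distortion, halve the mean of the reciprocal length \<open>W\<close> of
  a short image, and this drift drives the estimate. The potential is \<open>1 + W / H\<close>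
  rather than \<open>W\<close>, so that long images, which may be cut many times, contribute only an
  additive error of order \<open>\<kappa>\<^sup>2 / H\<close>, which disappears for large
  \<open>H\<close>. Both supermartingale arguments look \<open>M\<close> levels ahead, hence the
  passage through arithmetic progressions of step \<open>M\<close>.\<close>

text \<open>A counting device used twice: pieces of a cell are represented by points, the cuts
  between them by separators. Sending a point to the number of separators on its left is strictly
  increasing, hence injective.\<close>

lemma card_le_separators:
  fixes Y S :: "real set"
  assumes "finite S" and "\<And>y y'. y \<in> Y \<Longrightarrow> y' \<in> Y \<Longrightarrow> y < y' \<Longrightarrow> \<exists>s\<in>S. y < s \<and> s < y'"
  shows "finite Y \<and> card Y \<le> card S + 1"
proof -
  define f where "f y = card {s\<in>S. s < y}" for y
  have mono: "f y < f y'" if "y \<in> Y" "y' \<in> Y" "y < y'" for y y'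
  proof -
    obtain s where "s \<in> S" "y < s" "s < y'" using assms(2) \<open>y \<in> Y\<close> \<open>y' \<in> Y\<close> \<open>y < y'\<close> by blast
    then have "s \<in> {s\<in>S. s < y'} - {s\<in>S. s < y}" "{s\<in>S. s < y} \<subseteq> {s\<in>S. s < y'}"
      using that by auto
    then have "{s\<in>S. s < y} \<subset> {s\<in>S. s < y'}" by blast
    then show ?thesis unfolding f_def using assms(1) by (intro psubset_card_mono) auto
  qed
  have inj: "inj_on f Y"
    by (rule inj_onI) (metis mono linorder_neqE less_irrefl)
  have sub: "f ` Y \<subseteq> {..card S}"
    using assms(1) by (auto simp: f_def intro!: card_mono)
  have "finite Y" using finite_imageD[OF finite_subset[OF sub] inj] by simp
  moreover have "card Y \<le> card {..card S}" using card_inj_on_le[OF inj sub] by simp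
  ultimately show ?thesis by simp
qed

text \<open>Encloses a set of unknown measurability in an interval of controlled length; the
  parameters whose orbit comes too close to a cut are estimated this way.\<close>

lemma bounded_diameter_imp_interval:
  fixes S :: "real set"
  assumes "\<And>u v. u \<in> S \<Longrightarrow> v \<in> S \<Longrightarrow> u \<le> v \<Longrightarrow> v - u \<le> d"
  shows "\<exists>c. S \<subseteq> {c..c + d}"
proof (cases "S = {}")
  case False
  then obtain w where w: "w \<in> S" by auto
  have d: "0 \<le> d" using assms[OF w w] by simp
  have le: "v - d \<le> u" if "u \<in> S" "v \<in> S" for u v
    using assms[OF that] d by (cases "u \<le> v") linarith+
  have bdd: "bdd_below S" using le[OF _ w] by (rule bdd_belowI)
  have "v \<le> Inf S + d" if "v \<in> S" for v
    using cInf_greatest[OF False le[OF _ that]] by simp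
  then show ?thesis using cInf_lower[OF _ bdd] by (intro exI[of _ "Inf S"]) auto
qed auto


subsection \<open>Upper frequencies\<close>

text \<open>Upper density at most \<open>\<beta>\<close>, that is, a bound on the limsup of the
  proportions; in this form finitely many bounds combine under \<open>eventually\<close>.\<close>

definition freq_le :: "(nat \<Rightarrow> bool) \<Rightarrow> real \<Rightarrow> bool" where
  "freq_le A \<beta> \<longleftrightarrow>
     (\<forall>\<epsilon>>0. \<forall>\<^sub>F n in sequentially. real (card {i. i < n \<and> A i}) \<le> (\<beta> + \<epsilon>) * real n)"

lemma freq_le_mono:
  assumes "freq_le A \<beta>" "\<And>i. B i \<Longrightarrow> A i" "\<beta> \<le> \<gamma>"
  shows "freq_le B \<gamma>"
  unfolding freq_le_def
proof (intro allI impI)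
  fix \<epsilon> :: real assume "\<epsilon> > 0"
  then have "\<forall>\<^sub>F n in sequentially. real (card {i. i < n \<and> A i}) \<le> (\<beta> + \<epsilon>) * real n"
    using assms(1) by (auto simp: freq_le_def)
  then show "\<forall>\<^sub>F n in sequentially. real (card {i. i < n \<and> B i}) \<le> (\<gamma> + \<epsilon>) * real n"
  proof eventually_elim
    case (elim n)
    have "card {i. i < n \<and> B i} \<le> card {i. i < n \<and> A i}" using assms(2) by (intro card_mono) auto
    moreover have "(\<beta> + \<epsilon>) * real n \<le> (\<gamma> + \<epsilon>) * real n"
      using assms(3) by (intro mult_right_mono) auto
    ultimately show ?case using elim by linarith
  qed
qed

text \<open>After taking logarithms the factor \<open>K * real n ^ 2\<close> contributes only
  \<open>o(n)\<close>, and \<open>ln (1 + q) \<le> q\<close> gives the rate.\<close>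

lemma freq_le_exponential:
  assumes "c > 1" "0 \<le> q" "0 < K"
    and "\<forall>\<^sub>F n in sequentially. c ^ card {i. i < n \<and> A i} \<le> K * real n ^ 2 * (1 + q) ^ n"
  shows "freq_le A (q / ln c)"
  unfolding freq_le_def
proof (intro allI impI)
  fix \<epsilon> :: real assume e: "\<epsilon> > 0"
  have lc: "ln c > 0" using assms(1) by simp
  have "(\<lambda>n. ln K / real n + 2 * (ln (real n) / real n)) \<longlonglongrightarrow> 0 + 2 * 0"
    by (intro tendsto_add tendsto_mult tendsto_const lim_const_over_n lim_ln_over_n)
  then have "(\<lambda>n. (ln K + 2 * ln (real n)) / real n) \<longlonglongrightarrow> 0"
    by (simp add: add_divide_distrib)
  then have "\<forall>\<^sub>F n in sequentially. (ln K + 2 * ln (real n)) / real n < \<epsilon> * ln c"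
    using e lc by (intro order_tendstoD) auto
  with assms(4) eventually_gt_at_top[of 0]
  show "\<forall>\<^sub>F n in sequentially. real (card {i. i < n \<and> A i}) \<le> (q / ln c + \<epsilon>) * real n"
  proof eventually_elim
    case (elim n)
    let ?k = "card {i. i < n \<and> A i}"
    have "real ?k * ln c = ln (c ^ ?k)" using assms(1) by (simp add: ln_realpow)
    also have "\<dots> \<le> ln (K * real n ^ 2 * (1 + q) ^ n)"
      using elim assms by (subst ln_le_cancel_iff) auto
    also have "\<dots> = ln K + 2 * ln (real n) + real n * ln (1 + q)"
      using elim assms by (simp add: ln_mult ln_realpow)
    also have "\<dots> \<le> \<epsilon> * ln c * real n + real n * q"
    proof -
      have "ln (1 + q) \<le> q" using assms by (simp add: ln_add_one_self_le_self)
      moreover have "ln K + 2 * ln (real n) \<le> \<epsilon> * ln c * real n"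
        using elim by (simp add: divide_less_eq)
      ultimately show ?thesis by (intro add_mono mult_left_mono) auto
    qed
    finally have "real ?k \<le> (\<epsilon> * ln c * real n + real n * q) / ln c"
      using lc by (simp add: le_divide_eq)
    also have "\<dots> = (q / ln c + \<epsilon>) * real n" using lc by (simp add: field_simps)
    finally show ?case .
  qed
qed

text \<open>Each residue class modulo \<open>M\<close> contributes about
  \<open>\<beta> * n / M\<close> indices below \<open>n\<close>, so the \<open>M\<close> classes add
  up to \<open>\<beta> * n\<close>; the first \<open>t0\<close> indices and the rounding of
  \<open>n / M\<close> cost a bounded amount.\<close>

lemma freq_le_residues:
  assumes M: "M \<ge> 1" and "0 \<le> \<beta>" and t: "\<And>t. t \<ge> t0 \<Longrightarrow> freq_le (\<lambda>i. A (t + i * M)) \<beta>"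
  shows "freq_le A \<beta>"
  unfolding freq_le_def
proof (intro allI impI)
  fix \<epsilon> :: real assume e: "\<epsilon> > 0"
  let ?S = "\<lambda>s m. {i. i < m \<and> A (t0 + s + i * M)}"
  have "\<forall>s\<in>{..<M}. \<forall>\<^sub>F m in sequentially. real (card (?S s m)) \<le> (\<beta> + \<epsilon>/2) * real m"
    using t e by (auto simp: freq_le_def)
  then have "\<forall>\<^sub>F m in sequentially. \<forall>s\<in>{..<M}. real (card (?S s m)) \<le> (\<beta> + \<epsilon>/2) * real m"
    by (simp add: eventually_ball_finite)
  moreover have "filterlim (\<lambda>n. n div M + 1) at_top sequentially"
    unfolding filterlim_at_top
  proof
    fix Z
    show "\<forall>\<^sub>F n in sequentially. Z \<le> n div M + 1"
      using eventually_ge_at_top[of "Z * M"]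
    proof eventually_elim
      case (elim n)
      have "Z * M div M \<le> n div M" using elim by (rule div_le_mono)
      then show ?case using M by simp
    qed
  qed
  ultimately have 1: "\<forall>\<^sub>F n in sequentially.
      \<forall>s\<in>{..<M}. real (card (?S s (n div M + 1))) \<le> (\<beta> + \<epsilon>/2) * real (n div M + 1)"
    by (rule eventually_compose_filterlim)
  \<comment> \<open>From \<open>N\<close> on, \<open>\<epsilon>/2 * n\<close> absorbs the
    \<open>t0\<close> initial indices and the rounding error
    \<open>(\<beta> + \<epsilon>/2) * M\<close>.\<close>
  obtain N :: nat where N: "(real t0 + (\<beta> + \<epsilon>/2) * M) / (\<epsilon>/2) \<le> N" using real_arch_simple by blast
  show "\<forall>\<^sub>F n in sequentially. real (card {i. i < n \<and> A i}) \<le> (\<beta> + \<epsilon>) * real n"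
    using 1 eventually_ge_at_top[of N]
  proof eventually_elim
    case (elim n)
    let ?m = "n div M + 1"
    have sub: "{i. i < n \<and> A i} \<subseteq> {..<t0} \<union> (\<Union>s<M. (\<lambda>i. t0 + s + i * M) ` ?S s ?m)"
    proof
      fix j assume j: "j \<in> {i. i < n \<and> A i}"
      show "j \<in> {..<t0} \<union> (\<Union>s<M. (\<lambda>i. t0 + s + i * M) ` ?S s ?m)"
      proof (cases "j < t0")
        case False
        define s i where "s = (j - t0) mod M" and "i = (j - t0) div M"
        have eq: "j = t0 + s + i * M" using False by (simp add: s_def i_def)
        have "s < M" using M by (simp add: s_def)
        moreover have "i < ?m" using j by (auto simp: i_def less_Suc_eq_le intro!: div_le_mono)
        ultimately have "j \<in> (\<lambda>i. t0 + s + i * M) ` ?S s ?m" using j eq by auto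
        then show ?thesis using \<open>s < M\<close> by blast
      qed auto
    qed
    have "card {i. i < n \<and> A i} \<le> card ({..<t0} \<union> (\<Union>s<M. (\<lambda>i. t0 + s + i * M) ` ?S s ?m))"
      by (rule card_mono[OF _ sub]) auto
    also have "\<dots> \<le> t0 + card (\<Union>s<M. (\<lambda>i. t0 + s + i * M) ` ?S s ?m)"
      by (rule order_trans[OF card_Un_le]) simp
    also have "\<dots> \<le> t0 + (\<Sum>s<M. card (?S s ?m))"
      by (intro add_left_mono order_trans[OF card_UN_le] sum_mono card_image_le) auto
    finally have "real (card {i. i < n \<and> A i}) \<le> real (t0 + (\<Sum>s<M. card (?S s ?m)))"
      by (rule of_nat_mono)
    also have "\<dots> = real t0 + (\<Sum>s<M. real (card (?S s ?m)))"
      by (simp only: of_nat_add of_nat_sum)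
    also have "\<dots> \<le> real t0 + (\<Sum>s<M. (\<beta> + \<epsilon>/2) * real ?m)"
      using elim by (intro add_left_mono sum_mono) auto
    also have "\<dots> = real t0 + (\<beta> + \<epsilon>/2) * real (M * (n div M) + M)"
    proof -
      have "(\<Sum>s<M. c * real (k + 1)) = c * real (M * k + M)" for c k
        by (simp add: algebra_simps)
      then show ?thesis by (simp only:)
    qed
    also have "\<dots> \<le> real t0 + (\<beta> + \<epsilon>/2) * (real n + real M)"
    proof -
      have "real (M * (n div M) + M) \<le> real n + real M"
        by (simp only: of_nat_add[symmetric] of_nat_le_iff) (simp add: times_div_less_eq_dividend)
      then show ?thesis using e assms(2) by (intro add_left_mono mult_left_mono) auto
    qed
    also have "\<dots> \<le> (\<beta> + \<epsilon>) * real n"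
    proof -
      have "real t0 + (\<beta> + \<epsilon>/2) * M \<le> \<epsilon>/2 * N" using N e by (simp add: divide_le_eq mult.commute)
      also have "\<dots> \<le> \<epsilon>/2 * n" using elim e by simp
      finally have "real t0 + (\<beta> + \<epsilon>/2) * M + (\<beta> + \<epsilon>/2) * n \<le> \<epsilon>/2 * n + (\<beta> + \<epsilon>/2) * n"
        by simp
      also have "\<dots> = (\<beta> + \<epsilon>) * real n" by (simp add: field_simps)
      finally show ?thesis by (simp only: distrib_left)
    qed
    finally show ?case .
  qed
qed


subsection \<open>Multiplicative supermartingales on nested partitions\<close>

abbreviation len :: "real set \<Rightarrow> real" where
  "len \<equiv> measure lborel"

definition cell :: "real set set \<Rightarrow> real \<Rightarrow> real set" where
  "cell \<P> a = (THE U. U \<in> \<P> \<and> a \<in> U)"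

text \<open>A filtration given by the finite families of its atoms. Atoms of the next level may
  leave part of their parent uncovered, so lengths satisfy inequalities only, and pointwise claims
  are restricted to \<open>covered\<close> points.\<close>

locale nested_partitions =
  fixes P :: "nat \<Rightarrow> real set set"
  assumes finite_P: "finite (P n)"
    and fmeasurable_P: "U \<in> P n \<Longrightarrow> U \<in> fmeasurable lborel"
    and nonempty_P: "U \<in> P n \<Longrightarrow> U \<noteq> {}"
    and disjoint_P: "U \<in> P n \<Longrightarrow> U' \<in> P n \<Longrightarrow> a \<in> U \<Longrightarrow> a \<in> U' \<Longrightarrow> U = U'"
    and nested_Suc: "U \<in> P (Suc n) \<Longrightarrow> \<exists>U'\<in>P n. U \<subseteq> U'"
begin

abbreviation covered :: "real \<Rightarrow> bool" where
  "covered a \<equiv> \<forall>n. a \<in> \<Union>(P n)"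

abbreviation children :: "nat \<Rightarrow> real set \<Rightarrow> real set set" where
  "children n U \<equiv> {U' \<in> P n. U' \<subseteq> U}"

lemma nested: "U \<in> P (n + k) \<Longrightarrow> \<exists>U'\<in>P n. U \<subseteq> U'"
proof (induction k arbitrary: U)
  case (Suc k)
  have "U \<in> P (Suc (n + k))" using Suc.prems by simp
  then obtain U' where "U' \<in> P (n + k)" "U \<subseteq> U'" using nested_Suc by blast
  then show ?case using Suc.IH[of U'] by blast
next
  case 0
  then have "U \<in> P n" by simp
  then show ?case by blast
qed

lemma nested_le: "m \<le> n \<Longrightarrow> U \<in> P n \<Longrightarrow> \<exists>U'\<in>P m. U \<subseteq> U'"
  using nested[of U m "n - m"] by simp

lemma cell_eq: "U \<in> P n \<Longrightarrow> a \<in> U \<Longrightarrow> cell (P n) a = U"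
  unfolding cell_def by (rule the_equality) (auto dest: disjoint_P)

lemma cell_in: "a \<in> \<Union>(P n) \<Longrightarrow> cell (P n) a \<in> P n \<and> a \<in> cell (P n) a"
proof -
  assume "a \<in> \<Union>(P n)"
  then obtain U where U: "U \<in> P n" "a \<in> U" by blast
  show ?thesis unfolding cell_eq[OF U] using U by simp
qed

lemma cell_cong: "m \<le> n \<Longrightarrow> U \<in> P n \<Longrightarrow> a \<in> U \<Longrightarrow> a' \<in> U \<Longrightarrow> cell (P m) a = cell (P m) a'"
proof -
  assume *: "m \<le> n" "U \<in> P n" "a \<in> U" "a' \<in> U"
  then obtain U' where U': "U' \<in> P m" "U \<subseteq> U'" using nested_le by blast
  have "cell (P m) a = U'" by (rule cell_eq) (use * U' in auto)
  moreover have "cell (P m) a' = U'" by (rule cell_eq) (use * U' in auto)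
  ultimately show ?thesis by simp
qed

lemma sum_children:
  "(\<Sum>U'\<in>P (n + k). f U') = (\<Sum>U\<in>P n. \<Sum>U' | U' \<in> P (n + k) \<and> U' \<subseteq> U. f U')"
proof -
  have "P (n + k) = (\<Union>U\<in>P n. {U' \<in> P (n + k). U' \<subseteq> U})"
  proof (intro equalityI subsetI)
    fix U' assume *: "U' \<in> P (n + k)"
    obtain U where "U \<in> P n" "U' \<subseteq> U" using nested[OF *] by auto
    then show "U' \<in> (\<Union>U\<in>P n. {U' \<in> P (n + k). U' \<subseteq> U})" using * by auto
  qed auto
  then have "(\<Sum>U'\<in>P (n + k). f U') = sum f (\<Union>U\<in>P n. {U' \<in> P (n + k). U' \<subseteq> U})"
    by presburger
  also have "\<dots> = (\<Sum>U\<in>P n. \<Sum>U' | U' \<in> P (n + k) \<and> U' \<subseteq> U. f U')"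
  proof (rule sum.UNION_disjoint)
    show "\<forall>U\<in>P n. \<forall>U'\<in>P n. U \<noteq> U' \<longrightarrow>
        {U'\<in>P (n + k). U' \<subseteq> U} \<inter> {U''\<in>P (n + k). U'' \<subseteq> U'} = {}"
    proof (intro ballI impI equals0I)
      fix U U' U''
      assume *: "U \<in> P n" "U' \<in> P n" "U \<noteq> U'"
        "U'' \<in> {U'\<in>P (n + k). U' \<subseteq> U} \<inter> {U''\<in>P (n + k). U'' \<subseteq> U'}"
      then obtain a where "a \<in> U''" using nonempty_P[of U'' "n + k"] by auto
      then show False using * disjoint_P[of U n U' a] by auto
    qed
  qed (auto simp: finite_P)
  finally show ?thesis .
qed

lemma sum_measure_le:
  assumes "C \<subseteq> P n" "\<Union>C \<subseteq> S" "S \<in> fmeasurable lborel"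
  shows "(\<Sum>U\<in>C. len U) \<le> len S"
proof -
  have fin: "finite C" using assms(1) finite_P finite_subset by blast
  have m: "U \<in> fmeasurable lborel" if "U \<in> C" for U using assms(1) fmeasurable_P that by blast
  have "(\<Sum>U\<in>C. len U) = len (\<Union>C)"
  proof (intro measure_Union'[symmetric] fin m)
    show "pairwise disjnt C"
    proof (rule pairwiseI, rule ccontr)
      fix U U' assume *: "U \<in> C" "U' \<in> C" "U \<noteq> U'" "\<not> disjnt U U'"
      then obtain a where "a \<in> U" "a \<in> U'" by (auto simp: disjnt_def)
      then show False using * assms(1) disjoint_P[of U n U' a] by auto
    qed
  qed
  also have "\<dots> \<le> len S"
    using assms(2,3) m by (intro measure_mono_fmeasurable sets.finite_Union[OF fin]) (auto simp: fmeasurable_def)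
  finally show ?thesis .
qed

text \<open>\<open>G i U'\<close> is the factor gained on entering the atom \<open>U'\<close> of
  level \<open>i + 1\<close>. The second assumption says that its mean conditional on the parent
  \<open>U\<close> is at most 1, so the products below form a nonnegative supermartingale.\<close>

context
  fixes G :: "nat \<Rightarrow> real set \<Rightarrow> real"
  assumes G_nonneg: "\<And>i U. 0 \<le> G i U"
    and G_mean: "\<And>i U. U \<in> P i \<Longrightarrow>
      (\<Sum>U' | U' \<in> P (Suc i) \<and> U' \<subseteq> U. G i U' * len U') \<le> len U"
begin

text \<open>The expectation of a supermartingale does not increase. The product of the first
  \<open>n\<close> factors is constant on atoms of level \<open>n\<close>, so it may be evaluated at
  any chosen point; grouping atoms by their parents splits off the last factor.\<close>

lemma sum_prod_le:
  "(\<Sum>U\<in>P n. (\<Prod>i<n. G i (cell (P (Suc i)) (SOME a. a \<in> U))) * len U)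
     \<le> (\<Sum>U\<in>P 0. len U)"
proof (induction n)
  case (Suc n)
  let ?Q = "\<lambda>n U. \<Prod>i<n. G i (cell (P (Suc i)) (SOME a. a \<in> U))"
  have some: "(SOME a. a \<in> U) \<in> U" if "U \<in> P k" for U k
    using nonempty_P[OF that] by (simp add: some_in_eq)
  have Q: "?Q (Suc n) U' = ?Q n U * G n U'"
    if "U \<in> P n" "U' \<in> P (Suc n)" "U' \<subseteq> U" for U U'
  proof -
    have "cell (P (Suc n)) (SOME a. a \<in> U') = U'" by (rule cell_eq[OF that(2) some[OF that(2)]])
    moreover have "?Q n U' = ?Q n U"
    proof (rule prod.cong[OF refl], rule arg_cong[where f="G _"])
      fix i assume "i \<in> {..<n}"
      then show "cell (P (Suc i)) (SOME a. a \<in> U') = cell (P (Suc i)) (SOME a. a \<in> U)"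
        using that(1,3) some[OF that(2)] some[OF that(1)]
        by (intro cell_cong[of _ n U]) auto
    qed
    ultimately show ?thesis by (simp only: prod.lessThan_Suc)
  qed
  have "(\<Sum>U\<in>P (Suc n). ?Q (Suc n) U * len U) =
      (\<Sum>U\<in>P n. \<Sum>U' | U' \<in> P (Suc n) \<and> U' \<subseteq> U. ?Q (Suc n) U' * len U')"
    by (rule sum_children[of _ n 1, unfolded One_nat_def add_Suc_right add_0_right])
  also have "\<dots> = (\<Sum>U\<in>P n. ?Q n U * (\<Sum>U' | U' \<in> P (Suc n) \<and> U' \<subseteq> U. G n U' * len U'))"
    unfolding sum_distrib_left
  proof (intro sum.cong refl)
    fix U U' assume "U \<in> P n" "U' \<in> {U' \<in> P (Suc n). U' \<subseteq> U}"
    then have "?Q (Suc n) U' = ?Q n U * G n U'" by (intro Q) auto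
    then show "?Q (Suc n) U' * len U' = ?Q n U * (G n U' * len U')"
      by (simp only: mult.assoc)
  qed
  also have "\<dots> \<le> (\<Sum>U\<in>P n. ?Q n U * len U)"
    by (intro sum_mono mult_left_mono G_mean prod_nonneg) (auto simp: G_nonneg)
  finally show ?case using Suc.IH by linarith
qed simp

text \<open>By Markov's inequality the product exceeds \<open>real n ^ 2\<close> on a set of length
  at most \<open>C / real n ^ 2\<close>. This is summable, so Borel-Cantelli applies.\<close>

lemma AE_prod_le:
  "AE a in lborel. covered a \<longrightarrow>
     (\<forall>\<^sub>F n in sequentially. (\<Prod>i<n. G i (cell (P (Suc i)) a)) \<le> real n ^ 2)"
proof -
  let ?Q = "\<lambda>n a. \<Prod>i<n. G i (cell (P (Suc i)) a)"
  let ?pt = "\<lambda>U. SOME a. a \<in> U"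
  define B where "B n = {U\<in>P n. ?Q n (?pt U) > real n ^ 2}" for n
  define A where "A n = \<Union>(B n)" for n
  define C where "C = (\<Sum>U\<in>P 0. len U)"
  have fin: "finite (B n)" for n using finite_P by (simp add: B_def)
  have meas: "U \<in> fmeasurable lborel" if "U \<in> B n" for U n using that fmeasurable_P by (auto simp: B_def)
  have A: "A n \<in> fmeasurable lborel" for n
    unfolding A_def by (rule fmeasurable.finite_Union[OF fin]) (use meas in blast)
  have le: "len (A n) \<le> C / real n ^ 2" if "n > 0" for n
  proof -
    have "real n ^ 2 * len (A n) \<le> real n ^ 2 * (\<Sum>U\<in>B n. len U)"
      unfolding A_def using fin by (intro mult_left_mono measure_Union_le) (auto dest!: meas fmeasurableD)
    also have "\<dots> = (\<Sum>U\<in>B n. real n ^ 2 * len U)" by (simp add: sum_distrib_left)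
    also have "\<dots> \<le> (\<Sum>U\<in>B n. ?Q n (?pt U) * len U)"
      by (intro sum_mono mult_right_mono) (auto simp: B_def)
    also have "\<dots> \<le> (\<Sum>U\<in>P n. ?Q n (?pt U) * len U)"
      using finite_P G_nonneg by (intro sum_mono2) (auto simp: B_def intro!: mult_nonneg_nonneg prod_nonneg)
    also have "\<dots> \<le> C" unfolding C_def by (rule sum_prod_le)
    finally have "len (A n) * real n ^ 2 \<le> C" by (simp only: mult.commute)
    then show ?thesis using that by (simp add: pos_le_divide_eq)
  qed
  have "summable (\<lambda>n. C * (1 / real n ^ 2))"
    by (intro summable_mult) (use inverse_power_summable[of 2, where 'a=real] in \<open>simp add: inverse_eq_divide\<close>)
  then have "summable (\<lambda>n. len (A n))"
    by (rule summable_comparison_test'[of _ 1]) (use le in auto)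
  then have "AE a in lborel. \<forall>\<^sub>F n in sequentially. a \<in> space lborel - A n"
    using A by (intro borel_cantelli_AE1) (auto simp: fmeasurable_def)
  then show ?thesis
  proof eventually_elim
    case (elim a)
    show ?case
    proof
      assume a: "covered a"
      from elim show "\<forall>\<^sub>F n in sequentially. ?Q n a \<le> real n ^ 2"
      proof eventually_elim
        case (elim n)
        obtain U where U: "U \<in> P n" "a \<in> U" using a by blast
        have "?pt U \<in> U" using U by (meson someI)
        then have "?Q n a = ?Q n (?pt U)"
          using U by (intro prod.cong refl arg_cong[where f="G _"] cell_cong[of _ n U]) auto
        moreover have "U \<notin> B n" using elim U by (auto simp: A_def)
        ultimately show ?case using U by (auto simp: B_def)
      qed
    qed
  qed
qed

end

end


subsection \<open>Limits of empirical measures\<close>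

text \<open>For such a sequence, limits of the empirical measures are absolutely continuous.\<close>

definition no_concentration :: "(nat \<Rightarrow> real) \<Rightarrow> bool" where
  "no_concentration y \<longleftrightarrow> (\<forall>\<epsilon>>0. \<exists>C A. freq_le (\<lambda>j. \<not> A j) \<epsilon> \<and>
     (\<forall>u\<in>\<rat>. \<forall>v\<in>\<rat>. u < v \<longrightarrow> freq_le (\<lambda>j. A j \<and> y j \<in> {u..v}) (C * (v - u))))"

text \<open>The deterministic half of the proof: one map and one orbit. The orbit avoids
  \<open>Z\<close>, which contains all discontinuities in the unit interval, and
  \<open>sparse\<close> is what the almost sure estimates deliver for it.\<close>

locale sparse_orbit =
  fixes f :: "real \<Rightarrow> real" and Z :: "real set" and \<mu> :: "real measure" and x0 :: real
  assumes f01: "f \<in> {0..1} \<rightarrow> {0..1}"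
    and finite_Z: "finite Z" and Z01: "0 \<in> Z" "1 \<in> Z"
    and cont_f: "\<And>x. x \<in> {0..1} - Z \<Longrightarrow> isCont f x"
    and acip: "acip f \<mu>" and unique: "\<And>M. acip f M \<Longrightarrow> M = \<mu>"
    and x0: "x0 \<in> {0..1}" and orbit_Z: "\<And>j. (f ^^ j) x0 \<notin> Z"
    and sparse: "no_concentration (\<lambda>j. (f ^^ j) x0)"
begin

abbreviation "orb j \<equiv> (f ^^ j) x0"

text \<open>Measures on the whole line, so that tightness and weak convergence of real distributions
  apply. The shift by one avoids the empty average, which is not a probability measure.\<close>

definition emp :: "nat \<Rightarrow> real measure" where
  "emp n = distr (uniform_count_measure {..<Suc n}) borel orb"

lemma orb01: "orb j \<in> {0..1}"
  by (induction j) (use x0 f01 in auto)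

lemma real_distribution_emp: "real_distribution (emp n)"
proof -
  interpret prob_space "uniform_count_measure {..<Suc n}"
    by (rule prob_space_uniform_count_measure) auto
  show ?thesis
    unfolding emp_def real_distribution_def real_distribution_axioms_def
    by (auto intro!: prob_space_distr simp: measurable_def)
qed

lemma measurable_orb: "orb \<in> measurable (uniform_count_measure S) M" if "\<And>j. orb j \<in> space M"
  using that by (auto simp: measurable_def space_uniform_count_measure sets_uniform_count_measure)

lemma integral_emp:
  fixes g :: "real \<Rightarrow> real"
  assumes "g \<in> borel_measurable borel"
  shows "integral\<^sup>L (emp n) g = (\<Sum>j<Suc n. g (orb j)) / Suc n"
  unfolding emp_def
  by (subst integral_distr[OF measurable_orb assms])
    (simp_all add: integral_uniform_count_measure del: sum.lessThan_Suc)

lemma tight_emp: "tight emp"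
  unfolding tight_def
proof (intro conjI allI impI real_distribution_emp)
  fix \<epsilon> :: real assume "\<epsilon> > 0"
  have "measure (emp n) {-1<..1} = 1" for n
  proof -
    have "measure (emp n) {-1<..1} = measure (uniform_count_measure {..<Suc n}) (orb -` {-1<..1} \<inter> {..<Suc n})"
      unfolding emp_def by (subst measure_distr) (auto simp: measurable_def space_uniform_count_measure)
    also have "orb -` {-1<..1} \<inter> {..<Suc n} = {..<Suc n}"
    proof -
      have "orb j \<in> {-1<..1}" for j using orb01[of j] by auto
      then show ?thesis by blast
    qed
    finally show ?thesis by (simp add: measure_uniform_count_measure)
  qed
  then show "\<exists>a b. a < b \<and> (\<forall>n. 1 - \<epsilon> < measure (emp n) {a<..b})"
    using \<open>\<epsilon> > 0\<close> by (intro exI[of _ "-1"] exI[of _ 1]) auto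
qed

text \<open>Off \<open>Z\<close>, orbits of this map are orbits of \<open>f\<close>, and it is continuous on the whole line
  outside \<open>Z\<close>.\<close>

definition f' :: "real \<Rightarrow> real" where
  "f' x = (if x \<in> {0..1} - Z then f x else 0)"

lemma isCont_f': "x \<notin> Z \<Longrightarrow> isCont f' x"
proof -
  assume x: "x \<notin> Z"
  show ?thesis
  proof (cases "x \<in> {0..1}")
    case True
    then have "x \<in> {0<..<1} - Z" using x Z01 by (auto simp: less_le)
    moreover have "open ({0<..<1} - Z)" using finite_Z by (intro open_Diff finite_imp_closed) auto
    ultimately have "\<forall>\<^sub>F y in nhds x. f' y = f y"
      by (auto simp: eventually_nhds f'_def intro!: exI[of _ "{0<..<1} - Z"])
    then show ?thesis using cont_f[of x] True x by (subst isCont_cong) auto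
  next
    case False
    then have "\<forall>\<^sub>F y in nhds x. f' y = 0"
      by (auto simp: eventually_nhds f'_def intro!: exI[of _ "- {0..1}"])
    then show ?thesis by (subst isCont_cong[where g="\<lambda>_. 0"]) auto
  qed
qed

lemma measurable_f' [measurable]: "f' \<in> borel_measurable borel"
  using finite_Z isCont_f'
  by (intro borel_measurable_continuous_countable_exceptions[of Z])
     (auto simp: countable_finite intro: continuous_at_imp_continuous_on)

section \<open>Identification of a subsequential weak limit of the empirical measures\<close>

context
  fixes s :: "nat \<Rightarrow> nat" and \<nu> :: "real measure"
  assumes s: "strict_mono s" and \<nu>: "real_distribution \<nu>" and conv: "weak_conv_m (emp \<circ> s) \<nu>"
begin

interpretation \<nu>: real_distribution \<nu> by (rule \<nu>)

text \<open>Weak convergence extends to bounded functions whose discontinuities are null for the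
  limit. This generality is needed for \<open>g (f' x)\<close>, which may jump on
  \<open>Z\<close>.\<close>

lemma integral_limit:
  fixes g :: "real \<Rightarrow> real"
  assumes "emeasure \<nu> {x. \<not> isCont g x} = 0" "\<And>x. \<bar>g x\<bar> \<le> B" "g \<in> borel_measurable borel"
  shows "(\<lambda>n. (\<Sum>j<Suc (s n). g (orb j)) / Suc (s n)) \<longlonglongrightarrow> integral\<^sup>L \<nu> g"
  using weak_conv_imp_bdd_ae_continuous_conv[of "emp \<circ> s" \<nu> g B] conv \<nu> assms real_distribution_emp
  by (simp add: integral_emp o_def del: sum.lessThan_Suc)

lemma integral_limit_continuous:
  fixes g :: "real \<Rightarrow> real"
  assumes "continuous_on UNIV g" "\<And>x. \<bar>g x\<bar> \<le> B"
  shows "(\<lambda>n. (\<Sum>j<Suc (s n). g (orb j)) / Suc (s n)) \<longlonglongrightarrow> integral\<^sup>L \<nu> g"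
proof (rule integral_limit[OF _ assms(2)])
  have "{x. \<not> isCont g x} = {}" using assms(1) by (auto simp: continuous_on_eq_continuous_at)
  then show "emeasure \<nu> {x. \<not> isCont g x} = 0" by simp
qed (use assms in \<open>auto intro: borel_measurable_continuous_onI\<close>)

text \<open>Tested with the truncated distance to the unit interval, which vanishes along the
  orbit.\<close>

lemma AE_limit_01: "AE x in \<nu>. x \<in> {0..1}"
proof -
  define h where "h x = min 1 \<bar>x - max 0 (min 1 x)\<bar>" for x :: real
  have c: "continuous_on UNIV h" unfolding h_def by (intro continuous_intros)
  have "h (orb j) = 0" for j using orb01[of j] by (auto simp: h_def)
  then have "integral\<^sup>L \<nu> h = 0"
    using LIMSEQ_unique[OF integral_limit_continuous[OF c, of 1]] by (auto simp: h_def)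
  moreover have "integrable \<nu> h"
    using borel_measurable_continuous_onI[OF c] by (intro \<nu>.integrable_const_bound[of _ 1]) (auto simp: h_def)
  ultimately have "AE x in \<nu>. h x = 0"
    by (subst (asm) integral_nonneg_eq_0_iff_AE) (auto simp: h_def)
  then show ?thesis by eventually_elim (auto simp: h_def min_def max_def split: if_splits)
qed

text \<open>Grid intervals near \<open>K\<close> lie in an open set of length at most
  \<open>\<epsilon> / C\<close>, so there are at most \<open>N * \<epsilon> / C\<close> of them.
  Times in \<open>A\<close> visit each with frequency at most \<open>C / N\<close>, in total
  \<open>\<epsilon>\<close>; times outside \<open>A\<close> add another \<open>\<epsilon>\<close>.
  The rest of \<open>4 * \<epsilon>\<close> is the slack in the two frequency bounds.\<close>

lemma limit_compact_le:
  assumes K: "compact K" "emeasure lborel K = 0" and e: "\<epsilon> > 0"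
  shows "measure \<nu> K \<le> 4 * \<epsilon>"
proof (cases "K = {}")
  case False
  obtain C0 A where A: "freq_le (\<lambda>j. \<not> A j) \<epsilon>"
    and C0: "\<And>u v. u \<in> \<rat> \<Longrightarrow> v \<in> \<rat> \<Longrightarrow> u < v \<Longrightarrow>
      freq_le (\<lambda>j. A j \<and> orb j \<in> {u..v}) (C0 * (v - u))"
    using sparse e unfolding no_concentration_def by blast
  \<comment> \<open>Enlarging the constant keeps the bounds and makes \<open>\<epsilon> / C\<close>
    meaningful.\<close>
  define C where "C = max 1 C0"
  have C: "freq_le (\<lambda>j. A j \<and> orb j \<in> {u..v}) (C * (v - u))"
    if "u \<in> \<rat>" "v \<in> \<rat>" "u < v" for u v
    by (rule freq_le_mono[OF C0[OF that]]) (use that in \<open>auto simp: C_def intro!: mult_right_mono\<close>)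
  have C1: "C \<ge> 1" by (simp add: C_def)
  have Kb: "K \<in> sets borel" using K(1) by (simp add: borel_compact)
  have "ennreal (\<epsilon> / C) > 0" using e C1 by simp
  then obtain U where U: "open U" "K \<subseteq> U" "emeasure lborel (U - K) < \<epsilon> / C"
    using outer_regular_lborel[OF Kb, of "\<epsilon> / C"] e C1 by (metis divide_pos_pos less_le_trans zero_less_one)
  have "emeasure lborel U \<le> emeasure lborel (U - K) + emeasure lborel K"
    using U Kb by (metis Un_Diff_cancel2 Un_absorb2 emeasure_subadditive borel_open sets.Diff sets_lborel)
  then have lU: "emeasure lborel U < \<epsilon> / C" using U(3) K(2) by simp
  have mU: "U \<in> fmeasurable lborel" using U lU by (auto intro!: fmeasurableI less_trans[OF lU])
  have U_le: "len U \<le> \<epsilon> / C"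
    using lU mU e C1 by (simp add: emeasure_eq_measure2 ennreal_less_iff fmeasurableD2)
  obtain r where r: "r > 0" "(\<Union>x\<in>K. cball x r) \<subseteq> U"
    using compact_subset_open_imp_cball_epsilon_subset[OF K(1) U(1,2)] by blast
  \<comment> \<open>A grid interval of width \<open>1 / N\<close> with a point closer than
    \<open>1 / N\<close> to \<open>K\<close> stays within \<open>2 / N\<close> of one point of
    \<open>K\<close>, hence inside \<open>U\<close>.\<close>
  obtain N :: nat where N: "4 / r < N" using reals_Archimedean2 by blast
  have N0: "N > 0" using N r by (cases N) (auto simp: divide_less_0_iff not_less)
  have N4: "4 / real N < r" using N N0 r by (simp add: field_simps)
  define I where "I i = {real i / N..(real i + 1) / N}" for i
  \<comment> \<open>The index \<open>i = N\<close> is included to catch the point 1. The grid has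
    rational end points, as the hypothesis on visits requires.\<close>
  define S where "S = {i. i \<le> N \<and> (\<exists>y\<in>I i. infdist y K < 1 / N)}"
  have finS: "finite S" and cardS: "card S \<le> N + 1"
    using card_mono[of "{..N}" S] by (auto simp: S_def)
  have IU: "I i \<subseteq> U" if iS: "i \<in> S" for i
  proof
    fix z assume z: "z \<in> I i"
    obtain y where y: "y \<in> I i" "infdist y K < 1 / N" using iS unfolding S_def by blast
    obtain k where k: "k \<in> K" "infdist y K = dist y k"
      using infdist_attains_inf[OF compact_imp_closed[OF K(1)] False] by blast
    have "\<bar>z - y\<bar> \<le> 1 / N"
      using z y(1) unfolding I_def add_divide_distrib atLeastAtMost_iff by linarith
    moreover have "\<bar>y - k\<bar> < 1 / N" using y(2) k(2) by (simp only: dist_real_def)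
    moreover have "1 / real N + 1 / real N \<le> 4 / real N" using N0 by (simp add: field_simps)
    ultimately have "z \<in> cball k r" using N4 unfolding mem_cball dist_real_def by linarith
    then show "z \<in> U" using r(2) k(1) by blast
  qed
  have cardS_le: "real (card S) / N \<le> \<epsilon> / C"
  proof -
    define J where "J i = {real i / N<..<(real i + 1) / N}" for i
    have disj: "disjoint_family_on J S"
      unfolding disjoint_family_on_def
    proof (intro ballI impI)
      fix i j assume "i \<in> S" "j \<in> S" "i \<noteq> j"
      then consider "real i + 1 \<le> real j" | "real j + 1 \<le> real i" by linarith
      then show "J i \<inter> J j = {}"
      proof cases
        case 1
        then have "(real i + 1) / N \<le> real j / N" by (intro divide_right_mono) auto
        then show ?thesis by (auto simp: J_def)
      next
        case 2
        then have "(real j + 1) / N \<le> real i / N" by (intro divide_right_mono) auto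
        then show ?thesis by (auto simp: J_def)
      qed
    qed
    have "len (J i) = 1 / N" for i
      unfolding J_def by (simp add: divide_right_mono diff_divide_distrib[symmetric])
    then have "real (card S) / N = (\<Sum>i\<in>S. len (J i))" by simp
    also have "\<dots> = len (\<Union>i\<in>S. J i)"
    proof (intro measure_finite_Union[symmetric] disj finS)
      show "J ` S \<subseteq> sets lborel" by (auto simp: J_def)
      show "emeasure lborel (J i) \<noteq> \<infinity>" for i
        unfolding J_def by (subst emeasure_lborel_Ioo) (simp_all add: divide_right_mono)
    qed
    also have "\<dots> \<le> len U"
      using IU mU by (intro measure_mono_fmeasurable) (force simp: J_def I_def)+
    finally show ?thesis using U_le by linarith
  qed
  \<comment> \<open>A continuous majorant of the indicator of \<open>K\<close>. It vanishes at
    distance \<open>1 / N\<close> or more from \<open>K\<close>, so only the grid intervals in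
    \<open>S\<close> see it.\<close>
  define h where "h y = max 0 (1 - real N * infdist y K)" for y
  have hc: "continuous_on UNIV h" unfolding h_def by (intro continuous_intros)
  have h01: "0 \<le> h y" "h y \<le> 1" for y
    using mult_nonneg_nonneg[OF of_nat_0_le_iff infdist_nonneg, of N y K] by (auto simp: h_def)
  have h1: "h y = 1" if "y \<in> K" for y using that by (simp add: h_def)
  have "measure \<nu> K = integral\<^sup>L \<nu> (indicator K)" using Kb by simp
  also have "\<dots> \<le> integral\<^sup>L \<nu> h"
  proof (rule integral_mono)
    show "integrable \<nu> (indicator K :: real \<Rightarrow> real)" using Kb
      by (intro integrable_real_indicator) (auto simp: \<nu>.emeasure_eq_measure)
    show "integrable \<nu> h"
      using borel_measurable_continuous_onI[OF hc] h01 by (intro \<nu>.integrable_const_bound[of _ 1]) auto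
  qed (use h01 h1 in \<open>auto simp: indicator_def\<close>)
  also have "\<dots> \<le> 4 * \<epsilon>"
  proof (rule LIMSEQ_le_const2[OF integral_limit_continuous[OF hc, of 1]])
    show "\<bar>h x\<bar> \<le> 1" for x using h01[of x] by simp
    let ?E = "\<lambda>i j. A j \<and> orb j \<in> I i"
    have E: "freq_le (?E i) (C / N)" for i
      using C[of "real i / N" "(real i + 1) / N"] N0 by (simp add: I_def diff_divide_distrib[symmetric] divide_strict_right_mono)
    \<comment> \<open>The slack \<open>\<epsilon> / (N + 1)\<close> per interval sums to at most
      \<open>\<epsilon>\<close> because \<open>S\<close> has at most \<open>N + 1\<close>
      elements.\<close>
    have "\<forall>\<^sub>F n in sequentially. real (card {j. j < n \<and> \<not> A j}) \<le> (\<epsilon> + \<epsilon>) * real n \<and>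
      (\<forall>i\<in>S. real (card {j. j < n \<and> ?E i j}) \<le> (C / N + \<epsilon> / (N + 1)) * real n)"
      using A E e unfolding freq_le_def
      by (intro eventually_conj eventually_ball_finite finS ballI) auto
    then have ev: "\<forall>\<^sub>F n in sequentially. (\<Sum>j<n. h (orb j)) \<le> 4 * \<epsilon> * n"
    proof eventually_elim
      case (elim n)
      have 1: "h (orb j) \<le> (if \<not> A j then 1 else 0) + (\<Sum>i\<in>S. if ?E i j then 1 else 0)" for j
      proof (cases "A j \<and> h (orb j) > 0")
        case True
        have o: "orb j \<in> {0..1}" by (rule orb01)
        define i where "i = nat \<lfloor>N * orb j\<rfloor>"
        have i: "real i \<le> N * orb j" "N * orb j < real i + 1"
          using o unfolding i_def by (simp_all add: of_nat_nat)
        have "real N * orb j \<le> real N" using o by (intro mult_left_le) auto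
        then have "real i \<le> N" using i(1) by linarith
        moreover have "orb j \<in> I i"
          using i N0 by (simp add: I_def pos_divide_le_eq pos_le_divide_eq mult.commute)
        moreover have "infdist (orb j) K < 1 / N"
        proof -
          have "real N * infdist (orb j) K < 1" using True unfolding h_def by linarith
          then show ?thesis using N0 by (simp add: pos_less_divide_eq mult.commute)
        qed
        ultimately have "i \<in> S" unfolding S_def by auto
        then have "(if ?E i j then 1 else 0) \<le> (\<Sum>i\<in>S. if ?E i j then 1 else 0 :: real)"
          using finS by (intro member_le_sum) auto
        then show ?thesis using True h01[of "orb j"] \<open>orb j \<in> I i\<close> by auto
      next
        case False
        then show ?thesis using h01[of "orb j"] by (auto intro!: sum_nonneg)
      qed
      have count: "(\<Sum>j<n. if P j then 1 else 0 :: real) = card {j. j < n \<and> P j}" for P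
        by (simp add: sum.If_cases lessThan_def Collect_conj_eq)
      have "(\<Sum>j<n. h (orb j)) \<le> (\<Sum>j<n. (if \<not> A j then 1 else 0) + (\<Sum>i\<in>S. if ?E i j then 1 else 0))"
        by (intro sum_mono 1)
      also have "\<dots> = real (card {j. j < n \<and> \<not> A j}) + (\<Sum>i\<in>S. real (card {j. j < n \<and> ?E i j}))"
        unfolding sum.distrib sum.swap[of _ S] count ..
      also have "\<dots> \<le> (\<epsilon> + \<epsilon>) * n + (\<Sum>i\<in>S. (C / N + \<epsilon> / (N + 1)) * n)"
        using elim by (intro add_mono sum_mono) auto
      also have "\<dots> = ((\<epsilon> + \<epsilon>) + (C * (card S / N) + \<epsilon> * (card S / (N + 1)))) * n"
        by (simp add: algebra_simps)
      also have "\<dots> \<le> ((\<epsilon> + \<epsilon>) + (\<epsilon> + \<epsilon>)) * n"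
      proof (intro mult_right_mono add_mono order_refl)
        show "C * (card S / N) \<le> \<epsilon>" using cardS_le C1 by (simp add: le_divide_eq mult.commute)
        have "real (card S) \<le> N + 1" using cardS by linarith
        then show "\<epsilon> * (card S / (N + 1)) \<le> \<epsilon>" using e by (intro mult_left_le) auto
      qed auto
      finally show ?case by simp
    qed
    have "filterlim (\<lambda>n. Suc (s n)) sequentially sequentially"
      using filterlim_compose[OF filterlim_Suc filterlim_subseq[OF s]] .
    from eventually_compose_filterlim[OF ev this]
    have "\<forall>\<^sub>F n in sequentially. (\<Sum>j<Suc (s n). h (orb j)) \<le> 4 * \<epsilon> * Suc (s n)" .
    then show "\<exists>M. \<forall>n\<ge>M. (\<Sum>j<Suc (s n). h (orb j)) / Suc (s n) \<le> 4 * \<epsilon>"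
      by (simp only: eventually_sequentially pos_divide_le_eq of_nat_0_less_iff zero_less_Suc)
  qed
  finally show ?thesis .
qed (use e in auto)

text \<open>Inner regularity reduces the claim to compact null sets.\<close>

lemma limit_null: "A \<in> sets borel \<Longrightarrow> emeasure lborel A = 0 \<Longrightarrow> emeasure \<nu> A = 0"
proof -
  assume A: "A \<in> sets borel" "emeasure lborel A = 0"
  have "emeasure \<nu> A = (SUP K\<in>{K. K \<subseteq> A \<and> compact K}. emeasure \<nu> K)"
    by (rule inner_regular) (simp_all add: A)
  also have "\<dots> \<le> 0"
  proof (rule SUP_least)
    fix K assume K: "K \<in> {K. K \<subseteq> A \<and> compact K}"
    have "emeasure lborel K \<le> emeasure lborel A" by (rule emeasure_mono) (use K A in auto)
    then have K0: "emeasure lborel K = 0" using A(2) by simp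
    have "measure \<nu> K \<le> 0"
    proof (rule field_le_epsilon)
      fix e :: real assume "e > 0"
      then have "measure \<nu> K \<le> 4 * (e / 4)" by (intro limit_compact_le K0) (use K in auto)
      then show "measure \<nu> K \<le> 0 + e" by simp
    qed
    then show "emeasure \<nu> K \<le> 0" by (simp add: \<nu>.emeasure_eq_measure measure_le_0_iff)
  qed
  finally show ?thesis by simp
qed

lemma limit_Z: "emeasure \<nu> Z = 0" "AE x in \<nu>. x \<notin> Z"
proof -
  show "emeasure \<nu> Z = 0"
    using finite_Z by (intro limit_null) (auto intro: emeasure_lborel_countable countable_finite simp: finite_imp_closed)
  then show "AE x in \<nu>. x \<notin> Z"
    using finite_Z by (intro AE_not_in) (auto simp: null_sets_def finite_imp_closed)
qed

text \<open>The orbit sums of \<open>g (f' x)\<close> and \<open>g x\<close> differ only by a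
  boundary term, so their averages have the same limit. Both limits are integrals against
  \<open>\<nu>\<close>: the discontinuities of \<open>f'\<close> lie in \<open>Z\<close>, a
  \<open>\<nu>\<close>-null set. Cosines and sines as test functions give equal characteristic
  functions.\<close>

lemma limit_invariant: "distr \<nu> borel f' = \<nu>"
proof (rule Levy_uniqueness)
  show dist: "real_distribution (distr \<nu> borel f')"
    by (rule \<nu>.real_distribution_distr) simp
  have *: "integral\<^sup>L \<nu> (\<lambda>x. g (f' x)) = integral\<^sup>L \<nu> g"
    if c: "continuous_on UNIV g" and b: "\<And>x. \<bar>g x\<bar> \<le> 1" for g :: "real \<Rightarrow> real"
  proof -
    let ?S = "\<lambda>g n. \<Sum>j<Suc (s n). g (orb j) :: real"
    have m: "g \<in> borel_measurable borel" using c by (rule borel_measurable_continuous_onI)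
    have "{x. \<not> isCont (\<lambda>x. g (f' x)) x} \<subseteq> Z"
      using isCont_f' c by (auto simp: continuous_on_eq_continuous_at intro!: isCont_o2[of _ f' g])
    then have "emeasure \<nu> {x. \<not> isCont (\<lambda>x. g (f' x)) x} \<le> emeasure \<nu> Z"
      using finite_Z by (intro emeasure_mono) (auto simp: finite_imp_closed)
    then have L1: "(\<lambda>n. ?S (\<lambda>x. g (f' x)) n / Suc (s n)) \<longlonglongrightarrow> integral\<^sup>L \<nu> (\<lambda>x. g (f' x))"
      using b m limit_Z by (intro integral_limit[of _ 1]) auto
    have L2: "(\<lambda>n. ?S g n / Suc (s n)) \<longlonglongrightarrow> integral\<^sup>L \<nu> g"
      by (rule integral_limit_continuous[OF c b])
    have "?S (\<lambda>x. g (f' x)) n - ?S g n = g (orb (Suc (s n))) - g (orb 0)" for n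
    proof -
      have "f' (orb j) = orb (Suc j)" for j
        using orb01[of j] orbit_Z[of j] by (simp add: f'_def)
      then have "?S (\<lambda>x. g (f' x)) n - ?S g n = (\<Sum>j<Suc (s n). g (orb (Suc j)) - g (orb j))"
        by (simp only: sum_subtractf)
      also have "\<dots> = g (orb (Suc (s n))) - g (orb 0)" by (rule sum_lessThan_telescope)
      finally show ?thesis .
    qed
    then have eq: "?S (\<lambda>x. g (f' x)) n / Suc (s n) - ?S g n / Suc (s n) = (g (orb (Suc (s n))) - g (orb 0)) / Suc (s n)" for n
      by (simp only: diff_divide_distrib[symmetric])
    have "(\<lambda>n. (g (orb (Suc (s n))) - g (orb 0)) / Suc (s n)) \<longlonglongrightarrow> 0"
    proof (rule Lim_null_comparison)
      have "\<bar>g (orb (Suc (s n))) - g (orb 0)\<bar> \<le> 2" for n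
        using b[of "orb (Suc (s n))"] b[of "orb 0"] by linarith
      then show "\<forall>\<^sub>F n in sequentially. norm ((g (orb (Suc (s n))) - g (orb 0)) / Suc (s n)) \<le> 2 / Suc (s n)"
        by (intro always_eventually allI) (simp add: divide_right_mono del: funpow.simps)
      have "(\<lambda>n. 2 / real (Suc n)) \<longlonglongrightarrow> 0"
        by (rule LIMSEQ_Suc[OF lim_const_over_n])
      from LIMSEQ_subseq_LIMSEQ[OF this s] show "(\<lambda>n. 2 / real (Suc (s n))) \<longlonglongrightarrow> 0" by (simp add: o_def)
    qed
    then have "(\<lambda>n. ?S (\<lambda>x. g (f' x)) n / Suc (s n) - ?S g n / Suc (s n)) \<longlonglongrightarrow> 0" by (simp only: eq)
    from LIMSEQ_unique[OF this tendsto_diff[OF L1 L2]] show ?thesis by simp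
  qed
  show "char (distr \<nu> borel f') = char \<nu>"
  proof
    fix t
    have Re: "Re (char M t) = (\<integral>x. cos (t * x) \<partial>M)" and Im: "Im (char M t) = (\<integral>x. sin (t * x) \<partial>M)"
      if "real_distribution M" for M
    proof -
      interpret real_distribution M by (rule that)
      have i: "integrable M (\<lambda>x. iexp (t * x))" by (intro integrable_const_bound) auto
      show "Re (char M t) = (\<integral>x. cos (t * x) \<partial>M)"
        unfolding char_def integral_Re[OF i, symmetric] by (simp add: Re_exp)
      show "Im (char M t) = (\<integral>x. sin (t * x) \<partial>M)"
        unfolding char_def integral_Im[OF i, symmetric] by (simp add: Im_exp)
    qed
    show "char (distr \<nu> borel f') t = char \<nu> t"
      using *[of "\<lambda>x. cos (t * x)"] *[of "\<lambda>x. sin (t * x)"]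
      by (intro complex_eqI) (simp_all add: Re Im dist \<nu> integral_distr continuous_intros)
  qed
qed (rule \<nu>)

lemma restrict_limit: "restrict_space \<nu> {0..1} = \<mu>"
proof (rule unique)
  let ?M = "restrict_space \<nu> {0..1}"
  have [measurable]: "{0..1::real} \<in> sets borel" by simp
  have sM: "sets ?M = sets lborel01" unfolding lborel01_def by (intro sets_restrict_space_cong) simp
  have s\<mu>: "sets \<mu> = sets lborel01" using acip by (simp add: acip_def)
  \<comment> \<open>Measurability of \<open>f\<close> is read off from \<open>acip f \<mu>\<close>,
    since the two measures have the same measurable sets.\<close>
  have "f \<in> measurable \<mu> \<mu>" using acip by (simp add: acip_def)
  then have fM: "f \<in> measurable ?M ?M" using measurable_cong_sets[of \<mu> ?M \<mu> ?M] sM s\<mu> by simp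
  have spM: "space ?M = {0..1}" by (simp add: space_restrict_space)
  have inM: "A \<subseteq> {0..1} \<and> A \<in> sets borel" if "A \<in> sets ?M" for A
    using that by (simp add: sets_restrict_space_iff)
  have emM: "emeasure ?M A = emeasure \<nu> A" if "A \<subseteq> {0..1}" for A
    using that by (intro emeasure_restrict_space) auto
  show "acip f ?M"
    unfolding acip_def
  proof (intro conjI sM fM)
    have "emeasure \<nu> {0..1} = 1" using AE_limit_01 by (intro \<nu>.emeasure_eq_1_AE) auto
    then show "prob_space ?M" by (intro prob_space_restrict_space) auto
    show "absolutely_continuous lborel01 ?M"
      unfolding absolutely_continuous_def lborel01_def
    proof
      fix x :: "real set" assume "x \<in> null_sets (restrict_space lborel {0..1})"
      then have x: "x \<subseteq> {0..1}" "x \<in> null_sets lborel" by (simp_all add: null_sets_restrict_space)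
      then have "x \<in> null_sets \<nu>" using limit_null[of x] by (simp add: null_sets_def)
      then show "x \<in> null_sets ?M" using x(1) by (simp add: null_sets_restrict_space)
    qed
    show "distr ?M ?M f = ?M"
    proof (rule measure_eqI)
      fix A assume "A \<in> sets (distr ?M ?M f)"
      then have A: "A \<in> sets ?M" by simp
      have pre: "f -` A \<inter> {0..1} \<in> sets ?M" using measurable_sets[OF fM A] spM by simp
      have [measurable]: "A \<in> sets borel" using inM[OF A] by simp
      have "emeasure (distr ?M ?M f) A = emeasure \<nu> (f -` A \<inter> {0..1})"
        using fM A by (simp add: emeasure_distr spM emM)
      also have "\<dots> = emeasure \<nu> (f' -` A)"
      proof (rule emeasure_eq_AE)
        show "AE x in \<nu>. x \<in> f -` A \<inter> {0..1} \<longleftrightarrow> x \<in> f' -` A"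
          using AE_limit_01 limit_Z(2) by eventually_elim (auto simp: f'_def)
        show "f -` A \<inter> {0..1} \<in> sets \<nu>" using inM[OF pre] by simp
        show "f' -` A \<in> sets \<nu>" using measurable_sets[OF measurable_f', of A] by simp
      qed
      also have "\<dots> = emeasure (distr \<nu> borel f') A" by (subst emeasure_distr) auto
      also have "\<dots> = emeasure ?M A" using inM[OF A] by (simp add: limit_invariant emM)
      finally show "emeasure (distr ?M ?M f) A = emeasure ?M A" .
    qed simp
  qed
qed

lemma limit_eq: "\<nu> = distr \<mu> borel (\<lambda>x. x)"
proof (rule measure_eqI)
  fix A assume "A \<in> sets \<nu>"
  then have A [measurable]: "A \<in> sets borel" by simp
  have m: "(\<lambda>x. x) \<in> measurable \<mu> borel"
    unfolding restrict_limit[symmetric] by (rule measurable_restrict_space1) simp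
  have sp: "space \<mu> = {0..1}" unfolding restrict_limit[symmetric] by (simp add: space_restrict_space)
  have "emeasure (distr \<mu> borel (\<lambda>x. x)) A = emeasure \<mu> (A \<inter> {0..1})"
    using m by (simp add: emeasure_distr sp vimage_def)
  also have "\<dots> = emeasure \<nu> (A \<inter> {0..1})"
    unfolding restrict_limit[symmetric] by (intro emeasure_restrict_space) auto
  also have "\<dots> = emeasure \<nu> A"
    using AE_limit_01 by (intro emeasure_eq_AE) auto
  finally show "emeasure \<nu> A = emeasure (distr \<mu> borel (\<lambda>x. x)) A" by simp
qed simp

end

theorem typical: "typical f \<mu> x0"
  unfolding typical_def weak_star_conv_def
proof (intro allI impI)
  fix g :: "real \<Rightarrow> real" assume g: "continuous_on {0..1} g"
  let ?\<mu> = "distr \<mu> borel (\<lambda>x. x)"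
  have p: "prob_space \<mu>" and s\<mu>: "sets \<mu> = sets lborel01" using acip by (auto simp: acip_def)
  have sp: "space \<mu> = {0..1}" using sets_eq_imp_space_eq[OF s\<mu>] by (simp add: lborel01_def space_restrict_space)
  have m: "(\<lambda>x. x) \<in> measurable \<mu> borel"
    unfolding measurable_cong_sets[OF s\<mu> refl] lborel01_def by (rule measurable_restrict_space1) simp
  have rd: "real_distribution ?\<mu>"
    using prob_space.prob_space_distr[OF p m] by (simp add: real_distribution_def real_distribution_axioms_def)
  have conv: "weak_conv_m emp ?\<mu>"
  proof (rule tight_subseq_weak_converge[OF real_distribution_emp rd tight_emp])
    fix s \<nu> assume *: "strict_mono s" "real_distribution \<nu>" "weak_conv_m (emp \<circ> s) \<nu>"
    show "weak_conv_m (emp \<circ> s) ?\<mu>" using limit_eq[OF *] *(3) by simp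
  qed
  \<comment> \<open>Clamping the argument extends \<open>g\<close> to a bounded continuous function
    on the line without changing it on the unit interval.\<close>
  define h where "h x = g (max 0 (min 1 x))" for x
  have hc: "continuous_on UNIV h"
    unfolding h_def by (rule continuous_on_compose2[OF g]) (auto intro!: continuous_intros)
  have "bounded (g ` {0..1})" by (rule compact_imp_bounded[OF compact_continuous_image[OF g]]) simp
  then obtain B where "\<forall>y\<in>g ` {0..1}. norm y \<le> B" unfolding bounded_iff by blast
  then have B: "\<bar>g x\<bar> \<le> B" if "x \<in> {0..1}" for x using that by simp
  have "(\<lambda>n. integral\<^sup>L (emp n) h) \<longlonglongrightarrow> integral\<^sup>L ?\<mu> h"
  proof (rule weak_conv_imp_integral_bdd_continuous_conv[OF real_distribution_emp rd conv])
    show "isCont h x" for x using hc by (simp add: continuous_on_eq_continuous_at)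
    show "norm (h x) \<le> B" for x by (auto simp: h_def intro!: B)
  qed
  moreover have "integral\<^sup>L ?\<mu> h = integral\<^sup>L \<mu> g"
  proof -
    have "integral\<^sup>L ?\<mu> h = integral\<^sup>L \<mu> h"
      using hc m by (subst integral_distr) (auto intro: borel_measurable_continuous_onI)
    also have "\<dots> = integral\<^sup>L \<mu> g" by (rule Bochner_Integration.integral_cong) (auto simp: sp h_def)
    finally show ?thesis .
  qed
  moreover have "integral\<^sup>L (emp n) h = integral\<^sup>L (empirical_measure f x0 (Suc n)) g" for n
  proof -
    have gm: "g \<in> borel_measurable lborel01"
      using borel_measurable_continuous_on_restrict[OF g] unfolding lborel01_def
      by (simp cong: measurable_cong_sets sets_restrict_space_cong)
    have "integral\<^sup>L (empirical_measure f x0 (Suc n)) g = (\<Sum>j<Suc n. g (orb j)) / Suc n"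
      unfolding empirical_measure_def
      using orb01 by (subst integral_distr[OF measurable_orb gm])
        (simp_all add: integral_uniform_count_measure lborel01_def space_restrict_space del: sum.lessThan_Suc)
    also have "\<dots> = (\<Sum>j<Suc n. h (orb j)) / Suc n"
      using orb01 by (simp add: h_def del: sum.lessThan_Suc)
    also have "\<dots> = integral\<^sup>L (emp n) h"
      using hc by (intro integral_emp[symmetric] borel_measurable_continuous_onI)
    finally show ?thesis by simp
  qed
  ultimately have "(\<lambda>n. integral\<^sup>L (empirical_measure f x0 (Suc n)) g) \<longlonglongrightarrow> integral\<^sup>L \<mu> g"
    by (simp only:)
  then show "(\<lambda>n. integral\<^sup>L (empirical_measure f x0 n) g) \<longlonglongrightarrow> integral\<^sup>L \<mu> g"
    by (rule LIMSEQ_imp_Suc)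
qed

end


subsection \<open>Maximal open intervals\<close>

context
  fixes S :: "real set"
begin

abbreviation "maxi \<equiv> maximal_open_intervals (\<lambda>U. U \<subseteq> S)"

lemma maxi_interval: "U \<in> maxi \<Longrightarrow> \<exists>s t. s < t \<and> U = {s<..<t}"
  and maxi_subset: "U \<in> maxi \<Longrightarrow> U \<subseteq> S"
  by (auto simp: maximal_open_intervals_def)

lemma maxi_disjoint:
  assumes "U \<in> maxi" "U' \<in> maxi" "a \<in> U" "a \<in> U'"
  shows "U = U'"
proof -
  obtain s t s' t' where e: "U = {s<..<t}" "U' = {s'<..<t'}" using maxi_interval assms(1,2) by metis
  have u: "{min s s'<..<max t t'} = U \<union> U'"
    using assms(3,4) unfolding e by (auto simp: min_def max_def)
  have sub: "{min s s'<..<max t t'} \<subseteq> S" using u maxi_subset assms(1,2) by auto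
  have max: "{min s s'<..<max t t'} = U''" if "U'' \<in> maxi" "U'' \<subseteq> U \<union> U'" for U''
    using that sub unfolding u[symmetric] maximal_open_intervals_def by blast
  show ?thesis using max[OF assms(1)] max[OF assms(2)] by simp
qed

text \<open>The left end is pushed out with the right end held at \<open>t\<close>, and conversely;
  boundedness of \<open>S\<close> keeps both extremes finite.\<close>

lemma maxi_extends:
  assumes st: "s < t" "{s<..<t} \<subseteq> S" and "bounded S"
  shows "\<exists>U\<in>maxi. {s<..<t} \<subseteq> U"
proof -
  obtain m where mM: "S \<subseteq> {- m..m}"
    using bounded_subset_cbox_symmetric[OF \<open>bounded S\<close>] by auto
  have ends: "- m \<le> u \<and> v \<le> m" if "u < v" "{u<..<v} \<subseteq> S" for u v
  proof -
    have "{u<..<v} \<subseteq> {- m..m}" using that mM by blast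
    then show ?thesis using \<open>u < v\<close> by (simp add: greaterThanLessThan_subseteq_atLeastAtMost_iff)
  qed
  define A where "A = {u. u < t \<and> {u<..<t} \<subseteq> S}"
  define B where "B = {v. s < v \<and> {s<..<v} \<subseteq> S}"
  have sA: "s \<in> A" and tB: "t \<in> B" using st by (auto simp: A_def B_def)
  have bA: "bdd_below A" by (rule bdd_belowI[of _ "- m"]) (use ends in \<open>auto simp: A_def\<close>)
  have bB: "bdd_above B" by (rule bdd_aboveI[of _ m]) (use ends in \<open>auto simp: B_def\<close>)
  define l r where "l = Inf A" and "r = Sup B"
  have l: "l \<le> s" and r: "t \<le> r" using sA tB bA bB by (auto simp: l_def r_def cInf_lower cSup_upper)
  have sub: "{l<..<r} \<subseteq> S"
  proof
    fix z assume z: "z \<in> {l<..<r}"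
    show "z \<in> S"
    proof (cases "z < t")
      case True
      have "Inf A < z" using z by (simp add: l_def)
      then obtain u where "u \<in> A" "u < z" using cInf_lessD sA by blast
      then have "z \<in> {u<..<t}" "{u<..<t} \<subseteq> S" using True by (auto simp: A_def)
      then show ?thesis by blast
    next
      case False
      have "z < Sup B" using z by (simp add: r_def)
      then obtain v where "v \<in> B" "z < v" using less_cSupD tB by blast
      then have "z \<in> {s<..<v}" "{s<..<v} \<subseteq> S" using False st by (auto simp: B_def)
      then show ?thesis by blast
    qed
  qed
  have "{l<..<r} \<in> maxi"
    unfolding maximal_open_intervals_def
  proof (intro CollectI conjI allI impI)
    show "\<exists>s t. s < t \<and> {l<..<r} = {s<..<t}" using l r st by (intro exI[of _ l] exI[of _ r]) auto
    fix s' t' assume *: "{s'<..<t'} \<subseteq> S \<and> {l<..<r} \<subseteq> {s'<..<t'}"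
    then have st': "s' \<le> l" "r \<le> t'"
      using l r st by (auto simp: greaterThanLessThan_subseteq_greaterThanLessThan)
    have "{s'<..<t} \<subseteq> {s'<..<t'}" "{s<..<t'} \<subseteq> {s'<..<t'}" using st' l r by auto
    then have "{s'<..<t} \<subseteq> S" "{s<..<t'} \<subseteq> S" using * by blast+
    then have "s' \<in> A" "t' \<in> B" using st' l r st by (auto simp: A_def B_def)
    then have "l \<le> s'" "t' \<le> r" using bA bB by (auto simp: l_def r_def cInf_lower cSup_upper)
    then show "{s'<..<t'} = {l<..<r}" using st' by simp
  qed (rule sub)
  moreover have "{s<..<t} \<subseteq> {l<..<r}" using l r by auto
  ultimately show ?thesis by blast
qed

text \<open>A maximal interval is determined by its right end point, which is either an uncovered
  point of \<open>I\<close> or the supremum of \<open>I\<close>. This turns the finiteness in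
  condition (I) into finiteness of the partitions.\<close>

lemma finite_maxi:
  assumes "is_interval I" "S \<subseteq> I" "finite (I - \<Union>maxi)"
  shows "finite maxi"
proof (rule inj_on_finite)
  show "inj_on Sup maxi"
  proof (rule inj_onI)
    fix U U' assume *: "U \<in> maxi" "U' \<in> maxi" "Sup U = Sup U'"
    obtain s t where st: "s < t" "U = {s<..<t}" using maxi_interval[OF *(1)] by blast
    obtain s' t' where st': "s' < t'" "U' = {s'<..<t'}" using maxi_interval[OF *(2)] by blast
    have "t = t'" using * st st' by simp
    then have "max s s' < t" using st st' by simp
    then have "max s s' < (max s s' + t) / 2" "(max s s' + t) / 2 < t" by simp_all
    then have "(max s s' + t) / 2 \<in> U" "(max s s' + t) / 2 \<in> U'" using st st' \<open>t = t'\<close> by simp_all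
    then show "U = U'" by (rule maxi_disjoint[OF *(1,2)])
  qed
  show "Sup ` maxi \<subseteq> insert (Sup I) (I - \<Union>maxi)"
  proof
    fix t assume "t \<in> Sup ` maxi"
    then obtain U where U: "U \<in> maxi" "t = Sup U" by blast
    obtain s t' where "s < t'" "U = {s<..<t'}" using maxi_interval[OF U(1)] by blast
    then have s: "s < t" "U = {s<..<t}" using U(2) by simp_all
    have sub: "U \<subseteq> I" using maxi_subset[OF U(1)] assms(2) by blast
    show "t \<in> insert (Sup I) (I - \<Union>maxi)"
    proof (cases "t \<in> I")
      case True
      have "t \<notin> U'" if U': "U' \<in> maxi" for U'
      proof
        assume t: "t \<in> U'"
        obtain s' t' where st': "U' = {s'<..<t'}" using maxi_interval[OF U'] by blast
        have "max s s' < t" using s st' t by simp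
        define w where "w = (max s s' + t) / 2"
        have "max s s' < w" "w < t" using \<open>max s s' < t\<close> by (simp_all add: w_def)
        then have "s < w" "s' < w" "w < t" by simp_all
        then have "w \<in> U" "w \<in> U'" using s st' t by simp_all
        then have "U = U'" by (rule maxi_disjoint[OF U(1) U'])
        then show False using t s by auto
      qed
      then show ?thesis using True by blast
    next
      case False
      have ub: "z \<le> t" if "z \<in> I" for z
      proof (rule ccontr)
        assume "\<not> z \<le> t"
        moreover have "(s + t) / 2 \<in> U" using s by simp
        then have mid: "(s + t) / 2 \<in> I" using sub by blast
        ultimately have "t \<in> I"
          using s by (intro mem_is_interval_1_I[OF assms(1) mid that]) simp_all
        then show False using False by simp
      qed
      have bdd: "bdd_above I" using ub by (rule bdd_aboveI)
      have "t \<le> Sup I"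
      proof (rule dense_le)
        fix w assume "w < t"
        then have "max w ((s + t) / 2) \<in> U" using s by (simp add: less_max_iff_disj)
        then have "max w ((s + t) / 2) \<in> I" using sub by blast
        then have "max w ((s + t) / 2) \<le> Sup I" using bdd by (rule cSup_upper)
        then show "w \<le> Sup I" by simp
      qed
      moreover have "(s + t) / 2 \<in> U" using s by simp
      then have "I \<noteq> {}" using sub by blast
      then have "Sup I \<le> t" using ub by (intro cSup_least)
      ultimately show ?thesis by simp
    qed
  qed
  show "finite (insert (Sup I) (I - \<Union>maxi))" using assms(3) by simp
qed

end

subsection \<open>The family\<close>

locale expanding_maps =
  fixes I :: "real set" and L lam Lam :: real
    and T :: "real \<Rightarrow> real \<Rightarrow> real" and p :: nat and b :: "nat \<Rightarrow> real \<Rightarrow> real"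
  assumes interval_I: "is_interval I" and bounded_I: "bounded I"
    and L_pos: "0 < L" and lam_gt: "1 < lam" and lam_le: "lam \<le> Lam"
    and expanding: "\<And>a. a \<in> I \<Longrightarrow> expanding_map L lam Lam (T a) p (\<lambda>k. b k a)"
    and lipschitz_b: "\<And>k. k \<le> p \<Longrightarrow> L-lipschitz_on I (b k)"
    and prop_ii: "property_ii I L T p b"
begin

abbreviation "Z a \<equiv> cuts b p a"

lemma finite_Z: "finite (Z a)"
  unfolding cuts_def by simp

lemma Z01: "a \<in> I \<Longrightarrow> 0 \<in> Z a" "a \<in> I \<Longrightarrow> 1 \<in> Z a"
  using expanding[of a] unfolding expanding_map_def cuts_def by force+

lemma T01: "a \<in> I \<Longrightarrow> y \<in> {0..1} \<Longrightarrow> T a y \<in> {0..1}"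
  using expanding[of a] unfolding expanding_map_def by blast

lemma branch:
  assumes a: "a \<in> I" and uv: "u \<le> v" "{u..v} \<subseteq> {0..1}" "{u..v} \<inter> Z a = {}"
  shows "\<exists>k\<in>{1..p}. {u..v} \<subseteq> {b (k - 1) a<..<b k a}"
proof -
  have e: "b 0 a = 0" "b p a = 1" using expanding[OF a] by (auto simp: expanding_map_def)
  have notin: "b k a \<notin> {u..v}" if "k \<le> p" for k using uv(3) that by (auto simp: cuts_def)
  have "u \<in> {0..1}" "v \<in> {0..1}" using uv by auto
  then have u0: "b 0 a < u" and v1: "v < b p a"
    using notin[of 0] notin[of p] uv(1) e by auto
  define k where "k = (LEAST k. u < b k a)"
  have ex: "u < b p a" using v1 uv(1) by simp
  have k: "u < b k a" unfolding k_def by (rule LeastI[of _ p]) (rule ex)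
  have kp: "k \<le> p" unfolding k_def by (rule Least_le) (rule ex)
  have k0: "k \<noteq> 0" using k u0 by (cases "k = 0") auto
  have "\<not> u < b (k - 1) a" unfolding k_def by (rule not_less_Least) (use k0 k_def in simp)
  moreover have "b (k - 1) a \<notin> {u..v}" using kp by (intro notin) simp
  then have "u \<noteq> b (k - 1) a" using uv(1) by auto
  ultimately have "b (k - 1) a < u" by linarith
  moreover have "v < b k a" using notin[OF kp] k by auto
  ultimately show ?thesis using k0 kp by (intro bexI[of _ k]) auto
qed

lemma segment_branch:
  assumes a: "a \<in> I" and uv: "u \<in> {0..1}" "v \<in> {0..1}" "closed_segment u v \<inter> Z a = {}"
  shows "\<exists>k\<in>{1..p}. u \<in> {b (k - 1) a<..<b k a} \<and> v \<in> {b (k - 1) a<..<b k a}"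
proof -
  have eq: "closed_segment u v = {min u v..max u v}" by (auto simp: closed_segment_eq_real_ivl)
  have "min u v \<le> max u v" "{min u v..max u v} \<subseteq> {0..1}" using uv by auto
  then obtain k where k: "k \<in> {1..p}" "{min u v..max u v} \<subseteq> {b (k - 1) a<..<b k a}"
    using branch[OF a] uv(3) unfolding eq by blast
  have "u \<in> {min u v..max u v}" "v \<in> {min u v..max u v}" by auto
  then show ?thesis using k by blast
qed

lemma C11_branch: "a \<in> I \<Longrightarrow> k \<in> {1..p} \<Longrightarrow> C11_on L (T a) {b (k - 1) a<..<b k a}"
  using expanding[of a] by (auto simp: expanding_map_def)

lemma deriv_T_bounds: "a \<in> I \<Longrightarrow> y \<in> {0..1} - Z a \<Longrightarrow> lam \<le> \<bar>deriv (T a) y\<bar> \<and> \<bar>deriv (T a) y\<bar> \<le> Lam"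
  using expanding[of a] by (auto simp: expanding_map_def cuts_def)

lemma T_deriv:
  assumes "a \<in> I" "y \<in> {0..1} - Z a"
  shows "(T a has_real_derivative deriv (T a) y) (at y)"
proof -
  obtain k where k: "k \<in> {1..p}" "y \<in> {b (k - 1) a<..<b k a}"
    using segment_branch[OF assms(1), of y y] assms(2) by auto
  have "C1_on (T a) {b (k - 1) a<..<b k a}" using C11_branch[OF assms(1) k(1)] by (simp add: C11_on_def)
  then obtain g' where
    "\<forall>y\<in>{b (k - 1) a<..<b k a}. (T a has_real_derivative g' y) (at y within {b (k - 1) a<..<b k a})"
    unfolding C1_on_def by (elim exE conjE)
  then have "(T a has_real_derivative g' y) (at y within {b (k - 1) a<..<b k a})" using k(2) by (rule bspec)
  then have g: "(T a has_real_derivative g' y) (at y)"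
    unfolding at_within_open[OF k(2) open_greaterThanLessThan] .
  show ?thesis unfolding DERIV_imp_deriv[OF g] by (rule g)
qed

lemma deriv_T_lipschitz:
  assumes "a \<in> I" "u \<in> {0..1}" "v \<in> {0..1}" "closed_segment u v \<inter> Z a = {}"
  shows "\<bar>deriv (T a) u - deriv (T a) v\<bar> \<le> L * \<bar>u - v\<bar>"
proof -
  obtain k where k: "k \<in> {1..p}" "u \<in> {b (k - 1) a<..<b k a}" "v \<in> {b (k - 1) a<..<b k a}"
    using segment_branch[OF assms] by auto
  then show ?thesis
    using C11_branch[OF assms(1) k(1)] lipschitz_onD[of L "{b (k - 1) a<..<b k a}" "deriv (T a)" u v]
    by (simp add: C11_on_def dist_real_def)
qed

lemma T_mvt:
  assumes "a \<in> I" "u \<in> {0..1}" "v \<in> {0..1}" "closed_segment u v \<inter> Z a = {}"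
  shows "\<exists>\<xi>\<in>closed_segment u v. T a u - T a v = deriv (T a) \<xi> * (u - v)"
proof -
  have *: "\<exists>\<xi>\<in>{u..v}. T a v - T a u = (v - u) * deriv (T a) \<xi>"
    if "u < v" "u \<in> {0..1}" "v \<in> {0..1}" "{u..v} \<inter> Z a = {}" for u v
  proof -
    have "(T a has_real_derivative deriv (T a) y) (at y)" if "u \<le> y" "y \<le> v" for y
      using \<open>u \<in> {0..1}\<close> \<open>v \<in> {0..1}\<close> \<open>{u..v} \<inter> Z a = {}\<close> that by (intro T_deriv[OF assms(1)]) auto
    then show ?thesis using MVT2[OF \<open>u < v\<close>, of "T a" "deriv (T a)"] by fastforce
  qed
  consider "u < v" | "u = v" | "v < u" by linarith
  then show ?thesis
  proof cases
    case 1
    then obtain \<xi> where "\<xi> \<in> {u..v}" "T a v - T a u = (v - u) * deriv (T a) \<xi>"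
      using *[OF 1] assms by (auto simp: closed_segment_eq_real_ivl)
    then show ?thesis using 1 by (intro bexI[of _ \<xi>]) (auto simp: closed_segment_eq_real_ivl algebra_simps)
  next
    case 3
    then obtain \<xi> where "\<xi> \<in> {v..u}" "T a u - T a v = (u - v) * deriv (T a) \<xi>"
      using *[OF 3] assms by (auto simp: closed_segment_eq_real_ivl)
    then show ?thesis using 3 by (intro bexI[of _ \<xi>]) (auto simp: closed_segment_eq_real_ivl algebra_simps)
  qed auto
qed

lemma segment01: "u \<in> {0..1} \<Longrightarrow> v \<in> {0..1} \<Longrightarrow> closed_segment u v \<subseteq> {0..1::real}"
  by (simp add: closed_segment_subset)

lemma T_lipschitz:
  assumes "a \<in> I" "u \<in> {0..1}" "v \<in> {0..1}" "closed_segment u v \<inter> Z a = {}"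
  shows "\<bar>T a u - T a v\<bar> \<le> Lam * \<bar>u - v\<bar>"
proof -
  obtain \<xi> where \<xi>: "\<xi> \<in> closed_segment u v" "T a u - T a v = deriv (T a) \<xi> * (u - v)"
    using T_mvt[OF assms] by blast
  have "\<xi> \<in> {0..1} - Z a" using \<xi>(1) segment01[OF assms(2,3)] assms(4) by blast
  then have "\<bar>deriv (T a) \<xi>\<bar> \<le> Lam" using deriv_T_bounds assms(1) by blast
  then show ?thesis unfolding \<xi>(2) abs_mult by (rule mult_right_mono) simp
qed

lemma param_lipschitz:
  assumes "a \<in> I" "a' \<in> I" "y \<in> {0..1}" "\<And>s. s \<in> closed_segment a a' \<Longrightarrow> y \<notin> Z s"
  shows "\<bar>T a y - T a' y\<bar> \<le> L * \<bar>a - a'\<bar>" "\<bar>deriv (T a) y - deriv (T a') y\<bar> \<le> L * \<bar>a - a'\<bar>"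
proof -
  let ?J = "closed_segment a a'"
  have J: "is_interval ?J" by (simp add: is_interval_convex_1)
  have JI: "?J \<subseteq> I" using assms(1,2) interval_I by (simp add: closed_segment_subset is_interval_convex_1)
  have "\<forall>s\<in>?J. \<forall>k\<le>p. b k s \<noteq> y" using assms(4) by (auto simp: cuts_def)
  then have *: "L-lipschitz_on ?J (\<lambda>s. T s y)" "L-lipschitz_on ?J (\<lambda>s. deriv (T s) y)"
    using prop_ii assms(3) J JI unfolding property_ii_def by blast+
  show "\<bar>T a y - T a' y\<bar> \<le> L * \<bar>a - a'\<bar>" "\<bar>deriv (T a) y - deriv (T a') y\<bar> \<le> L * \<bar>a - a'\<bar>"
    using lipschitz_onD[OF *(1), of a a'] lipschitz_onD[OF *(2), of a a'] by (auto simp: dist_real_def)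
qed

lemma b_lipschitz: "k \<le> p \<Longrightarrow> a \<in> I \<Longrightarrow> a' \<in> I \<Longrightarrow> \<bar>b k a - b k a'\<bar> \<le> L * \<bar>a - a'\<bar>"
  using lipschitz_onD[OF lipschitz_b, of k a a'] by (simp add: dist_real_def)

lemma Z_gap:
  assumes "a \<in> I" "y \<notin> Z a"
  obtains d where "d > 0" "\<And>s k. s \<in> I \<Longrightarrow> \<bar>s - a\<bar> < d \<Longrightarrow> k \<le> p \<Longrightarrow> d \<le> \<bar>b k s - y\<bar>"
proof -
  obtain d0 where "d0 > 0" "\<forall>z\<in>Z a. z \<noteq> y \<longrightarrow> d0 \<le> dist y z"
    using finite_set_avoid[OF finite_Z, of a y] by blast
  then have d0: "d0 > 0" "\<And>z. z \<in> Z a \<Longrightarrow> d0 \<le> dist y z" using assms(2) by auto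
  \<comment> \<open>For \<open>\<bar>s - a\<bar> < d\<close> a cut moves by at most
    \<open>L * d\<close>, which leaves \<open>d0 - L * d = d\<close>.\<close>
  define d where "d = d0 / (1 + L)"
  have eq: "d * (1 + L) = d0" using L_pos by (simp add: d_def)
  show ?thesis
  proof (rule that[of d])
    show "d > 0" using d0 L_pos by (simp add: d_def)
    fix s k assume *: "s \<in> I" "\<bar>s - a\<bar> < d" "k \<le> p"
    have "L * \<bar>s - a\<bar> \<le> L * d" using *(2) L_pos by simp
    then have "\<bar>b k s - b k a\<bar> \<le> L * d" using b_lipschitz[OF *(3,1) assms(1)] by linarith
    moreover have "b k a \<in> Z a" using *(3) by (auto simp: cuts_def)
    then have "d0 \<le> \<bar>b k a - y\<bar>" using d0(2)[of "b k a"] by (simp add: dist_real_def abs_minus_commute)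
    ultimately show "d \<le> \<bar>b k s - y\<bar>" using eq by (simp add: algebra_simps)
  qed
qed

lemma interior_ball:
  assumes "a \<in> interior I"
  obtains d where "d > 0" "\<And>s. \<bar>s - a\<bar> < d \<Longrightarrow> s \<in> I"
  using assms unfolding mem_interior by (auto simp: subset_iff dist_real_def abs_minus_commute)

text \<open>For nearby parameters all cuts stay away from a neighbourhood of \<open>y\<close>. So
  one may first move \<open>z\<close> to \<open>y\<close> with \<open>s\<close> fixed and then
  \<open>s\<close> to \<open>a\<close> with \<open>y\<close> fixed, using the two separate Lipschitz
  bounds.\<close>

lemma local_deriv_lipschitz:
  assumes "a \<in> interior I" "y \<in> {0..1} - Z a"
  obtains d where "d > 0" "\<And>s. \<bar>s - a\<bar> < d \<Longrightarrow> s \<in> I"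
    "\<And>s z z'. \<bar>s - a\<bar> < d \<Longrightarrow> \<bar>z - y\<bar> < d \<Longrightarrow> \<bar>z' - y\<bar> < d \<Longrightarrow> closed_segment z z' \<inter> Z s = {}"
    "\<And>s z. \<bar>s - a\<bar> < d \<Longrightarrow> \<bar>z - y\<bar> < d \<Longrightarrow> z \<in> {0..1} \<Longrightarrow>
      \<bar>deriv (T s) z - deriv (T a) y\<bar> \<le> L * (\<bar>s - a\<bar> + \<bar>z - y\<bar>)"
proof -
  have aI: "a \<in> I" using assms(1) interior_subset by blast
  obtain d1 where d1: "d1 > 0" "\<And>s. \<bar>s - a\<bar> < d1 \<Longrightarrow> s \<in> I" using interior_ball[OF assms(1)] by blast
  obtain d2 where d2: "d2 > 0" "\<And>s k. s \<in> I \<Longrightarrow> \<bar>s - a\<bar> < d2 \<Longrightarrow> k \<le> p \<Longrightarrow> d2 \<le> \<bar>b k s - y\<bar>"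
    using Z_gap[OF aI, of y] assms(2) by blast
  define d where "d = min d1 d2"
  have seg: "closed_segment z z' \<inter> Z s = {}"
    if "\<bar>s - a\<bar> < d" "\<bar>z - y\<bar> < d" "\<bar>z' - y\<bar> < d" for s z z'
  proof -
    have far: "d2 \<le> \<bar>b k s - y\<bar>" if "k \<le> p" for k
      using d2(2)[of s k] d1(2)[of s] \<open>\<bar>s - a\<bar> < d\<close> that by (simp add: d_def)
    have "\<bar>w - y\<bar> < d2" if "w \<in> closed_segment z z'" for w
      using that \<open>\<bar>z - y\<bar> < d\<close> \<open>\<bar>z' - y\<bar> < d\<close>
      by (auto simp: closed_segment_eq_real_ivl d_def split: if_splits)
    then show ?thesis using far by (fastforce simp: cuts_def)
  qed
  show ?thesis
  proof (rule that[of d])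
    show "d > 0" using d1 d2 by (simp add: d_def)
    show "\<bar>s - a\<bar> < d \<Longrightarrow> s \<in> I" for s using d1(2) by (simp add: d_def)
    show "closed_segment z z' \<inter> Z s = {}"
      if "\<bar>s - a\<bar> < d" "\<bar>z - y\<bar> < d" "\<bar>z' - y\<bar> < d" for s z z'
      by (rule seg[OF that])
    show "\<bar>deriv (T s) z - deriv (T a) y\<bar> \<le> L * (\<bar>s - a\<bar> + \<bar>z - y\<bar>)"
      if s: "\<bar>s - a\<bar> < d" and z: "\<bar>z - y\<bar> < d" "z \<in> {0..1}" for s z
    proof -
      have sI: "s \<in> I" using d1(2) s by (simp add: d_def)
      have y: "\<bar>y - y\<bar> < d" using z(1) by linarith
      have "\<bar>deriv (T s) z - deriv (T s) y\<bar> \<le> L * \<bar>z - y\<bar>"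
        using assms(2) z by (intro deriv_T_lipschitz[OF sI] seg[OF s z(1) y]) auto
      moreover have "\<bar>deriv (T s) y - deriv (T a) y\<bar> \<le> L * \<bar>s - a\<bar>"
      proof (rule param_lipschitz(2)[OF sI aI])
        fix w assume "w \<in> closed_segment s a"
        then have "\<bar>w - a\<bar> < d" using s by (auto simp: closed_segment_eq_real_ivl split: if_splits)
        from seg[OF this y y] show "y \<notin> Z w" by simp
      qed (use assms(2) in auto)
      ultimately show ?thesis by (simp add: algebra_simps)
    qed
  qed
qed

end

subsection \<open>Parameter partitions\<close>

locale expanding_family = expanding_maps +
  fixes K :: "real \<Rightarrow> real set" and X :: "real \<Rightarrow> real" and C0 :: real
  assumes K_invariant: "\<And>a y. a \<in> I \<Longrightarrow> y \<in> K a - Z a \<Longrightarrow> T a y \<in> K a"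
    and X01: "X \<in> I \<rightarrow> {0..1}"
    and C0_ge: "1 \<le> C0"
    and condI: "\<And>j U a. 1 \<le> j \<Longrightarrow> U \<in> parameter_partition I T K p b X j \<Longrightarrow> a \<in> U \<Longrightarrow>
        1 / C0 \<le> \<bar>deriv (orbit T X j) a / deriv (T a ^^ j) (X a)\<bar> \<and>
        \<bar>deriv (orbit T X j) a / deriv (T a ^^ j) (X a)\<bar> \<le> C0"
    and condI_finite: "\<And>j. 1 \<le> j \<Longrightarrow> finite (I - \<Union>(parameter_partition I T K p b X j))"
begin

abbreviation "x \<equiv> orbit T X"
abbreviation "P \<equiv> parameter_partition I T K p b X"

lemma x_0 [simp]: "x 0 a = X a" and x_Suc: "x (Suc j) a = T a (x j a)"
  by (simp_all add: orbit_def)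

lemma x01: "a \<in> I \<Longrightarrow> x j a \<in> {0..1}"
  by (induction j) (use X01 T01 in \<open>auto simp: x_Suc\<close>)


text \<open>The defining condition of the parameter partition is pointwise; as inclusion in a single
  set it falls under the lemmas on \<open>maxi\<close>.\<close>

definition good :: "nat \<Rightarrow> real set" where
  "good j = {a \<in> interior I - nondiff_set I X. \<forall>i<j. x i a \<in> K a - Z a}"

lemma P_eq: "P j = maximal_open_intervals (\<lambda>U. U \<subseteq> good j)"
  unfolding parameter_partition_def
  by (rule arg_cong[where f=maximal_open_intervals]) (auto simp: good_def fun_eq_iff)

lemma good_interior: "a \<in> good j \<Longrightarrow> a \<in> interior I"
  and good_I: "a \<in> good j \<Longrightarrow> a \<in> I"
  and good_Z: "a \<in> good j \<Longrightarrow> i < j \<Longrightarrow> x i a \<in> {0..1} - Z a"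
  and good_mono: "a \<in> good j \<Longrightarrow> i \<le> j \<Longrightarrow> a \<in> good i"
  using x01[of a i] interior_subset[of I] by (auto simp: good_def)

text \<open>Once the orbit is in \<open>K a\<close> and off the cuts, invariance keeps the next
  point in \<open>K a\<close>; only the cuts remain to be checked.\<close>

lemma good_SucI: "a \<in> good (Suc j) \<Longrightarrow> x (Suc j) a \<notin> Z a \<Longrightarrow> a \<in> good (Suc (Suc j))"
proof -
  assume *: "a \<in> good (Suc j)" "x (Suc j) a \<notin> Z a"
  have "x j a \<in> K a - Z a" using *(1) by (simp add: good_def)
  then have "x (Suc j) a \<in> K a" using K_invariant[OF good_I[OF *(1)]] by (simp add: x_Suc)
  then show ?thesis using * by (auto simp: good_def less_Suc_eq)
qed

lemma bounded_good: "bounded (good j)"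
  by (rule bounded_subset[OF bounded_I]) (auto dest: good_I)

lemma P_interval: "U \<in> P j \<Longrightarrow> \<exists>s t. s < t \<and> U = {s<..<t}"
  unfolding P_eq by (rule maxi_interval)

lemma P_good: "U \<in> P j \<Longrightarrow> a \<in> U \<Longrightarrow> a \<in> good j"
  using maxi_subset[of U "good j"] unfolding P_eq by blast

lemma P_disjoint: "U \<in> P j \<Longrightarrow> U' \<in> P j \<Longrightarrow> a \<in> U \<Longrightarrow> a \<in> U' \<Longrightarrow> U = U'"
  unfolding P_eq by (rule maxi_disjoint)

lemma P_extends: "s < t \<Longrightarrow> {s<..<t} \<subseteq> good j \<Longrightarrow> \<exists>U\<in>P j. {s<..<t} \<subseteq> U"
  unfolding P_eq by (rule maxi_extends[OF _ _ bounded_good])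

lemma P_nested: "U \<in> P (Suc j) \<Longrightarrow> \<exists>U'\<in>P j. U \<subseteq> U'"
proof -
  assume U: "U \<in> P (Suc j)"
  obtain s t where st: "s < t" "U = {s<..<t}" using P_interval[OF U] by blast
  have "U \<subseteq> good j" using P_good[OF U] good_mono[of _ "Suc j" j] by auto
  then show ?thesis using P_extends[OF st(1), of j] st(2) by simp
qed

lemma finite_P: "finite (P j)" and finite_uncovered: "finite (I - \<Union>(P j))"
proof -
  \<comment> \<open>Condition (I) starts at level 1; level 0 leaves no more points uncovered than
    level 1.\<close>
  have "I - \<Union>(P j) \<subseteq> I - \<Union>(P (Suc j))" using P_nested by blast
  moreover have "finite (I - \<Union>(P (Suc j)))" by (rule condI_finite) simp
  ultimately show *: "finite (I - \<Union>(P j))" by (rule finite_subset)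
  have "good j \<subseteq> I" using good_I by blast
  then show "finite (P j)" using finite_maxi[OF interval_I, of "good j"] * unfolding P_eq by simp
qed

sublocale nested_partitions P
proof
  fix n U assume U: "U \<in> P n"
  obtain s t where st: "s < t" "U = {s<..<t}" using P_interval[OF U] by blast
  show "U \<in> fmeasurable lborel" "U \<noteq> {}" using st by (auto simp: fmeasurable_def)
qed (use finite_P P_nested P_disjoint in auto)

lemma P_segment: "U \<in> P j \<Longrightarrow> u \<in> U \<Longrightarrow> v \<in> U \<Longrightarrow> closed_segment u v \<subseteq> U"
  using P_interval[of U j] by (auto simp: closed_segment_eq_real_ivl split: if_splits)

lemma P_join:
  assumes "U1 \<in> P j" "U2 \<in> P j" "u \<in> U1" "v \<in> U2" "u \<le> v" "{u..v} \<subseteq> good j"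
  shows "U1 = U2"
proof -
  obtain s t where 1: "U1 = {s<..<t}" using P_interval[OF assms(1)] by blast
  obtain s' t' where 2: "U2 = {s'<..<t'}" using P_interval[OF assms(2)] by blast
  have "{s<..<t'} \<subseteq> U1 \<union> {u..v} \<union> U2" using assms(3-5) 1 2 by auto
  then have "{s<..<t'} \<subseteq> good j" using P_good assms(1,2,6) by blast
  moreover have "s < t'" using assms(3-5) 1 2 by auto
  ultimately obtain U where U: "U \<in> P j" "{s<..<t'} \<subseteq> U" using P_extends by blast
  have "u \<in> U" "v \<in> U" using U(2) assms(3-5) 1 2 by auto
  then show ?thesis using P_disjoint[OF assms(1) U(1) assms(3)] P_disjoint[OF assms(2) U(1) assms(4)] by simp
qed

subsection \<open>Derivatives along orbits\<close>

text \<open>By the chain rule this is the absolute derivative of \<open>T a ^^ j\<close> at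
  \<open>X a\<close> for good parameters; see \<open>abs_deriv_T_iterate\<close>.\<close>

definition e :: "nat \<Rightarrow> real \<Rightarrow> real" where
  "e j a = (\<Prod>i<j. \<bar>deriv (T a) (x i a)\<bar>)"

lemma x_differentiable: "a \<in> good j \<Longrightarrow> \<exists>D. (x j has_real_derivative D) (at a)"
proof (induction j)
  case 0
  have "a \<in> I" "a \<notin> nondiff_set I X" using good_I[OF 0] 0 by (simp_all add: good_def)
  then have "X differentiable (at a within I)" by (simp add: nondiff_set_def)
  then have "X differentiable (at a)" unfolding at_within_interior[OF good_interior[OF 0]] .
  moreover have "x 0 = X" by (simp add: fun_eq_iff)
  ultimately show ?case by (simp add: real_differentiable_def)
next
  case (Suc j)
  have aI: "a \<in> interior I" using good_interior[OF Suc.prems] .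
  define y where "y = x j a"
  have y: "y \<in> {0..1} - Z a" using good_Z[OF Suc.prems, of j] by (simp add: y_def)
  obtain D where D: "(x j has_real_derivative D) (at a)" using Suc.IH good_mono[OF Suc.prems] by auto
  obtain d where d: "d > 0" "\<And>s. \<bar>s - a\<bar> < d \<Longrightarrow> s \<in> I"
    "\<And>s z z'. \<bar>s - a\<bar> < d \<Longrightarrow> \<bar>z - y\<bar> < d \<Longrightarrow> \<bar>z' - y\<bar> < d \<Longrightarrow> closed_segment z z' \<inter> Z s = {}"
    "\<And>s z. \<bar>s - a\<bar> < d \<Longrightarrow> \<bar>z - y\<bar> < d \<Longrightarrow> z \<in> {0..1} \<Longrightarrow>
      \<bar>deriv (T s) z - deriv (T a) y\<bar> \<le> L * (\<bar>s - a\<bar> + \<bar>z - y\<bar>)"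
    using local_deriv_lipschitz[OF aI y] by blast
  have "C1_on (\<lambda>s. T s y) {a - d<..<a + d}"
  proof -
    have "{a - d<..<a + d} \<subseteq> I" using d(2) by (auto simp: abs_less_iff)
    moreover have "\<forall>s\<in>{a - d<..<a + d}. \<forall>k\<le>p. b k s \<noteq> y"
      using d(3)[of _ y y] d(1) by (force simp: abs_less_iff cuts_def)
    ultimately show ?thesis
      using prop_ii y unfolding property_ii_def by (simp add: is_interval_oo)
  qed
  moreover have "a \<in> {a - d<..<a + d}" using d(1) by simp
  ultimately have "\<exists>E. ((\<lambda>s. T s y) has_real_derivative E) (at a within {a - d<..<a + d})"
    unfolding C1_on_def by (elim exE conjE) (drule (1) bspec, erule exI)
  moreover have "at a within {a - d<..<a + d} = at a"
    by (rule at_within_open) (use d(1) in auto)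
  ultimately obtain E where E: "((\<lambda>s. T s y) has_real_derivative E) (at a)" by (simp only:) blast
  have xc: "(x j \<longlongrightarrow> y) (at a)" using DERIV_isCont[OF D] by (simp add: isCont_def y_def)
  \<comment> \<open>The slope of \<open>T s\<close> between \<open>y\<close> and
    \<open>x j s\<close>, completed by the limiting value so that the product formula for the
    increment holds even when the two points coincide.\<close>
  define q where "q s = (if x j s = y then deriv (T a) y else (T s (x j s) - T s y) / (x j s - y))" for s
  have near: "\<forall>\<^sub>F s in at a. \<bar>s - a\<bar> < d \<and> \<bar>x j s - y\<bar> < d"
  proof (rule eventually_conj)
    show "\<forall>\<^sub>F s in at a. \<bar>s - a\<bar> < d" using d(1) by (auto simp: eventually_at dist_real_def)
    show "\<forall>\<^sub>F s in at a. \<bar>x j s - y\<bar> < d" using tendstoD[OF xc d(1)] by (simp add: dist_real_def)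
  qed
  have "((\<lambda>s. deriv (T a) y - q s) \<longlongrightarrow> 0) (at a)"
  proof (rule Lim_null_comparison)
    have "((\<lambda>s. L * (\<bar>s - a\<bar> + \<bar>x j s - y\<bar>)) \<longlongrightarrow> L * (\<bar>a - a\<bar> + \<bar>y - y\<bar>)) (at a)"
      by (intro tendsto_intros xc)
    then show "((\<lambda>s. L * (\<bar>s - a\<bar> + \<bar>x j s - y\<bar>)) \<longlongrightarrow> 0) (at a)" by simp
    show "\<forall>\<^sub>F s in at a. norm (deriv (T a) y - q s) \<le> L * (\<bar>s - a\<bar> + \<bar>x j s - y\<bar>)"
      using near
    proof eventually_elim
      case (elim s)
      show ?case
      proof (cases "x j s = y")
        case False
        have sI: "s \<in> I" using d(2) elim by simp
        have z: "\<bar>y - y\<bar> < d" using d(1) by simp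
        obtain \<xi> where \<xi>: "\<xi> \<in> closed_segment (x j s) y" "T s (x j s) - T s y = deriv (T s) \<xi> * (x j s - y)"
          using T_mvt[OF sI x01[OF sI] _ d(3)[OF _ _ z]] elim y by blast
        have "\<bar>\<xi> - y\<bar> \<le> \<bar>x j s - y\<bar>" using \<xi>(1) by (auto simp: closed_segment_eq_real_ivl split: if_splits)
        moreover have "\<xi> \<in> {0..1}" using \<xi>(1) segment01[OF x01[OF sI], of y] y by blast
        ultimately have "\<bar>deriv (T s) \<xi> - deriv (T a) y\<bar> \<le> L * (\<bar>s - a\<bar> + \<bar>\<xi> - y\<bar>)"
          using d(4)[of s \<xi>] elim by simp
        also have "\<dots> \<le> L * (\<bar>s - a\<bar> + \<bar>x j s - y\<bar>)"
          using \<open>\<bar>\<xi> - y\<bar> \<le> \<bar>x j s - y\<bar>\<close> L_pos by simp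
        finally show ?thesis using False \<xi>(2) by (simp add: q_def abs_minus_commute)
      qed (use L_pos in \<open>simp add: q_def\<close>)
    qed
  qed
  then have "((\<lambda>s. deriv (T a) y - (deriv (T a) y - q s)) \<longlongrightarrow> deriv (T a) y - 0) (at a)"
    by (intro tendsto_diff tendsto_const)
  then have "(q \<longlongrightarrow> deriv (T a) y) (at a)" by simp
  moreover have "((\<lambda>s. (x j s - x j a) / (s - a)) \<longlongrightarrow> D) (at a)"
    using D by (simp add: has_field_derivative_iff)
  moreover have "((\<lambda>s. (T s y - T a y) / (s - a)) \<longlongrightarrow> E) (at a)"
    using E by (simp add: has_field_derivative_iff)
  ultimately have "((\<lambda>s. q s * ((x j s - x j a) / (s - a)) + (T s y - T a y) / (s - a)) \<longlongrightarrow>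
      deriv (T a) y * D + E) (at a)"
    by (intro tendsto_intros)
  moreover have "q s * ((x j s - x j a) / (s - a)) + (T s y - T a y) / (s - a) =
      (x (Suc j) s - x (Suc j) a) / (s - a)" for s
    by (simp add: q_def x_Suc add_divide_distrib[symmetric] flip: y_def)
  ultimately have "((\<lambda>s. (x (Suc j) s - x (Suc j) a) / (s - a)) \<longlongrightarrow> deriv (T a) y * D + E) (at a)"
    by simp
  then show ?case unfolding has_field_derivative_iff by blast
qed

lemma x_deriv: "a \<in> good j \<Longrightarrow> (x j has_real_derivative deriv (x j) a) (at a)"
  using x_differentiable[of a j] DERIV_imp_deriv[of "x j" _ a] by auto

lemma T_iterate_deriv:
  "a \<in> good j \<Longrightarrow> (T a ^^ j has_real_derivative (\<Prod>i<j. deriv (T a) (x i a))) (at (X a))"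
proof (induction j)
  case 0
  show ?case by (simp add: id_def)
next
  case (Suc j)
  have "(T a ^^ j has_real_derivative (\<Prod>i<j. deriv (T a) (x i a))) (at (X a))"
    using Suc.IH good_mono[OF Suc.prems] by simp
  moreover have "(T a has_real_derivative deriv (T a) (x j a)) (at ((T a ^^ j) (X a)))"
    using T_deriv[OF good_I[OF Suc.prems] good_Z[OF Suc.prems, of j]] by (simp add: orbit_def)
  ultimately have "(T a \<circ> (T a ^^ j) has_real_derivative deriv (T a) (x j a) * (\<Prod>i<j. deriv (T a) (x i a))) (at (X a))"
    by (rule DERIV_chain[rotated])
  then show ?case by (simp only: funpow.simps prod.lessThan_Suc mult.commute)
qed

lemma abs_deriv_T_iterate: "a \<in> good j \<Longrightarrow> \<bar>deriv (T a ^^ j) (X a)\<bar> = e j a"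
  using DERIV_imp_deriv[OF T_iterate_deriv] by (simp add: e_def abs_prod)

lemma e_Suc: "e (Suc j) a = e j a * \<bar>deriv (T a) (x j a)\<bar>"
  by (simp add: e_def)

lemma e_growth: "a \<in> good (j + i) \<Longrightarrow> lam ^ i * e j a \<le> e (j + i) a" and e_pos: "a \<in> good j \<Longrightarrow> 0 < e j a"
proof -
  have pos: "0 < e j a" if "a \<in> good j" for j
    unfolding e_def using deriv_T_bounds[OF good_I[OF that] good_Z[OF that]] lam_gt
    by (intro prod_pos) fastforce
  show "0 < e j a" if "a \<in> good j" using pos[OF that] .
  show "lam ^ i * e j a \<le> e (j + i) a" if "a \<in> good (j + i)"
    using that
  proof (induction i)
    case (Suc i)
    have g: "a \<in> good (j + i)" using good_mono[OF Suc.prems] by simp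
    have "lam \<le> \<bar>deriv (T a) (x (j + i) a)\<bar>"
      using deriv_T_bounds[OF good_I[OF Suc.prems] good_Z[OF Suc.prems, of "j + i"]] by simp
    then have "(lam ^ i * e j a) * lam \<le> e (j + i) a * \<bar>deriv (T a) (x (j + i) a)\<bar>"
      using Suc.IH[OF g] pos[OF g] lam_gt by (intro mult_mono) auto
    then show ?case by (simp add: e_Suc mult_ac)
  qed simp
qed

lemma deriv_x_bounds:
  assumes "1 \<le> j" "U \<in> P j" "a \<in> U"
  shows "e j a / C0 \<le> \<bar>deriv (x j) a\<bar>" "\<bar>deriv (x j) a\<bar> \<le> C0 * e j a"
proof -
  have g: "a \<in> good j" by (rule P_good[OF assms(2,3)])
  have "1 / C0 \<le> \<bar>deriv (x j) a\<bar> / e j a" "\<bar>deriv (x j) a\<bar> / e j a \<le> C0"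
    using condI[OF assms] by (simp_all add: abs_divide abs_deriv_T_iterate[OF g])
  then show "e j a / C0 \<le> \<bar>deriv (x j) a\<bar>" "\<bar>deriv (x j) a\<bar> \<le> C0 * e j a"
    using e_pos[OF g] C0_ge by (simp_all add: field_simps)
qed

end


subsection \<open>Bounded distortion\<close>

lemma measure_le_diameter:
  assumes "S \<in> fmeasurable lborel" "0 \<le> d" "\<And>u v. u \<in> S \<Longrightarrow> v \<in> S \<Longrightarrow> u \<le> v \<Longrightarrow> v - u \<le> d"
  shows "len S \<le> d"
proof -
  obtain c where c: "S \<subseteq> {c..c + d}" using bounded_diameter_imp_interval[of S d] assms(3) by blast
  have "len S \<le> len {c..c + d}"
    using c assms(1,2) by (intro measure_mono_fmeasurable) (auto simp: fmeasurable_def)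
  then show ?thesis using assms(2) by simp
qed

lemma prod_if_eq_power_card: "(\<Prod>i<n. if A i then c else 1) = c ^ card {i. i < n \<and> A i}"
  for c :: "'a :: comm_monoid_mult" and n :: nat
proof -
  have "(\<Prod>i<n. if A i then c else 1) = (\<Prod>i\<in>{i. i < n \<and> A i}. c)"
    by (intro prod.mono_neutral_cong_right) auto
  then show ?thesis by simp
qed

lemma (in nested_partitions) subsequence: "nested_partitions (\<lambda>i. P (t + i * M))"
proof
  fix n U assume "U \<in> P (t + Suc n * M)"
  then have "U \<in> P ((t + n * M) + M)" by (simp add: add_ac)
  then show "\<exists>U'\<in>P (t + n * M). U \<subseteq> U'" by (rule nested)
qed (fact finite_P, erule fmeasurable_P, erule nonempty_P, erule (3) disjoint_P)

context expanding_family
begin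

lemma x_cont: "U \<in> P j \<Longrightarrow> a \<in> U \<Longrightarrow> isCont (x j) a"
  using DERIV_isCont[OF x_deriv[OF P_good]] .

lemma e_ge: "a \<in> good j \<Longrightarrow> lam ^ j \<le> e j a"
  using e_growth[of a 0 j] by (simp add: e_def)

lemma x_mvt:
  assumes "U \<in> P j" "u \<in> U" "v \<in> U" "u < v"
  shows "\<exists>\<xi>\<in>U. x j v - x j u = (v - u) * deriv (x j) \<xi>"
proof -
  have seg: "{u..v} \<subseteq> U" using P_segment[OF assms(1-3)] assms(4) by (simp add: closed_segment_eq_real_ivl)
  have "\<exists>z>u. z < v \<and> x j v - x j u = (v - u) * deriv (x j) z"
  proof (rule MVT2[OF assms(4)])
    fix z assume "u \<le> z" "z \<le> v"
    then have "z \<in> U" using seg by auto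
    then show "(x j has_real_derivative deriv (x j) z) (at z)" by (rule x_deriv[OF P_good[OF assms(1)]])
  qed
  then obtain z where z: "u < z" "z < v" "x j v - x j u = (v - u) * deriv (x j) z" by blast
  moreover have "z \<in> U" using seg z(1,2) by auto
  ultimately show ?thesis by blast
qed

lemma x_mvt_abs:
  assumes "U \<in> P j" "u \<in> U" "v \<in> U"
  shows "\<exists>\<xi>\<in>U. \<bar>x j v - x j u\<bar> = \<bar>v - u\<bar> * \<bar>deriv (x j) \<xi>\<bar>"
proof -
  consider "u < v" | "u = v" | "v < u" by linarith
  then show ?thesis
  proof cases
    case 1
    show ?thesis using x_mvt[OF assms 1] by (metis abs_mult)
  next
    case 3
    show ?thesis using x_mvt[OF assms(1,3,2) 3] by (metis abs_mult abs_minus_commute)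
  qed (use assms in auto)
qed

lemma x_expands:
  assumes "1 \<le> j" "U \<in> P j" "u \<in> U" "v \<in> U"
  shows "lam ^ j / C0 * \<bar>v - u\<bar> \<le> \<bar>x j v - x j u\<bar>"
proof -
  obtain \<xi> where \<xi>: "\<xi> \<in> U" "\<bar>x j v - x j u\<bar> = \<bar>v - u\<bar> * \<bar>deriv (x j) \<xi>\<bar>"
    using x_mvt_abs[OF assms(2-4)] by blast
  have "lam ^ j / C0 \<le> e j \<xi> / C0"
    using e_ge[OF P_good[OF assms(2) \<xi>(1)]] C0_ge by (intro divide_right_mono) auto
  also have "\<dots> \<le> \<bar>deriv (x j) \<xi>\<bar>" by (rule deriv_x_bounds[OF assms(1,2) \<xi>(1)])
  finally have "lam ^ j / C0 * \<bar>v - u\<bar> \<le> \<bar>deriv (x j) \<xi>\<bar> * \<bar>v - u\<bar>" by (rule mult_right_mono) simp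
  then show ?thesis unfolding \<xi>(2) by (simp only: mult.commute)
qed

lemma x_inj: "1 \<le> j \<Longrightarrow> U \<in> P j \<Longrightarrow> inj_on (x j) U"
proof (rule inj_onI)
  fix u v assume *: "1 \<le> j" "U \<in> P j" "u \<in> U" "v \<in> U" "x j u = x j v"
  have "lam ^ j / C0 * \<bar>v - u\<bar> \<le> 0" using x_expands[OF *(1-4)] *(5) by simp
  moreover have "lam ^ j / C0 > 0" using lam_gt C0_ge by simp
  ultimately have "\<bar>v - u\<bar> \<le> 0" by (metis abs_ge_zero mult_le_0_iff not_le)
  then show "u = v" by simp
qed

lemma x_strict_between:
  assumes "1 \<le> j" "U \<in> P j" "u \<in> U" "v \<in> U" "u < w" "w < v"
  shows "(x j u < x j w \<and> x j w < x j v) \<or> (x j v < x j w \<and> x j w < x j u)"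
proof -
  have seg: "{u..v} \<subseteq> U"
    using P_segment[OF assms(2-4)] assms(5,6) by (simp add: closed_segment_eq_real_ivl)
  have "continuous_on {u..v} (x j)"
    using seg x_cont[OF assms(2)] by (intro continuous_at_imp_continuous_on) auto
  moreover have "inj_on (x j) {u..v}" using x_inj[OF assms(1,2)] seg by (rule inj_on_subset)
  ultimately show ?thesis using continuous_inj_imp_mono[OF assms(5,6)] by blast
qed

lemma x_additive:
  assumes "1 \<le> j" "U \<in> P j" "u \<in> U" "v \<in> U" "u \<le> w" "w \<le> v"
  shows "\<bar>x j u - x j w\<bar> + \<bar>x j w - x j v\<bar> = \<bar>x j u - x j v\<bar>"
proof (cases "u < w \<and> w < v")
  case True
  then show ?thesis using x_strict_between[OF assms(1-4)] by fastforce
next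
  case False
  then have "w = u \<or> w = v" using assms by auto
  then show ?thesis by auto
qed

text \<open>Cauchy's mean value theorem compares \<open>x i\<close> and \<open>x (i + k)\<close> at
  one common parameter \<open>c\<close>, where \<open>e\<close> grows by at least
  \<open>lam ^ k\<close>. Condition (I) is used once for each of the two derivatives, hence
  \<open>C0\<^sup>2\<close>.\<close>

lemma x_contract:
  assumes "1 \<le> i" "U \<in> P (i + k)" "u \<in> U" "v \<in> U"
  shows "lam ^ k * \<bar>x i u - x i v\<bar> \<le> C0\<^sup>2 * \<bar>x (i + k) u - x (i + k) v\<bar>"
proof -
  have *: "lam ^ k * \<bar>x i u - x i v\<bar> \<le> C0\<^sup>2 * \<bar>x (i + k) u - x (i + k) v\<bar>"
    if "u < v" "u \<in> U" "v \<in> U" for u v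
  proof -
    have seg: "z \<in> U" if "u \<le> z" "z \<le> v" for z
      using P_segment[OF assms(2) \<open>u \<in> U\<close> \<open>v \<in> U\<close>] \<open>u < v\<close> that by (auto simp: closed_segment_eq_real_ivl)
    obtain U' where U': "U' \<in> P i" "U \<subseteq> U'" using nested[OF assms(2)] by blast
    have "\<exists>c. u < c \<and> c < v \<and>
        (x i v - x i u) * deriv (x (i + k)) c = (x (i + k) v - x (i + k) u) * deriv (x i) c"
    proof (rule GMVT'[OF \<open>u < v\<close>])
      fix z assume z: "u \<le> z" "z \<le> v"
      show "isCont (x i) z" using seg[OF z] U' by (intro x_cont[of U']) auto
      show "isCont (x (i + k)) z" by (rule x_cont[OF assms(2) seg[OF z]])
    next
      fix z assume z: "u < z" "z < v"
      then have z': "z \<in> U" using seg by simp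
      show "(x (i + k) has_real_derivative deriv (x (i + k)) z) (at z)" by (rule x_deriv[OF P_good[OF assms(2) z']])
      show "(x i has_real_derivative deriv (x i) z) (at z)" using z' U' by (intro x_deriv P_good[of U']) auto
    qed
    then obtain c where c: "u < c" "c < v"
      "(x i v - x i u) * deriv (x (i + k)) c = (x (i + k) v - x (i + k) u) * deriv (x i) c" by blast
    have cU: "c \<in> U" using c seg by simp
    have g: "c \<in> good (i + k)" by (rule P_good[OF assms(2) cU])
    have ei: "0 < e i c" using good_mono[OF g] by (intro e_pos) simp
    have "lam ^ k * e i c / C0 * \<bar>x i v - x i u\<bar> \<le> \<bar>deriv (x (i + k)) c\<bar> * \<bar>x i v - x i u\<bar>"
    proof (rule mult_right_mono)
      have "lam ^ k * e i c / C0 \<le> e (i + k) c / C0"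
        using e_growth[OF g] C0_ge by (intro divide_right_mono) auto
      also have "\<dots> \<le> \<bar>deriv (x (i + k)) c\<bar>" using assms(1) by (intro deriv_x_bounds(1)[OF _ assms(2) cU]) simp
      finally show "lam ^ k * e i c / C0 \<le> \<bar>deriv (x (i + k)) c\<bar>" .
    qed simp
    also have "\<dots> = \<bar>x (i + k) v - x (i + k) u\<bar> * \<bar>deriv (x i) c\<bar>"
      using arg_cong[OF c(3), of abs] by (simp add: abs_mult mult.commute)
    also have "\<dots> \<le> \<bar>x (i + k) v - x (i + k) u\<bar> * (C0 * e i c)"
      using cU U' by (intro mult_left_mono deriv_x_bounds(2)[OF assms(1) U'(1)]) auto
    finally have "e i c * (lam ^ k * \<bar>x i v - x i u\<bar>) \<le> e i c * (C0\<^sup>2 * \<bar>x (i + k) v - x (i + k) u\<bar>)"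
      using C0_ge by (simp add: divide_simps power2_eq_square mult_ac)
    then show ?thesis using ei by (simp add: abs_minus_commute)
  qed
  consider "u < v" | "u = v" | "v < u" by linarith
  then show ?thesis
  proof cases
    case 3
    then show ?thesis using *[OF 3 assms(4,3)] by (simp add: abs_minus_commute)
  qed (use * assms in auto)
qed

text \<open>Only the curve of points \<open>x i s\<close> over \<open>s\<close> between
  \<open>u\<close> and \<open>v\<close> is known to avoid the cuts, so the local estimate is chained
  along it by bisection. No constant is lost because \<open>x i\<close> is monotone there and its
  increments add up.\<close>

lemma deriv_along_orbit_lipschitz:
  assumes "1 \<le> i" "i < j" "U \<in> P j" "u \<in> U" "v \<in> U" "u \<le> v"
  shows "\<bar>deriv (T u) (x i u) - deriv (T v) (x i v)\<bar> \<le> L * ((v - u) + \<bar>x i u - x i v\<bar>)"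
proof -
  define g where "g a = deriv (T a) (x i a)" for a
  obtain U' where U': "U' \<in> P i" "U \<subseteq> U'" using nested_le[OF _ assms(3), of i] assms(2) by auto
  have seg: "z \<in> U" if "u \<le> z" "z \<le> v" for z
    using P_segment[OF assms(3-5)] \<open>u \<le> v\<close> that by (auto simp: closed_segment_eq_real_ivl)
  have add: "\<bar>x i r - x i s\<bar> + \<bar>x i s - x i t\<bar> = \<bar>x i r - x i t\<bar>" if "u \<le> r" "r \<le> s" "s \<le> t" "t \<le> v" for r s t
    using that seg U'(2) by (intro x_additive[OF assms(1) U'(1)]) auto
  have "u \<le> u \<and> v \<le> v \<longrightarrow> \<bar>g u - g v\<bar> \<le> L * ((v - u) + \<bar>x i u - x i v\<bar>)"
    using \<open>u \<le> v\<close>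
  proof (induction rule: Bolzano[where P="\<lambda>r s. u \<le> r \<and> s \<le> v \<longrightarrow> \<bar>g r - g s\<bar> \<le> L * ((s - r) + \<bar>x i r - x i s\<bar>)"])
    case (trans r s t)
    show ?case
    proof
      assume *: "u \<le> r \<and> t \<le> v"
      have "\<bar>g r - g t\<bar> \<le> L * ((s - r) + \<bar>x i r - x i s\<bar>) + L * ((t - s) + \<bar>x i s - x i t\<bar>)"
        using trans * by linarith
      also have "\<dots> = L * ((t - r) + (\<bar>x i r - x i s\<bar> + \<bar>x i s - x i t\<bar>))" by (simp add: algebra_simps)
      finally show "\<bar>g r - g t\<bar> \<le> L * ((t - r) + \<bar>x i r - x i t\<bar>)" using add[of r s t] trans * by simp
    qed
  next
    case (local t)
    have t: "t \<in> U" using seg local by simp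
    define y where "y = x i t"
    have gt: "t \<in> good j" by (rule P_good[OF assms(3) t])
    have y: "y \<in> {0..1} - Z t" using good_Z[OF gt assms(2)] by (simp add: y_def)
    obtain d where d: "d > 0" "\<And>s. \<bar>s - t\<bar> < d \<Longrightarrow> s \<in> I"
      "\<And>s z. \<bar>s - t\<bar> < d \<Longrightarrow> \<bar>z - y\<bar> < d \<Longrightarrow> z \<in> {0..1} \<Longrightarrow>
        \<bar>deriv (T s) z - deriv (T t) y\<bar> \<le> L * (\<bar>s - t\<bar> + \<bar>z - y\<bar>)"
      using local_deriv_lipschitz[OF good_interior[OF gt] y] by metis
    have "isCont (x i) t" using t U' by (intro x_cont[OF U'(1)]) auto
    then obtain d' where d': "d' > 0" "\<And>s. \<bar>s - t\<bar> < d' \<Longrightarrow> \<bar>x i s - y\<bar> < d"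
      using d(1) unfolding continuous_at_eps_delta y_def dist_real_def by metis
    have near: "\<bar>g s - g t\<bar> \<le> L * (\<bar>s - t\<bar> + \<bar>x i s - x i t\<bar>)" if s: "\<bar>s - t\<bar> < min d d'" for s
      using d(3)[of s "x i s"] d'(2)[of s] x01[OF d(2)] s by (simp add: g_def y_def)
    show ?case
    proof (intro exI[of _ "min d d'"] conjI allI impI)
      show "min d d' > 0" using d d' by simp
      fix r s assume rs: "r \<le> t \<and> t \<le> s \<and> s - r < min d d'" and uv: "u \<le> r \<and> s \<le> v"
      have "\<bar>g r - g s\<bar> \<le> \<bar>g r - g t\<bar> + \<bar>g s - g t\<bar>" by linarith
      also have "\<dots> \<le> L * (\<bar>r - t\<bar> + \<bar>x i r - x i t\<bar>) + L * (\<bar>s - t\<bar> + \<bar>x i s - x i t\<bar>)"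
        using rs by (intro add_mono near) auto
      also have "\<dots> = L * ((s - r) + (\<bar>x i r - x i t\<bar> + \<bar>x i t - x i s\<bar>))"
        using rs by (simp add: algebra_simps abs_minus_commute)
      finally show "\<bar>g r - g s\<bar> \<le> L * ((s - r) + \<bar>x i r - x i s\<bar>)" using add[of r t s] rs uv by simp
    qed
  qed
  then show ?thesis by (simp add: g_def)
qed

text \<open>\<open>L\<close> is the Lipschitz constant of the derivative, \<open>1 / lam\<close>
  turns absolute into relative error, \<open>C0 + 1\<close> accounts for the parameter distance
  along with the phase distance, and \<open>C0\<^sup>2\<close> comes from
  \<open>x_contract\<close>.\<close>

definition distortion_rate :: real where "distortion_rate = L / lam * ((C0 + 1) * C0\<^sup>2)"
text \<open>The exponential sums the relative errors as a geometric series. \<open>Lam / lam\<close>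
  bounds the factor of time 0, where condition (I) gives no comparison of \<open>X u\<close> with
  \<open>X v\<close>.\<close>

definition distort :: real where "distort = Lam / lam * exp (distortion_rate / (1 - 1 / lam))"

lemma distortion_rate_nonneg: "0 \<le> distortion_rate"
  using L_pos lam_gt C0_ge by (simp add: distortion_rate_def)

lemma distort_ge: "1 \<le> distort"
proof -
  have "1 \<le> Lam / lam" using lam_gt lam_le by simp
  moreover have "1 \<le> exp (distortion_rate / (1 - 1 / lam))" using distortion_rate_nonneg lam_gt by simp
  ultimately show ?thesis unfolding distort_def by (metis mult_mono' mult_1 zero_le_one)
qed

text \<open>Points at time \<open>j\<close> are at distance at most 1, so at time \<open>i\<close>
  they are \<open>C0\<^sup>2 * (1 / lam) ^ (j - i)\<close> close; since \<open>x i\<close> expands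
  parameters up to the factor \<open>C0\<close>, the parameter distance is dominated by this as
  well.\<close>

lemma distortion_factor:
  assumes "1 \<le> i" "i < j" "U \<in> P j" "u \<in> U" "v \<in> U"
  shows "\<bar>deriv (T u) (x i u)\<bar> \<le> \<bar>deriv (T v) (x i v)\<bar> * exp (distortion_rate * (1 / lam) ^ (j - i))"
proof -
  define k where "k = j - i"
  have jk: "j = i + k" using assms(2) by (simp add: k_def)
  obtain U' where U': "U' \<in> P i" "U \<subseteq> U'" using nested_le[OF _ assms(3), of i] assms(2) by auto
  have hv: "lam \<le> \<bar>deriv (T v) (x i v)\<bar>"
    using deriv_T_bounds[OF good_I good_Z[OF _ assms(2)]] P_good[OF assms(3,5)] by blast
  have uv: "\<bar>u - v\<bar> \<le> C0 * \<bar>x i u - x i v\<bar>"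
  proof -
    have "\<bar>u - v\<bar> \<le> lam ^ i * \<bar>u - v\<bar>" using lam_gt by (simp add: mult_le_cancel_right1)
    also have "\<dots> \<le> C0 * \<bar>x i u - x i v\<bar>"
      using x_expands[OF assms(1) U'(1), of v u] assms(4,5) U'(2) C0_ge by (auto simp: field_simps)
    finally show ?thesis .
  qed
  have xuv: "\<bar>x i u - x i v\<bar> \<le> C0\<^sup>2 * (1 / lam) ^ k"
  proof -
    have "lam ^ k * \<bar>x i u - x i v\<bar> \<le> C0\<^sup>2 * \<bar>x (i + k) u - x (i + k) v\<bar>"
      using assms jk by (intro x_contract) auto
    also have "\<dots> \<le> C0\<^sup>2 * 1"
    proof (rule mult_left_mono)
      show "\<bar>x (i + k) u - x (i + k) v\<bar> \<le> 1"
        using x01[OF good_I[OF P_good[OF assms(3,4)]], of "i + k"] x01[OF good_I[OF P_good[OF assms(3,5)]], of "i + k"]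
        by (simp add: abs_le_iff)
    qed simp
    finally show ?thesis using lam_gt by (simp add: power_divide pos_le_divide_eq mult.commute)
  qed
  have "\<bar>deriv (T u) (x i u) - deriv (T v) (x i v)\<bar> \<le> L * (\<bar>u - v\<bar> + \<bar>x i u - x i v\<bar>)"
    using deriv_along_orbit_lipschitz[OF assms(1-3) assms(4,5)] deriv_along_orbit_lipschitz[OF assms(1-3) assms(5,4)]
    by (cases "u \<le> v") (auto simp: abs_minus_commute)
  also have "\<dots> \<le> L * ((C0 + 1) * (C0\<^sup>2 * (1 / lam) ^ k))"
  proof (rule mult_left_mono)
    have "\<bar>u - v\<bar> + \<bar>x i u - x i v\<bar> \<le> (C0 + 1) * \<bar>x i u - x i v\<bar>" using uv by (simp add: algebra_simps)
    also have "\<dots> \<le> (C0 + 1) * (C0\<^sup>2 * (1 / lam) ^ k)" using xuv C0_ge by (intro mult_left_mono) auto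
    finally show "\<bar>u - v\<bar> + \<bar>x i u - x i v\<bar> \<le> (C0 + 1) * (C0\<^sup>2 * (1 / lam) ^ k)" .
  qed (use L_pos in simp)
  also have "\<dots> = lam * (distortion_rate * (1 / lam) ^ k)" using lam_gt by (simp add: distortion_rate_def)
  also have "\<dots> \<le> \<bar>deriv (T v) (x i v)\<bar> * (distortion_rate * (1 / lam) ^ k)"
    using hv distortion_rate_nonneg lam_gt by (intro mult_right_mono) auto
  finally have "\<bar>deriv (T u) (x i u)\<bar> \<le> \<bar>deriv (T v) (x i v)\<bar> * (1 + distortion_rate * (1 / lam) ^ k)"
    by (simp add: distrib_left)
  also have "\<dots> \<le> \<bar>deriv (T v) (x i v)\<bar> * exp (distortion_rate * (1 / lam) ^ k)"
    by (intro mult_left_mono exp_ge_add_one_self) auto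
  finally show ?thesis by (simp add: k_def)
qed

lemma distortion:
  assumes "U \<in> P j" "u \<in> U" "v \<in> U"
  shows "e j u \<le> distort * e j v"
proof (cases j)
  case 0
  then show ?thesis using distort_ge by (simp add: e_def)
next
  case (Suc n)
  define q where "q = 1 / lam"
  have q: "0 \<le> q" "q < 1" using lam_gt by (auto simp: q_def)
  let ?h = "\<lambda>a i. \<bar>deriv (T a) (x i a)\<bar>"
  have h: "lam \<le> ?h a i" "?h a i \<le> Lam" if "a \<in> U" "i < j" for a i
    using deriv_T_bounds[OF good_I good_Z[OF _ that(2)]] P_good[OF assms(1) that(1)] by blast+
  have "e j u = (\<Prod>i<j. ?h u i)" by (simp add: e_def)
  also have "\<dots> \<le> (\<Prod>i<j. ?h v i * ((if i = 0 then Lam / lam else 1) * exp (distortion_rate * q ^ (j - i))))"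
  proof (rule prod_mono, rule conjI)
    fix i assume i: "i \<in> {..<j}"
    show "?h u i \<le> ?h v i * ((if i = 0 then Lam / lam else 1) * exp (distortion_rate * q ^ (j - i)))"
    proof (cases "i = 0")
      case True
      have "?h u i \<le> lam * (Lam / lam)" using h(2)[OF assms(2), of i] i lam_gt by simp
      also have "\<dots> \<le> ?h v i * (Lam / lam * exp (distortion_rate * q ^ (j - i)))"
      proof (rule mult_mono)
        show "Lam / lam \<le> Lam / lam * exp (distortion_rate * q ^ (j - i))"
        proof -
          have "Lam / lam * 1 \<le> Lam / lam * exp (distortion_rate * q ^ (j - i))"
            using distortion_rate_nonneg q lam_gt lam_le by (intro mult_left_mono) auto
          then show ?thesis by simp
        qed
      qed (use h(1)[OF assms(3), of i] i lam_gt lam_le in auto)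
      finally show ?thesis using True by simp
    next
      case False
      then show ?thesis using distortion_factor[of i j U u v] i assms by (simp add: q_def)
    qed
  qed simp
  also have "\<dots> = e j v * ((\<Prod>i<j. if i = 0 then Lam / lam else 1) * exp (distortion_rate * (\<Sum>i<j. q ^ (j - i))))"
    by (simp add: prod.distrib e_def exp_sum sum_distrib_left)
  also have "(\<Prod>i<j. if i = 0 then Lam / lam else 1) = Lam / lam"
    using Suc by (simp add: prod.delta)
  also have "e j v * (Lam / lam * exp (distortion_rate * (\<Sum>i<j. q ^ (j - i)))) \<le> e j v * distort"
    unfolding distort_def
  proof (intro mult_left_mono)
    \<comment> \<open>Lowering each exponent by one turns the sum into an initial segment of the
      geometric series after reversal.\<close>
    have "(\<Sum>i<j. q ^ (j - i)) \<le> (\<Sum>i<j. q ^ (j - Suc i))"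
      using q by (intro sum_mono power_decreasing) auto
    also have "\<dots> = (\<Sum>i<j. q ^ i)" by (rule sum.nat_diff_reindex)
    also have "\<dots> \<le> (\<Sum>i. q ^ i)" using q by (intro sum_le_suminf) auto
    also have "\<dots> = 1 / (1 - q)" using q by (intro suminf_geometric) auto
    finally have "distortion_rate * (\<Sum>i<j. q ^ (j - i)) \<le> distortion_rate * (1 / (1 - q))" using distortion_rate_nonneg by (rule mult_left_mono)
    then show "exp (distortion_rate * (\<Sum>i<j. q ^ (j - i))) \<le> exp (distortion_rate / (1 - 1 / lam))" by (simp add: q_def)
    show "0 \<le> Lam / lam" using lam_gt lam_le by simp
    show "0 \<le> e j v" using e_pos[OF P_good[OF assms(1,3)]] by simp
  qed
  finally show ?thesis by (simp add: mult.commute)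
qed

lemma x_length_bounds:
  assumes "1 \<le> j" "U \<in> P j" "u \<in> U" "v \<in> U" "c \<in> U"
  shows "e j c * \<bar>u - v\<bar> \<le> C0 * distort * \<bar>x j u - x j v\<bar>"
    and "\<bar>x j u - x j v\<bar> \<le> C0 * distort * (e j c * \<bar>u - v\<bar>)"
proof -
  obtain \<xi> where \<xi>: "\<xi> \<in> U" "\<bar>x j u - x j v\<bar> = \<bar>u - v\<bar> * \<bar>deriv (x j) \<xi>\<bar>"
    using x_mvt_abs[OF assms(2,4,3)] by blast
  have d: "e j \<xi> \<le> C0 * \<bar>deriv (x j) \<xi>\<bar>" "\<bar>deriv (x j) \<xi>\<bar> \<le> C0 * e j \<xi>"
    using deriv_x_bounds[OF assms(1,2) \<xi>(1)] C0_ge by (simp_all add: field_simps)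
  have "e j c \<le> distort * e j \<xi>" by (rule distortion[OF assms(2,5) \<xi>(1)])
  also have "\<dots> \<le> distort * (C0 * \<bar>deriv (x j) \<xi>\<bar>)" using d(1) distort_ge by (intro mult_left_mono) auto
  finally have "e j c * \<bar>u - v\<bar> \<le> distort * (C0 * \<bar>deriv (x j) \<xi>\<bar>) * \<bar>u - v\<bar>" by (rule mult_right_mono) simp
  then show "e j c * \<bar>u - v\<bar> \<le> C0 * distort * \<bar>x j u - x j v\<bar>" unfolding \<xi>(2) by (simp add: mult_ac)
  have "\<bar>deriv (x j) \<xi>\<bar> \<le> C0 * (distort * e j c)"
    using d(2) distortion[OF assms(2) \<xi>(1) assms(5)] C0_ge by (meson mult_left_mono order_trans zero_le_one)
  then have "\<bar>u - v\<bar> * \<bar>deriv (x j) \<xi>\<bar> \<le> \<bar>u - v\<bar> * (C0 * (distort * e j c))" by (rule mult_left_mono) simp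
  then show "\<bar>x j u - x j v\<bar> \<le> C0 * distort * (e j c * \<bar>u - v\<bar>)" unfolding \<xi>(2) by (simp add: mult_ac)
qed

end

section \<open>Reciprocal lengths of images\<close>

lemma telescoping_prod:
  fixes f :: "nat \<Rightarrow> 'a :: comm_monoid_mult"
  shows "(\<Prod>i<n. f (Suc i)) * f 0 = (\<Prod>i<n. f i) * f n"
proof (induction n)
  case (Suc n)
  have "(\<Prod>i<Suc n. f (Suc i)) * f 0 = ((\<Prod>i<n. f (Suc i)) * f 0) * f (Suc n)"
    by (simp add: mult_ac)
  then show ?case by (simp only: Suc.IH prod.lessThan_Suc)
qed simp

context expanding_family
begin

definition pt :: "real set \<Rightarrow> real" where "pt U = (SOME a. a \<in> U)"

text \<open>Up to a bounded factor, this is the reciprocal of the length of the image \<open>x j ` U\<close>.\<close>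

definition inv_length :: "nat \<Rightarrow> real set \<Rightarrow> real" where
  "inv_length j U = 1 / (len U * e j (pt U))"

lemma pt_in: "U \<in> P j \<Longrightarrow> pt U \<in> U"
  unfolding pt_def using nonempty_P[of U j] by (simp add: some_in_eq)

lemma measure_P_pos: "U \<in> P j \<Longrightarrow> 0 < len U"
  using P_interval[of U j] by auto

lemma e_pt_pos: "U \<in> P j \<Longrightarrow> 0 < e j (pt U)"
  using e_pos[OF P_good[OF _ pt_in]] by blast

lemma inv_length_pos: "U \<in> P j \<Longrightarrow> 0 < inv_length j U"
  using measure_P_pos[of U j] e_pt_pos[of U j] by (simp add: inv_length_def)

lemma inverse_e_pt: "U \<in> P j \<Longrightarrow> 1 / e j (pt U) = inv_length j U * len U"
  using measure_P_pos[of U j] by (simp add: inv_length_def)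

lemma cell_pt: "U' \<in> P (j + k) \<Longrightarrow> U \<in> P j \<Longrightarrow> U' \<subseteq> U \<Longrightarrow> cell (P j) (pt U') = U"
  using pt_in[of U' "j + k"] by (intro cell_eq) auto

lemma sum_children_le: "U \<in> P j \<Longrightarrow> (\<Sum>U' | U' \<in> P n \<and> U' \<subseteq> U. len U') \<le> len U"
  by (rule sum_measure_le[of _ n]) (auto dest: fmeasurable_P)

lemma x_diff_le_1: "a \<in> I \<Longrightarrow> a' \<in> I \<Longrightarrow> \<bar>x j a - x j a'\<bar> \<le> 1"
  using x01[of a j] x01[of a' j] by (simp add: abs_le_iff)

text \<open>A conditional probability bound: within the cell \<open>U\<close>, being sent by
  \<open>x j\<close> into a set of diameter \<open>d\<close> has probability at most a constant
  times \<open>d * inv_length j U\<close>.\<close>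

lemma measure_preimage_le:
  assumes "1 \<le> j" "U \<in> P j" "S \<subseteq> U" "S \<in> fmeasurable lborel" "0 \<le> d"
    and "\<And>u v. u \<in> S \<Longrightarrow> v \<in> S \<Longrightarrow> \<bar>x j u - x j v\<bar> \<le> d"
  shows "len S \<le> C0 * distort * d * (inv_length j U * len U)"
proof (rule measure_le_diameter[OF assms(4)])
  have E: "0 < e j (pt U)" by (rule e_pt_pos[OF assms(2)])
  show "0 \<le> C0 * distort * d * (inv_length j U * len U)"
    using C0_ge distort_ge assms(5) inv_length_pos[OF assms(2)] by simp
  fix u v assume uv: "u \<in> S" "v \<in> S" "u \<le> v"
  have "e j (pt U) * \<bar>u - v\<bar> \<le> C0 * distort * \<bar>x j u - x j v\<bar>"
    using uv assms(3) by (intro x_length_bounds[OF assms(1,2) _ _ pt_in[OF assms(2)]]) auto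
  also have "\<dots> \<le> C0 * distort * d"
    using C0_ge distort_ge uv assms(6) by (intro mult_left_mono) auto
  finally have "v - u \<le> C0 * distort * d * (1 / e j (pt U))" using E uv(3) by (simp add: pos_le_divide_eq mult.commute)
  then show "v - u \<le> C0 * distort * d * (inv_length j U * len U)" by (simp only: inverse_e_pt[OF assms(2)])
qed

text \<open>The upper half of the comparison: a large \<open>inv_length\<close> forces a short
  image.\<close>

lemma x_diameter:
  assumes "1 \<le> j" "U \<in> P j" "u \<in> U" "v \<in> U"
  shows "\<bar>x j u - x j v\<bar> \<le> C0 * distort / inv_length j U"
proof -
  obtain s t where st: "U = {s<..<t}" "s < t" using P_interval[OF assms(2)] by blast
  have "\<bar>u - v\<bar> \<le> len U" using assms(3,4) st by auto
  then have "C0 * distort * (e j (pt U) * \<bar>u - v\<bar>) \<le> C0 * distort * (e j (pt U) * len U)"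
    using C0_ge distort_ge e_pt_pos[OF assms(2)] by (intro mult_left_mono) auto
  with x_length_bounds(2)[OF assms pt_in[OF assms(2)]] show ?thesis by (simp add: inv_length_def mult_ac)
qed

subsection \<open>Frequency of visits to an interval\<close>

abbreviation "inv_length_at j a \<equiv> inv_length j (cell (P j) a)"

text \<open>By the choice of \<open>M\<close>, \<open>x j\<close> varies by at most
  \<open>v - u\<close> on a cell of level \<open>j + M\<close>, so the cells that meet a visit are
  sent into an interval of length \<open>3 * (v - u)\<close>. Their conditional probability is at
  most \<open>q\<close> unless the image is short. Weighting visits by 2 and dividing by
  \<open>1 + q\<close> gives a factor of mean at most 1.\<close>

lemma visits_progression:
  assumes "1 \<le> t" "u < v" "0 < H" and M: "C0\<^sup>2 \<le> (v - u) * lam ^ M"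
  defines "q \<equiv> C0 * distort * (3 * (v - u)) * H"
  shows "AE a in lborel. covered a \<longrightarrow>
    freq_le (\<lambda>i. inv_length_at (t + i * M) a \<le> H \<and> x (t + i * M) a \<in> {u..v}) (q / ln 2)"
proof -
  interpret sub: nested_partitions "\<lambda>i. P (t + i * M)" by (rule subsequence)
  have q: "0 \<le> q" using C0_ge distort_ge assms(2,3) by (simp add: q_def)
  \<comment> \<open>The factor must be constant on the cell \<open>U'\<close>, so a visit by any of
    its points counts for the whole cell.\<close>
  define hit where "hit j U' \<longleftrightarrow> x j ` U' \<inter> {u..v} \<noteq> {}" for j and U' :: "real set"
  define G where "G i U' = (if inv_length_at (t + i * M) (pt U') \<le> H
      then (if hit (t + i * M) U' then 2 else 1) / (1 + q) else 1)" for i U'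
  have mean: "(\<Sum>U' | U' \<in> P (t + Suc i * M) \<and> U' \<subseteq> U. G i U' * len U') \<le> len U"
    if U: "U \<in> P (t + i * M)" for i U
  proof -
    define j where "j = t + i * M"
    have j1: "1 \<le> j" using assms(1) by (simp add: j_def)
    have eq: "t + Suc i * M = j + M" by (simp add: j_def)
    let ?C = "{U'. U' \<in> P (j + M) \<and> U' \<subseteq> U}"
    have Uj: "U \<in> P j" using U by (simp add: j_def)
    have fin: "finite ?C" using finite_P[of "j + M"] by simp
    have cell: "cell (P j) (pt U') = U" if "U' \<in> ?C" for U' using that Uj by (intro cell_pt) auto
    show ?thesis
    proof (cases "inv_length j U \<le> H")
      case False
      then have "(\<Sum>U'\<in>?C. G i U' * len U') = (\<Sum>U'\<in>?C. len U')"
        by (intro sum.cong refl) (simp add: G_def cell flip: j_def)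
      then show ?thesis using sum_children_le[OF Uj, of "j + M"] unfolding eq by linarith
    next
      case True
      let ?H = "{U'\<in>?C. hit j U'}"
      have H_le: "(\<Sum>U'\<in>?H. len U') \<le> q * len U"
      proof -
        have Hfm: "\<Union>?H \<in> fmeasurable lborel"
          using finite_subset[OF _ fin, of ?H] by (intro fmeasurable.finite_Union) (auto dest: fmeasurable_P)
        have "(\<Sum>U'\<in>?H. len U') \<le> len (\<Union>?H)"
          by (rule sum_measure_le[of _ "j + M"]) (use Hfm in auto)
        also have "\<dots> \<le> C0 * distort * (3 * (v - u)) * (inv_length j U * len U)"
        proof (rule measure_preimage_le[OF j1 Uj _ Hfm])
          have near: "\<exists>z\<in>{u..v}. \<bar>x j a - z\<bar> \<le> v - u" if a: "a \<in> \<Union>?H" for a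
          proof -
            obtain U' where U': "U' \<in> P (j + M)" "hit j U'" "a \<in> U'" using a by auto
            obtain a' where a': "a' \<in> U'" "x j a' \<in> {u..v}" using U'(2) unfolding hit_def by blast
            have "lam ^ M * \<bar>x j a - x j a'\<bar> \<le> C0\<^sup>2 * \<bar>x (j + M) a - x (j + M) a'\<bar>"
              by (rule x_contract[OF j1 U'(1,3) a'(1)])
            also have "\<dots> \<le> C0\<^sup>2 * 1"
              using good_I[OF P_good[OF U'(1,3)]] good_I[OF P_good[OF U'(1) a'(1)]]
              by (intro mult_left_mono x_diff_le_1) auto
            also have "\<dots> \<le> lam ^ M * (v - u)" using M by (simp add: mult.commute)
            finally have "\<bar>x j a - x j a'\<bar> \<le> v - u" using lam_gt by simp
            then show ?thesis using a'(2) by blast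
          qed
          fix a a' assume "a \<in> \<Union>?H" and "a' \<in> \<Union>?H"
          from near[OF this(1)] near[OF this(2)]
          obtain z z' where "z \<in> {u..v}" "\<bar>x j a - z\<bar> \<le> v - u" "z' \<in> {u..v}" "\<bar>x j a' - z'\<bar> \<le> v - u"
            by (elim bexE)
          then have "x j a \<le> v + (v - u)" "u - (v - u) \<le> x j a" "x j a' \<le> v + (v - u)" "u - (v - u) \<le> x j a'"
            by (simp_all add: abs_le_iff)
          then show "\<bar>x j a - x j a'\<bar> \<le> 3 * (v - u)" by (simp add: abs_le_iff)
        qed (use assms(2) in auto)
        also have "\<dots> \<le> C0 * distort * (3 * (v - u)) * (H * len U)"
          using C0_ge distort_ge assms(2) True by (intro mult_left_mono mult_right_mono) auto
        finally show ?thesis by (simp add: q_def mult_ac)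
      qed
      have "(\<Sum>U'\<in>?C. G i U' * len U') =
          (\<Sum>U'\<in>?C. (len U' + (if hit j U' then len U' else 0)) / (1 + q))"
        using True by (intro sum.cong refl) (simp add: G_def cell flip: j_def)
      also have "\<dots> = ((\<Sum>U'\<in>?C. len U') + (\<Sum>U'\<in>?H. len U')) / (1 + q)"
      proof -
        have "(\<Sum>U'\<in>?C. if hit j U' then len U' else 0) = (\<Sum>U'\<in>?H. len U')"
          using fin by (intro sum.mono_neutral_cong_right) auto
        then show ?thesis by (simp only: sum_divide_distrib[symmetric] sum.distrib)
      qed
      also have "\<dots> \<le> (len U + q * len U) / (1 + q)"
        using q by (intro divide_right_mono add_mono H_le sum_children_le[OF Uj]) auto
      also have "\<dots> = len U * (1 + q) / (1 + q)" by (simp add: algebra_simps)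
      also have "\<dots> = len U" using q by simp
      finally show ?thesis unfolding eq .
    qed
  qed
  have "AE a in lborel. (\<forall>n. a \<in> \<Union>(P (t + n * M))) \<longrightarrow>
     (\<forall>\<^sub>F n in sequentially. (\<Prod>i<n. G i (cell (P (t + Suc i * M)) a)) \<le> real n ^ 2)"
    by (rule sub.AE_prod_le[OF _ mean]) (use q in \<open>auto simp: G_def\<close>)
  then show ?thesis
  proof eventually_elim
    case (elim a)
    show ?case
    proof
      assume a: "covered a"
      let ?A = "\<lambda>i. inv_length_at (t + i * M) a \<le> H \<and> x (t + i * M) a \<in> {u..v}"
      have G_ge: "(if ?A i then 2 else 1) / (1 + q) \<le> G i (cell (P (t + Suc i * M)) a)" for i
      proof -
        let ?U' = "cell (P (t + Suc i * M)) a"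
        have U': "?U' \<in> P (t + Suc i * M)" "a \<in> ?U'" using a cell_in by blast+
        have "cell (P (t + i * M)) (pt ?U') = cell (P (t + i * M)) a"
          by (rule cell_cong[OF _ U'(1) pt_in[OF U'(1)] U'(2)]) simp
        moreover have "hit (t + i * M) ?U'" if "x (t + i * M) a \<in> {u..v}"
          using that U'(2) unfolding hit_def by blast
        ultimately show ?thesis using q by (auto simp: G_def divide_right_mono)
      qed
      have "\<forall>\<^sub>F n in sequentially. 2 ^ card {i. i < n \<and> ?A i} \<le> 1 * real n ^ 2 * (1 + q) ^ n"
        using elim[rule_format, OF a[rule_format]]
      proof eventually_elim
        case (elim n)
        have "2 ^ card {i. i < n \<and> ?A i} / (1 + q) ^ n = (\<Prod>i<n. (if ?A i then 2 else 1) / (1 + q))"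
          by (simp add: prod_dividef prod_if_eq_power_card)
        also have "\<dots> \<le> (\<Prod>i<n. G i (cell (P (t + Suc i * M)) a))"
          using q by (intro prod_mono conjI G_ge) auto
        also have "\<dots> \<le> real n ^ 2" by (rule elim)
        finally show ?case using q by (simp add: pos_divide_le_eq)
      qed
      then show "freq_le ?A (q / ln 2)" by (intro freq_le_exponential[of 2 q 1]) (use q in auto)
    qed
  qed
qed

text \<open>\<open>M\<close> has to grow as \<open>v - u\<close> shrinks, but the frequency bound
  along each progression is independent of \<open>M\<close>, so the residue classes recombine
  without loss.\<close>

lemma visits:
  assumes "u < v" "0 < H"
  shows "AE a in lborel. covered a \<longrightarrow>
    freq_le (\<lambda>j. inv_length_at j a \<le> H \<and> x j a \<in> {u..v}) (C0 * distort * (3 * (v - u)) * H / ln 2)"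
proof -
  obtain M0 where M0: "C0\<^sup>2 / (v - u) < lam ^ M0" using real_arch_pow[OF lam_gt] by blast
  define M where "M = Suc M0"
  have "lam ^ M0 \<le> lam ^ M" using lam_gt by (intro power_increasing) (auto simp: M_def)
  then have "(v - u) * lam ^ M0 \<le> (v - u) * lam ^ M" using assms(1) by (intro mult_left_mono) auto
  moreover have "C0\<^sup>2 < (v - u) * lam ^ M0" using M0 assms(1) by (simp add: pos_divide_less_eq mult.commute)
  ultimately have M: "C0\<^sup>2 \<le> (v - u) * lam ^ M" by linarith
  have "AE a in lborel. \<forall>t. 1 \<le> t \<longrightarrow> covered a \<longrightarrow>
    freq_le (\<lambda>i. inv_length_at (t + i * M) a \<le> H \<and> x (t + i * M) a \<in> {u..v}) (C0 * distort * (3 * (v - u)) * H / ln 2)"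
    unfolding AE_all_countable
  proof
    fix t
    show "AE a in lborel. 1 \<le> t \<longrightarrow> covered a \<longrightarrow>
      freq_le (\<lambda>i. inv_length_at (t + i * M) a \<le> H \<and> x (t + i * M) a \<in> {u..v}) (C0 * distort * (3 * (v - u)) * H / ln 2)"
      using visits_progression[OF _ assms M, of t] by (cases "1 \<le> t") auto
  qed
  then show ?thesis
  proof eventually_elim
    case (elim a)
    show ?case
    proof
      assume a: "covered a"
      show "freq_le (\<lambda>j. inv_length_at j a \<le> H \<and> x j a \<in> {u..v}) (C0 * distort * (3 * (v - u)) * H / ln 2)"
      proof (rule freq_le_residues[of M _ 1])
        show "0 \<le> C0 * distort * (3 * (v - u)) * H / ln 2" using C0_ge distort_ge assms by simp
      qed (use elim a in \<open>auto simp: M_def\<close>)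
    qed
  qed
qed

subsection \<open>Growth of small images\<close>

text \<open>Children that miss \<open>clear j\<close> are left out, since such parameters will be
  discarded by Borel-Cantelli. Children are taken \<open>M\<close> levels below their
  parent.\<close>

definition clear_children :: "nat \<Rightarrow> (nat \<Rightarrow> real set) \<Rightarrow> nat \<Rightarrow> real set \<Rightarrow> nat" where
  "clear_children M clear j U = card {U' \<in> P (j + M). U' \<subseteq> U \<and> U' \<inter> clear j \<noteq> {}}"

text \<open>The number \<open>\<kappa>\<close> stands for the reciprocal of the length below which an image counts as
  short; it will depend on the parameter.\<close>

definition tame :: "nat \<Rightarrow> (nat \<Rightarrow> real set) \<Rightarrow> nat \<Rightarrow> nat \<Rightarrow> real set \<Rightarrow> bool" where
  "tame M clear \<kappa> j U \<longleftrightarrow> clear_children M clear j U \<le> 2 \<or> (inv_length j U \<le> \<kappa> \<and> clear_children M clear j U \<le> \<kappa>)"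

text \<open>Up to the telescoping numerators, the factors \<open>(1 + W / H) / (1 + W / (2 * H) + c)\<close> with
  \<open>W = inv_length j U\<close> are at least \<open>1 / (1 + c)\<close>, and at least \<open>4 / 3 / (1 + c)\<close> when \<open>W > H\<close>. As
  \<open>c\<close> tends to \<open>0\<close> for large \<open>H\<close>, a product of subexponential growth forces the latter case to be
  rare.\<close>

lemma growth_progression:
  fixes \<kappa> M t :: nat and H :: real and clear :: "nat \<Rightarrow> real set"
  assumes M: "4 * distort \<le> lam ^ M" and "0 < H"
  defines "c \<equiv> (real \<kappa>)\<^sup>2 / H"
  shows "AE a in lborel. covered a \<longrightarrow>
    (\<forall>i. tame M clear \<kappa> (t + i * M) (cell (P (t + i * M)) a) \<and> a \<in> clear (t + i * M)) \<longrightarrow>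
    freq_le (\<lambda>i. inv_length_at (t + i * M) a > H) (c / ln (4/3))"
proof -
  interpret sub: nested_partitions "\<lambda>i. P (t + i * M)" by (rule subsequence)
  have c: "0 \<le> c" using assms(2) by (simp add: c_def)
  \<comment> \<open>Children of a parent that is not tame, and children missing
    \<open>clear j\<close>, get the factor 0: this preserves the mean bound and affects none of the
    parameters in the conclusion. The test \<open>U' \<in> P (j + M)\<close> and the absolute value
    make nonnegativity immediate for arbitrary sets.\<close>
  define G where "G i U' = (let j = t + i * M; U = cell (P j) (pt U') in
      if tame M clear \<kappa> j U \<and> U' \<inter> clear j \<noteq> {} \<and> U' \<in> P (j + M)
      then (1 + inv_length (j + M) U' / H) / (1 + \<bar>inv_length j U\<bar> / (2 * H) + c) else 0)" for i U'
  have G_nonneg: "0 \<le> G i U'" for i U'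
    using c assms(2) inv_length_pos[of U' "t + i * M + M"] by (auto simp: G_def Let_def intro!: divide_nonneg_nonneg add_nonneg_nonneg)
  have mean: "(\<Sum>U' | U' \<in> P (t + Suc i * M) \<and> U' \<subseteq> U. G i U' * len U') \<le> len U"
    if U: "U \<in> P (t + i * M)" for i U
  proof -
    define j where "j = t + i * M"
    have eq: "t + Suc i * M = j + M" by (simp add: j_def)
    let ?C = "{U'. U' \<in> P (j + M) \<and> U' \<subseteq> U}"
    let ?g = "{U' \<in> P (j + M). U' \<subseteq> U \<and> U' \<inter> clear j \<noteq> {}}"
    have Uj: "U \<in> P j" using U by (simp add: j_def)
    have fin: "finite ?C" "finite ?g" using finite_P[of "j + M"] by simp_all
    have cell: "cell (P j) (pt U') = U" if "U' \<in> ?C" for U' using that Uj by (intro cell_pt) auto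
    show ?thesis
    proof (cases "tame M clear \<kappa> j U")
      case False
      then have "(\<Sum>U'\<in>?C. G i U' * len U') = (\<Sum>U'\<in>?C. 0)"
        by (intro sum.cong refl) (simp add: G_def cell flip: j_def)
      then show ?thesis unfolding eq by simp
    next
      case True
      define den where "den = 1 + inv_length j U / (2 * H) + c"
      have w: "0 < inv_length j U" by (rule inv_length_pos[OF Uj])
      have den: "0 < den" using w c assms(2) by (auto simp: den_def intro!: add_pos_nonneg)
      let ?n = "real (clear_children M clear j U)"
      have "(\<Sum>U'\<in>?C. G i U' * len U') =
          (\<Sum>U'\<in>?g. (1 + inv_length (j + M) U' / H) / den * len U')"
        using fin True w
        by (intro sum.mono_neutral_cong_right) (auto simp: G_def cell Let_def den_def simp flip: j_def)
      also have "\<dots> = ((\<Sum>U'\<in>?g. len U') + (\<Sum>U'\<in>?g. inv_length (j + M) U' * len U') / H) / den"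
        by (simp add: sum.distrib sum_divide_distrib add_divide_distrib algebra_simps)
      also have "\<dots> \<le> (len U + (?n * (inv_length j U / 4 * len U)) / H) / den"
      proof (intro divide_right_mono add_mono)
        have "(\<Sum>U'\<in>?g. len U') \<le> (\<Sum>U'\<in>?C. len U')"
          using fin by (intro sum_mono2) auto
        also have "\<dots> \<le> len U" by (rule sum_children_le[OF Uj])
        finally show "(\<Sum>U'\<in>?g. len U') \<le> len U" .
        \<comment> \<open>Both sides are reciprocals of derivatives. Over \<open>M\<close> steps
          these grow by \<open>lam ^ M \<ge> 4 * distort\<close>, and \<open>distort\<close> pays
          for the change of base point. With at most two children the quarter adds up to one
          half.\<close>
        have "inv_length (j + M) U' * len U' \<le> inv_length j U / 4 * len U" if "U' \<in> ?g" for U'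
        proof -
          have U': "U' \<in> P (j + M)" "U' \<subseteq> U" using that by auto
          have p': "pt U' \<in> U" using pt_in[OF U'(1)] U'(2) by blast
          have "distort * 4 * e j (pt U) \<le> lam ^ M * (distort * e j (pt U'))"
            using M distortion[OF Uj pt_in[OF Uj] p'] e_pt_pos[OF Uj] distort_ge lam_gt
            by (intro order_trans[OF mult_right_mono mult_left_mono]) (auto simp: mult.commute)
          also have "\<dots> \<le> distort * e (j + M) (pt U')"
            using e_growth[OF P_good[OF U'(1) pt_in[OF U'(1)]]] distort_ge by (simp add: mult.left_commute)
          finally have "4 * e j (pt U) \<le> e (j + M) (pt U')" using distort_ge by simp
          then have "1 / e (j + M) (pt U') \<le> 1 / (4 * e j (pt U))"
            using e_pt_pos[OF Uj] by (intro divide_left_mono) auto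
          also have "\<dots> = (1 / e j (pt U)) / 4" by simp
          finally show ?thesis unfolding inverse_e_pt[OF U'(1)] inverse_e_pt[OF Uj] by simp
        qed
        then have "(\<Sum>U'\<in>?g. inv_length (j + M) U' * len U') \<le> (\<Sum>U'\<in>?g. inv_length j U / 4 * len U)"
          by (rule sum_mono)
        also have "\<dots> = ?n * (inv_length j U / 4 * len U)" by (simp add: clear_children_def)
        finally show "(\<Sum>U'\<in>?g. inv_length (j + M) U' * len U') \<le> ?n * (inv_length j U / 4 * len U)" .
      qed (use den assms(2) in auto)
      also have "\<dots> = len U * (1 + ?n * inv_length j U / (4 * H)) / den"
        by (simp add: algebra_simps)
      also have "\<dots> \<le> len U * den / den"
      proof (intro divide_right_mono mult_left_mono)
        \<comment> \<open>A long image may have up to \<open>\<kappa>\<close> clear children, but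
          then its own reciprocal length is at most \<open>\<kappa>\<close>, and the product is
          absorbed by \<open>c\<close>.\<close>
        have "?n * inv_length j U / (4 * H) \<le> inv_length j U / (2 * H) + c"
          using True unfolding tame_def
        proof
          assume "clear_children M clear j U \<le> 2"
          then have "?n * inv_length j U \<le> 2 * inv_length j U" using w by (intro mult_right_mono) auto
          then have "?n * inv_length j U / (4 * H) \<le> 2 * inv_length j U / (4 * H)" using assms(2) by (intro divide_right_mono) auto
          then show ?thesis using c by simp
        next
          assume *: "inv_length j U \<le> \<kappa> \<and> clear_children M clear j U \<le> \<kappa>"
          then have "?n * inv_length j U \<le> real \<kappa> * real \<kappa>" using w by (intro mult_mono) auto
          then have "?n * inv_length j U / (4 * H) \<le> (real \<kappa>)\<^sup>2 / (4 * H)"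
            using assms(2) by (intro divide_right_mono) (auto simp: power2_eq_square)
          also have "\<dots> \<le> c" unfolding c_def using assms(2) by (intro divide_left_mono) auto
          also have "\<dots> \<le> inv_length j U / (2 * H) + c" using w assms(2) by simp
          finally show ?thesis .
        qed
        then show "1 + ?n * inv_length j U / (4 * H) \<le> den" by (simp add: den_def)
      qed (use den in auto)
      also have "\<dots> = len U" using den by simp
      finally show ?thesis unfolding eq .
    qed
  qed
  have "AE a in lborel. (\<forall>n. a \<in> \<Union>(P (t + n * M))) \<longrightarrow>
     (\<forall>\<^sub>F n in sequentially. (\<Prod>i<n. G i (cell (P (t + Suc i * M)) a)) \<le> real n ^ 2)"
    by (rule sub.AE_prod_le[OF G_nonneg mean])
  then show ?thesis
  proof eventually_elim
    case (elim a)
    show ?case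
    proof (intro impI)
      assume a: "covered a"
        and ok: "\<forall>i. tame M clear \<kappa> (t + i * M) (cell (P (t + i * M)) a) \<and> a \<in> clear (t + i * M)"
      define w where "w i = inv_length_at (t + i * M) a" for i
      have w: "0 < w i" for i unfolding w_def using a cell_in inv_length_pos by blast
      define f where "f i = 1 + w i / H" for i
      have f: "1 \<le> f i" for i using w[of i] assms(2) by (simp add: f_def)
      define d where "d i = 1 + w i / (2 * H) + c" for i
      have d: "0 < d i" for i using w[of i] assms(2) c by (auto simp: d_def intro!: add_pos_nonneg)
      have G: "G i (cell (P (t + Suc i * M)) a) = f (Suc i) / d i" for i
      proof -
        let ?U' = "cell (P (t + Suc i * M)) a"
        have U': "?U' \<in> P (t + Suc i * M)" "a \<in> ?U'" using a cell_in by blast+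
        have "cell (P (t + i * M)) (pt ?U') = cell (P (t + i * M)) a"
          by (rule cell_cong[OF _ U'(1) pt_in[OF U'(1)] U'(2)]) simp
        then have "G i ?U' = (1 + inv_length (t + i * M + M) ?U' / H) / (1 + \<bar>inv_length_at (t + i * M) a\<bar> / (2 * H) + c)"
          unfolding G_def Let_def using ok U' by (subst if_P) (auto simp: add_ac)
        also have "inv_length (t + i * M + M) ?U' = w (Suc i)" by (simp add: w_def add_ac)
        also have "\<bar>inv_length_at (t + i * M) a\<bar> = w i" using w[of i] by (simp add: w_def)
        finally show ?thesis by (simp only: f_def d_def)
      qed
      have ratio: "(if w i > H then 4/3 else 1) / (1 + c) \<le> f i / d i" for i
      proof -
        have "(if w i > H then 4/3 else 1) * d i \<le> f i * (1 + c)"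
        proof (cases "w i > H")
          case True
          \<comment> \<open>\<open>4/3\<close> is the value of \<open>(1 + y) / (1 + y / 2)\<close>
            at \<open>y = 1\<close>, that is, at \<open>w i = H\<close>.\<close>
          have "4/3 * (1 + y / 2 + c) \<le> (1 + y) * (1 + c)" if "1 \<le> y" for y
          proof -
            have "c \<le> c * y" using mult_left_mono[OF that c] by simp
            moreover have "(1 + y) * (1 + c) = 1 + y + c + c * y" by (simp add: algebra_simps)
            ultimately show ?thesis using that c by argo
          qed
          from this[of "w i / H"] show ?thesis using True assms(2) by (simp add: d_def f_def mult.commute)
        next
          case False
          have "1 + y / 2 + c \<le> (1 + y) * (1 + c)" if "0 \<le> y" for y
          proof -
            have "0 \<le> c * y" using mult_nonneg_nonneg[OF c that] .
            moreover have "(1 + y) * (1 + c) = 1 + y + c + c * y" by (simp add: algebra_simps)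
            ultimately show ?thesis using that by argo
          qed
          from this[of "w i / H"] show ?thesis using False assms(2) w[of i] by (simp add: d_def f_def mult.commute)
        qed
        then show ?thesis using d[of i] c by (simp add: pos_divide_le_eq pos_le_divide_eq mult_ac)
      qed
      have "\<forall>\<^sub>F n in sequentially. (4/3) ^ card {i. i < n \<and> w i > H} \<le> f 0 * real n ^ 2 * (1 + c) ^ n"
        using elim[rule_format, OF a[rule_format]]
      proof eventually_elim
        case (elim n)
        have "(4/3) ^ card {i. i < n \<and> w i > H} / (1 + c) ^ n = (\<Prod>i<n. (if w i > H then 4/3 else 1) / (1 + c))"
          by (simp add: prod_dividef prod_if_eq_power_card)
        also have "\<dots> \<le> (\<Prod>i<n. f i / d i)"
          using c by (intro prod_mono conjI ratio) auto
        \<comment> \<open>The extra factor \<open>f n \<ge> 1\<close> completes the telescoping of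
          numerators, at the cost of the constant \<open>f 0\<close>.\<close>
        also have "\<dots> \<le> (\<Prod>i<n. f i / d i) * f n"
        proof -
          have "0 \<le> (\<Prod>i<n. f i / d i)"
            using f d by (intro prod_nonneg) (simp add: less_imp_le order_trans[OF zero_le_one])
          then show ?thesis using mult_left_mono[OF f[of n], of "\<Prod>i<n. f i / d i"] by simp
        qed
        also have "\<dots> = (\<Prod>i<n. f (Suc i) / d i) * f 0"
          using telescoping_prod[of f n] by (simp add: prod_dividef)
        also have "\<dots> \<le> real n ^ 2 * f 0"
          using elim f[of 0] unfolding G by (intro mult_right_mono) auto
        finally show ?case using c by (simp add: pos_divide_le_eq mult_ac)
      qed
      then show "freq_le (\<lambda>i. inv_length_at (t + i * M) a > H) (c / ln (4/3))"
        unfolding w_def[symmetric] by (intro freq_le_exponential[of "4/3" c "f 0"]) (use c f[of 0] in auto)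
    qed
  qed
qed

end

text \<open>Subadditivity of outer measure, phrased with measurable covers.\<close>

lemma covered_UN:
  assumes "finite A"
    and "\<And>i. i \<in> A \<Longrightarrow> \<exists>S\<in>fmeasurable lborel. B i \<subseteq> S \<and> len S \<le> f i"
  shows "\<exists>S\<in>fmeasurable lborel. (\<Union>i\<in>A. B i) \<subseteq> S \<and> len S \<le> (\<Sum>i\<in>A. f i)"
proof -
  obtain S where S: "\<And>i. i \<in> A \<Longrightarrow> S i \<in> fmeasurable lborel \<and> B i \<subseteq> S i \<and> len (S i) \<le> f i"
    using bchoice[of A "\<lambda>i S. S \<in> fmeasurable lborel \<and> B i \<subseteq> S \<and> len S \<le> f i"] assms(2) by blast
  show ?thesis
  proof (intro bexI conjI)
    show "(\<Union>i\<in>A. B i) \<subseteq> (\<Union>i\<in>A. S i)" using S by blast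
    show "(\<Union>i\<in>A. S i) \<in> fmeasurable lborel"
      using S assms(1) by (intro fmeasurable.finite_UN) auto
    have "len (\<Union>i\<in>A. S i) \<le> (\<Sum>i\<in>A. len (S i))"
      using S assms(1) by (intro measure_UNION_le) (auto simp: fmeasurable_def)
    also have "\<dots> \<le> (\<Sum>i\<in>A. f i)" using S by (intro sum_mono) auto
    finally show "len (\<Union>i\<in>A. S i) \<le> (\<Sum>i\<in>A. f i)" .
  qed
qed

lemma finite_set_gap:
  fixes S :: "real set"
  assumes "finite S"
  shows "\<exists>\<delta>>0. \<forall>s\<in>S. \<forall>s'\<in>S. s \<noteq> s' \<longrightarrow> \<delta> \<le> \<bar>s - s'\<bar>"
proof -
  define D where "D = (\<lambda>z. \<bar>fst z - snd z\<bar>) ` {z \<in> S \<times> S. fst z \<noteq> snd z}"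
  have "finite (S \<times> S)" using assms by simp
  then have "finite {z \<in> S \<times> S. fst z \<noteq> snd z}" by simp
  then have fin: "finite (insert 1 D)" unfolding D_def by (intro finite.insertI finite_imageI)
  have "0 < d" if "d \<in> insert 1 D" for d using that unfolding D_def by auto
  then have pos: "0 < Min (insert 1 D)" using Min_in[OF fin] by blast
  have "Min (insert 1 D) \<le> \<bar>s - s'\<bar>" if "s \<in> S" "s' \<in> S" "s \<noteq> s'" for s s'
  proof (rule Min_le[OF fin])
    have "\<bar>fst (s, s') - snd (s, s')\<bar> \<in> D" unfolding D_def using that by (intro imageI) simp
    then show "\<bar>s - s'\<bar> \<in> insert 1 D" by simp
  qed
  then show ?thesis using pos by blast
qed

context expanding_family
begin

text \<open>The quantifiers over \<open>\<kappa>\<close> and \<open>J\<close> stand inside the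
  almost sure statement, so that both may be chosen depending on \<open>a\<close>; as natural
  numbers they produce only countably many null sets.\<close>

lemma growth:
  assumes M: "4 * distort \<le> lam ^ M" "1 \<le> M"
  shows "AE a in lborel. covered a \<longrightarrow>
    (\<forall>\<kappa> J. (\<forall>j\<ge>J. tame M clear \<kappa> j (cell (P j) a) \<and> a \<in> clear j) \<longrightarrow>
      (\<forall>H::nat. 0 < real H \<longrightarrow> freq_le (\<lambda>j. inv_length_at j a > H) ((real \<kappa>)\<^sup>2 / H / ln (4/3))))"
proof -
  have "AE a in lborel. \<forall>\<kappa> t. \<forall>H::nat. 0 < real H \<longrightarrow> covered a \<longrightarrow>
    (\<forall>i. tame M clear \<kappa> (t + i * M) (cell (P (t + i * M)) a) \<and> a \<in> clear (t + i * M)) \<longrightarrow>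
    freq_le (\<lambda>i. inv_length_at (t + i * M) a > H) ((real \<kappa>)\<^sup>2 / H / ln (4/3))"
    unfolding AE_all_countable
  proof (intro allI)
    fix \<kappa> t H :: nat
    show "AE a in lborel. 0 < real H \<longrightarrow> covered a \<longrightarrow>
      (\<forall>i. tame M clear \<kappa> (t + i * M) (cell (P (t + i * M)) a) \<and> a \<in> clear (t + i * M)) \<longrightarrow>
      freq_le (\<lambda>i. inv_length_at (t + i * M) a > H) ((real \<kappa>)\<^sup>2 / H / ln (4/3))"
    proof (cases "0 < real H")
      case True
      then show ?thesis using growth_progression[OF M(1), of "real H" clear \<kappa> t] by simp
    qed auto
  qed
  then show ?thesis
  proof eventually_elim
    case (elim a)
    show ?case
    proof (intro impI allI)
      fix \<kappa> J H :: nat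
      assume *: "covered a" "\<forall>j\<ge>J. tame M clear \<kappa> j (cell (P j) a) \<and> a \<in> clear j" "0 < real H"
      show "freq_le (\<lambda>j. inv_length_at j a > H) ((real \<kappa>)\<^sup>2 / H / ln (4/3))"
      proof (rule freq_le_residues[OF M(2), where ?t0.0=J])
        fix t assume "J \<le> t"
        then have "\<forall>i. tame M clear \<kappa> (t + i * M) (cell (P (t + i * M)) a) \<and> a \<in> clear (t + i * M)"
          using *(2) trans_le_add1 by blast
        then show "freq_le (\<lambda>i. inv_length_at (t + i * M) a > H) ((real \<kappa>)\<^sup>2 / H / ln (4/3))"
          using elim *(1,3) by blast
      qed simp
    qed
  qed
qed

subsection \<open>Crossings of the cuts\<close>

text \<open>From such a level on, the orbit point moves with the parameter at least twice as fast as
  any cut, so it crosses each moving cut at most once per cell.\<close>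

definition steep :: "nat \<Rightarrow> bool" where
  "steep m \<longleftrightarrow> 1 \<le> m \<and> 2 * L \<le> lam ^ m / C0"

lemma steep_mono: "steep m \<Longrightarrow> m \<le> n \<Longrightarrow> steep n"
proof -
  assume *: "steep m" "m \<le> n"
  have "lam ^ m / C0 \<le> lam ^ n / C0"
    using *(2) lam_gt C0_ge by (intro divide_right_mono power_increasing) auto
  then show ?thesis using * unfolding steep_def by linarith
qed

lemma ex_steep: "\<exists>m. steep m"
proof -
  obtain n where "2 * L * C0 < lam ^ n" using real_arch_pow[OF lam_gt] by blast
  moreover have "lam ^ n \<le> lam ^ Suc n" using lam_gt by (intro power_increasing) auto
  ultimately have "2 * L * C0 \<le> lam ^ Suc n" by linarith
  then have "steep (Suc n)" using C0_ge by (simp add: steep_def pos_le_divide_eq)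
  then show ?thesis by blast
qed

lemma cut_motion:
  assumes "U \<in> P m" "u \<in> U" "v \<in> U" "k \<le> p"
  shows "\<bar>b k u - b k v\<bar> \<le> L * \<bar>u - v\<bar>"
  using b_lipschitz[OF assms(4)] good_I[OF P_good[OF assms(1)]] assms(2,3) by blast

text \<open>Half of the expansion rate \<open>lam ^ m / C0\<close> pays for the motion of the cuts,
  the other half remains.\<close>

lemma relative_expansion:
  assumes "steep m" "U \<in> P m" "u \<in> U" "v \<in> U" "k \<le> p"
  shows "L * \<bar>u - v\<bar> + lam ^ m / (2 * C0) * \<bar>u - v\<bar> \<le> \<bar>x m u - x m v\<bar>"
    and "lam ^ m / (2 * C0) * \<bar>u - v\<bar> \<le> \<bar>(x m u - b k u) - (x m v - b k v)\<bar>"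
proof -
  have m: "1 \<le> m" "2 * L \<le> lam ^ m / C0" using assms(1) by (simp_all add: steep_def)
  have "L * \<bar>u - v\<bar> + lam ^ m / (2 * C0) * \<bar>u - v\<bar> = (L + lam ^ m / C0 / 2) * \<bar>u - v\<bar>"
    by (simp add: algebra_simps)
  also have "\<dots> \<le> lam ^ m / C0 * \<bar>u - v\<bar>" using m(2) by (intro mult_right_mono) auto
  also have "\<dots> \<le> \<bar>x m u - x m v\<bar>" by (rule x_expands[OF m(1) assms(2,4,3)])
  finally show 1: "L * \<bar>u - v\<bar> + lam ^ m / (2 * C0) * \<bar>u - v\<bar> \<le> \<bar>x m u - x m v\<bar>" .
  show "lam ^ m / (2 * C0) * \<bar>u - v\<bar> \<le> \<bar>(x m u - b k u) - (x m v - b k v)\<bar>"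
    using 1 cut_motion[OF assms(2-5)] by linarith
qed

lemma same_child:
  assumes "1 \<le> m" "U \<in> P m" "u \<in> U" "v \<in> U" "u \<le> v"
    and "U1 \<in> P (Suc m)" "U2 \<in> P (Suc m)" "u \<in> U1" "v \<in> U2"
    and "\<And>s. u < s \<Longrightarrow> s < v \<Longrightarrow> x m s \<notin> Z s"
  shows "U1 = U2"
proof (rule P_join[OF assms(6-9,5)])
  obtain n where n: "m = Suc n" using assms(1) by (cases m) auto
  show "{u..v} \<subseteq> good (Suc m)"
  proof
    fix s assume s: "s \<in> {u..v}"
    have "s \<in> U" using P_segment[OF assms(2-4)] s assms(5) by (auto simp: closed_segment_eq_real_ivl)
    then have g: "s \<in> good m" by (rule P_good[OF assms(2)])
    have "x m u \<notin> Z u" using good_Z[OF P_good[OF assms(6,8)], of m] by simp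
    moreover have "x m v \<notin> Z v" using good_Z[OF P_good[OF assms(7,9)], of m] by simp
    ultimately have "x m s \<notin> Z s" using assms(10)[of s] s by (cases "s = u \<or> s = v") auto
    then show "s \<in> good (Suc m)" using good_SucI[of s n] g unfolding n by simp
  qed
qed

text \<open>Each of the \<open>p + 1\<close> moving cuts is crossed at most once on
  \<open>U\<close>. The crossings separate the children, so there are at most
  \<open>p + 2\<close>.\<close>

lemma card_children_Suc:
  assumes "steep m" "U \<in> P m"
  shows "card (children (Suc m) U) \<le> p + 2"
proof -
  let ?C = "children (Suc m) U"
  have m: "1 \<le> m" using assms(1) by (simp add: steep_def)
  define S where "S = {a \<in> U. x m a \<in> Z a}"
  define k where "k a = (SOME k. k \<le> p \<and> x m a = b k a)" for a
  have k: "k a \<le> p \<and> x m a = b (k a) a" if "a \<in> S" for a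
  proof -
    have "\<exists>k. k \<le> p \<and> x m a = b k a" using that by (auto simp: S_def cuts_def)
    then show ?thesis unfolding k_def by (rule someI_ex)
  qed
  have "inj_on k S"
  proof (rule inj_onI)
    fix u v assume uv: "u \<in> S" "v \<in> S" "k u = k v"
    have "u \<in> U" "v \<in> U" using uv by (auto simp: S_def)
    from relative_expansion(2)[OF assms this, of "k u"] have "lam ^ m / (2 * C0) * \<bar>u - v\<bar> \<le> 0"
      using k[OF uv(1)] k[OF uv(2)] uv(3) by simp
    moreover have "0 < lam ^ m / (2 * C0)" using lam_gt C0_ge by simp
    ultimately have "\<bar>u - v\<bar> \<le> 0" by (metis abs_ge_zero mult_le_0_iff not_le)
    then show "u = v" by simp
  qed
  moreover have "k ` S \<subseteq> {..p}" using k by auto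
  ultimately have S: "finite S" "card S \<le> p + 1"
    using inj_on_finite[of k S "{..p}"] card_inj_on_le[of k S "{..p}"] by simp_all
  have pt: "pt U' \<in> U'" "U' \<in> P (Suc m)" "pt U' \<in> U" if "U' \<in> ?C" for U'
    using pt_in[of U' "Suc m"] that by auto
  have "card (pt ` ?C) \<le> card S + 1"
  proof (rule card_le_separators[OF S(1), THEN conjunct2])
    fix y y' assume "y \<in> pt ` ?C" "y' \<in> pt ` ?C" and yy: "y < y'"
    then obtain U1 U2 where U: "U1 \<in> ?C" "y = pt U1" "U2 \<in> ?C" "y' = pt U2" by blast
    show "\<exists>s\<in>S. y < s \<and> s < y'"
    proof (rule ccontr)
      assume no: "\<not> ?thesis"
      have "U1 = U2"
      proof (rule same_child[OF m assms(2), of y y'])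
        fix s assume s: "y < s" "s < y'"
        have "s \<in> U" using P_segment[OF assms(2) pt(3)[OF U(1)] pt(3)[OF U(3)]] s U(2,4)
          by (auto simp: closed_segment_eq_real_ivl)
        then show "x m s \<notin> Z s" using no s by (auto simp: S_def)
      qed (use pt[OF U(1)] pt[OF U(3)] U(2,4) yy in auto)
      then show False using U(2,4) yy by simp
    qed
  qed
  moreover have "inj_on pt ?C"
  proof (rule inj_onI)
    fix U1 U2 assume *: "U1 \<in> ?C" "U2 \<in> ?C" "pt U1 = pt U2"
    then show "U1 = U2" using pt[OF *(1)] pt[OF *(2)] P_disjoint[of U1 "Suc m" U2 "pt U1"] by simp
  qed
  ultimately show ?thesis using S(2) by (simp add: card_image)
qed

lemma card_children:
  assumes "steep m" "U \<in> P m"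
  shows "card (children (m + i) U) \<le> (p + 2) ^ i"
proof (induction i)
  case 0
  have "children (m + 0) U \<subseteq> {U}"
  proof
    fix U' assume *: "U' \<in> children (m + 0) U"
    then have "U' = U" using pt_in[of U' m] assms(2) by (intro P_disjoint[of U' m U "pt U'"]) auto
    then show "U' \<in> {U}" by simp
  qed
  then have "card (children (m + 0) U) \<le> card {U}" by (intro card_mono) auto
  then show ?case by simp
next
  case (Suc i)
  let ?C = "children (m + i) U"
  have fin: "finite ?C" using finite_P[of "m + i"] by simp
  have "children (m + Suc i) U \<subseteq> (\<Union>U1\<in>?C. children (Suc (m + i)) U1)"
  proof
    fix U' assume *: "U' \<in> children (m + Suc i) U"
    then have U': "U' \<in> P (Suc (m + i))" "U' \<subseteq> U" by auto
    obtain U1 where U1: "U1 \<in> P (m + i)" "U' \<subseteq> U1" using P_nested[OF U'(1)] by blast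
    obtain U2 where U2: "U2 \<in> P m" "U1 \<subseteq> U2" using nested[OF U1(1)] by blast
    have "U2 = U" using pt_in[OF U'(1)] U' U1 U2 assms(2) by (intro P_disjoint[of U2 m U "pt U'"]) auto
    then show "U' \<in> (\<Union>U1\<in>?C. children (Suc (m + i)) U1)" using U1 U2 U' by blast
  qed
  then have "card (children (m + Suc i) U) \<le> card (\<Union>U1\<in>?C. children (Suc (m + i)) U1)"
    using finite_P fin by (intro card_mono) auto
  also have "\<dots> \<le> (\<Sum>U1\<in>?C. card (children (Suc (m + i)) U1))" by (rule card_UN_le[OF fin])
  also have "\<dots> \<le> (\<Sum>U1\<in>?C. p + 2)"
    using steep_mono[OF assms(1)] by (intro sum_mono card_children_Suc) auto
  also have "\<dots> = card ?C * (p + 2)" by simp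
  also have "\<dots> \<le> (p + 2) ^ i * (p + 2)" using Suc.IH by (rule mult_right_mono) simp
  also have "\<dots> = (p + 2) ^ Suc i" by simp
  finally show ?case .
qed

subsection \<open>Parameters whose orbit comes too close to a cut\<close>

text \<open>Per unit of parameter distance, the power bounds the drift between two orbits over
  \<open>M\<close> steps (each step adds \<open>L\<close> and multiplies by \<open>Lam\<close>), and
  the final \<open>L\<close> bounds the displacement of the cuts.\<close>

definition clearance :: "nat \<Rightarrow> real" where "clearance M = (1 + L + Lam) ^ M + L"

text \<open>At a distance from the cuts of more than \<open>clearance M\<close> times the length of the cell, replacing
  the parameter by any other one in the cell does not change the branches used in the next \<open>M\<close>
  steps.\<close>

definition clear :: "nat \<Rightarrow> nat \<Rightarrow> real set" where
  "clear M j = {a \<in> \<Union>(P (j + M)). \<forall>i<M. \<forall>k\<le>p. clearance M * len (cell (P j) a) < \<bar>x (j + i) a - b k a\<bar>}"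

lemma clearance_pos: "0 < clearance M"
  using L_pos lam_gt lam_le by (auto simp: clearance_def intro!: add_pos_pos)

text \<open>On a cell of level \<open>j + i\<close> inside \<open>U\<close>,
  \<open>x (j + i)\<close> moves relative to a cut at rate at least
  \<open>lam ^ (j + i) / (2 * C0)\<close>, so the parameters too close to it lie in an interval of
  length \<open>4 * clearance M * C0 * len U / lam ^ j\<close>. There are at most
  \<open>(p + 2) ^ M\<close> such cells in \<open>U\<close> and \<open>M * (p + 1)\<close> pairs
  \<open>i\<close>, \<open>k\<close>; the lengths of the cells \<open>U\<close> have bounded
  sum.\<close>

lemma bad_covered:
  assumes "steep j"
  shows "\<exists>S\<in>fmeasurable lborel. (\<Union>(P (j + M)) - clear M j) \<subseteq> S \<and>
    len S \<le> real (M * (p + 1) * (p + 2) ^ M) * (4 * clearance M * C0) * (\<Sum>U\<in>P 0. len U) * (1 / lam) ^ j"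
proof -
  let ?d = "\<lambda>U. 4 * clearance M * C0 * len U / lam ^ j"
  let ?B = "\<lambda>i k. {a \<in> \<Union>(P (j + i)). \<bar>x (j + i) a - b k a\<bar> \<le> clearance M * len (cell (P j) a)}"
  have "\<exists>S\<in>fmeasurable lborel. ?B i k \<subseteq> S \<and> len S \<le> (\<Sum>U\<in>P 0. ?d U) * (p + 2) ^ M"
    if ik: "i < M" "k \<le> p" for i k
  proof -
    let ?B' = "\<lambda>U'. {a \<in> U'. \<bar>x (j + i) a - b k a\<bar> \<le> clearance M * len (cell (P j) a)}"
    have "\<exists>S\<in>fmeasurable lborel. ?B' U' \<subseteq> S \<and> len S \<le> ?d (cell (P j) (pt U'))"
      if U': "U' \<in> P (j + i)" for U'
    proof -
      obtain U where U: "U \<in> P j" "U' \<subseteq> U" using nested[OF U'] by blast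
      have cell: "cell (P j) a = U" if "a \<in> U'" for a using that U by (intro cell_eq) auto
      have st: "steep (j + i)" by (rule steep_mono[OF assms]) simp
      have "\<exists>c. ?B' U' \<subseteq> {c..c + ?d U}"
      proof (rule bounded_diameter_imp_interval)
        fix u v assume uv: "u \<in> ?B' U'" "v \<in> ?B' U'" "u \<le> v"
        have "lam ^ (j + i) / (2 * C0) * \<bar>u - v\<bar> \<le> \<bar>(x (j + i) u - b k u) - (x (j + i) v - b k v)\<bar>"
          using uv by (intro relative_expansion(2)[OF st U' _ _ ik(2)]) auto
        also have "\<dots> \<le> 2 * (clearance M * len U)" using uv by (auto simp: cell)
        finally have 1: "lam ^ (j + i) / (2 * C0) * \<bar>u - v\<bar> \<le> 2 * (clearance M * len U)" .
        have "lam ^ j * \<bar>u - v\<bar> \<le> lam ^ (j + i) * \<bar>u - v\<bar>"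
          using lam_gt by (intro mult_right_mono power_increasing) auto
        also have "\<dots> \<le> 4 * clearance M * C0 * len U" using 1 C0_ge by (simp add: field_simps)
        finally show "v - u \<le> ?d U" using uv(3) lam_gt by (simp add: pos_le_divide_eq mult.commute)
      qed
      then obtain c where c: "?B' U' \<subseteq> {c..c + ?d U}" by blast
      have "0 \<le> ?d U" using clearance_pos[of M] C0_ge lam_gt by simp
      then have "len {c..c + ?d U} \<le> ?d (cell (P j) (pt U'))"
        using cell[OF pt_in[OF U']] by simp
      moreover have "{c..c + ?d U} \<in> fmeasurable lborel"
        using \<open>0 \<le> ?d U\<close> by (simp add: fmeasurable_def)
      ultimately show ?thesis using c by blast
    qed
    then have "\<exists>S\<in>fmeasurable lborel. (\<Union>U'\<in>P (j + i). ?B' U') \<subseteq> S \<and>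
        len S \<le> (\<Sum>U'\<in>P (j + i). ?d (cell (P j) (pt U')))"
      by (intro covered_UN[OF finite_P])
    then obtain S where S: "S \<in> fmeasurable lborel" "(\<Union>U'\<in>P (j + i). ?B' U') \<subseteq> S"
      "len S \<le> (\<Sum>U'\<in>P (j + i). ?d (cell (P j) (pt U')))" by (elim bexE conjE)
    have "(\<Sum>U'\<in>P (j + i). ?d (cell (P j) (pt U'))) =
        (\<Sum>U\<in>P j. \<Sum>U' | U' \<in> P (j + i) \<and> U' \<subseteq> U. ?d (cell (P j) (pt U')))"
      by (rule sum_children)
    also have "\<dots> = (\<Sum>U\<in>P j. real (card (children (j + i) U)) * ?d U)"
    proof (intro sum.cong refl)
      fix U assume U: "U \<in> P j"
      have "(\<Sum>U' | U' \<in> P (j + i) \<and> U' \<subseteq> U. ?d (cell (P j) (pt U'))) = (\<Sum>U' | U' \<in> P (j + i) \<and> U' \<subseteq> U. ?d U)"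
      proof (intro sum.cong refl)
        fix U' assume "U' \<in> {U'. U' \<in> P (j + i) \<and> U' \<subseteq> U}"
        then have "cell (P j) (pt U') = U" using U by (intro cell_pt[of U' j i U]) auto
        then show "?d (cell (P j) (pt U')) = ?d U" by (simp only:)
      qed
      also have "\<dots> = real (card (children (j + i) U)) * ?d U" by (rule sum_constant)
      finally show "(\<Sum>U' | U' \<in> P (j + i) \<and> U' \<subseteq> U. ?d (cell (P j) (pt U'))) =
        real (card (children (j + i) U)) * ?d U" .
    qed
    also have "\<dots> \<le> (\<Sum>U\<in>P j. (p + 2) ^ M * ?d U)"
    proof (intro sum_mono mult_right_mono)
      fix U assume "U \<in> P j"
      then have "card (children (j + i) U) \<le> (p + 2) ^ i" by (rule card_children[OF assms])
      also have "\<dots> \<le> (p + 2) ^ M" using ik by (intro power_increasing) auto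
      finally show "real (card (children (j + i) U)) \<le> real ((p + 2) ^ M)" by (rule of_nat_mono)
      show "0 \<le> ?d U" using clearance_pos[of M] C0_ge lam_gt by simp
    qed
    also have "\<dots> = (\<Sum>U\<in>P j. len U) * ((p + 2) ^ M * (4 * clearance M * C0 / lam ^ j))"
      unfolding sum_distrib_right by (intro sum.cong refl) simp
    also have "\<dots> \<le> (\<Sum>U\<in>P 0. len U) * ((p + 2) ^ M * (4 * clearance M * C0 / lam ^ j))"
    proof (rule mult_right_mono)
      have "(\<Sum>U'\<in>P (0 + j). len U') = (\<Sum>U\<in>P 0. \<Sum>U' | U' \<in> P (0 + j) \<and> U' \<subseteq> U. len U')"
        by (rule sum_children)
      also have "\<dots> \<le> (\<Sum>U\<in>P 0. len U)" by (intro sum_mono sum_children_le)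
      finally show "(\<Sum>U\<in>P j. len U) \<le> (\<Sum>U\<in>P 0. len U)" by simp
      show "0 \<le> (p + 2) ^ M * (4 * clearance M * C0 / lam ^ j)" using clearance_pos[of M] C0_ge lam_gt by simp
    qed
    also have "\<dots> = (\<Sum>U\<in>P 0. ?d U) * (p + 2) ^ M"
      unfolding sum_distrib_right by (intro sum.cong refl) simp
    finally have "len S \<le> (\<Sum>U\<in>P 0. ?d U) * (p + 2) ^ M" using S(3) by linarith
    moreover have "?B i k \<subseteq> S" using S(2) by blast
    ultimately show ?thesis using S(1) by blast
  qed
  then have "\<exists>S\<in>fmeasurable lborel. (\<Union>ik\<in>{..<M} \<times> {..p}. ?B (fst ik) (snd ik)) \<subseteq> S \<and>
      len S \<le> (\<Sum>ik\<in>{..<M} \<times> {..p}. (\<Sum>U\<in>P 0. ?d U) * (p + 2) ^ M)"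
    by (intro covered_UN) auto
  then obtain S where S: "S \<in> fmeasurable lborel" "(\<Union>ik\<in>{..<M} \<times> {..p}. ?B (fst ik) (snd ik)) \<subseteq> S"
    "len S \<le> (\<Sum>ik\<in>{..<M} \<times> {..p}. (\<Sum>U\<in>P 0. ?d U) * (p + 2) ^ M)" by blast
  have sub: "\<Union>(P (j + M)) - clear M j \<subseteq> S"
  proof
    fix a assume a: "a \<in> \<Union>(P (j + M)) - clear M j"
    then obtain i k where ik: "i < M" "k \<le> p" "\<bar>x (j + i) a - b k a\<bar> \<le> clearance M * len (cell (P j) a)"
      unfolding clear_def by (auto simp: not_less)
    obtain U' where "U' \<in> P (j + M)" "a \<in> U'" using a by blast
    then have "a \<in> \<Union>(P (j + i))" using nested_le[of "j + i" "j + M" U'] ik(1) by auto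
    then have "a \<in> ?B (fst (i, k)) (snd (i, k))" using ik(3) by simp
    moreover have "(i, k) \<in> {..<M} \<times> {..p}" using ik by simp
    ultimately show "a \<in> S" using S(2) by blast
  qed
  have eq: "(\<Sum>ik\<in>{..<M} \<times> {..p}. (\<Sum>U\<in>P 0. ?d U) * (p + 2) ^ M) =
      real (M * (p + 1) * (p + 2) ^ M) * (4 * clearance M * C0) * (\<Sum>U\<in>P 0. len U) * (1 / lam) ^ j"
  proof -
    have "(\<Sum>U\<in>P 0. ?d U) = (4 * clearance M * C0) * (\<Sum>U\<in>P 0. len U) * (1 / lam) ^ j"
      unfolding sum_distrib_left sum_distrib_right by (intro sum.cong refl) (simp add: power_one_over)
    moreover have "(\<Sum>ik\<in>{..<M} \<times> {..p}. c * s * q * real ((p + 2) ^ M)) = real (M * (p + 1) * (p + 2) ^ M) * c * s * q"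
      for c s q :: real
      by (simp add: card_cartesian_product)
    ultimately show ?thesis by (simp only:)
  qed
  show ?thesis using S(1) sub S(3)[unfolded eq] by (intro bexI[of _ S] conjI)
qed

lemma eventually_clear: "AE a in lborel. covered a \<longrightarrow> (\<forall>\<^sub>F j in sequentially. a \<in> clear M j)"
proof -
  obtain m where m: "steep m" using ex_steep by blast
  define B where "B = real (M * (p + 1) * (p + 2) ^ M) * (4 * clearance M * C0) * (\<Sum>U\<in>P 0. len U)"
  have "\<exists>S. \<forall>j. S j \<in> fmeasurable lborel \<and>
      (m \<le> j \<longrightarrow> \<Union>(P (j + M)) - clear M j \<subseteq> S j \<and> len (S j) \<le> B * (1 / lam) ^ j)"
  proof (rule choice, rule allI)
    fix j
    show "\<exists>S. S \<in> fmeasurable lborel \<and>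
        (m \<le> j \<longrightarrow> \<Union>(P (j + M)) - clear M j \<subseteq> S \<and> len S \<le> B * (1 / lam) ^ j)"
    proof (cases "m \<le> j")
      case True
      then show ?thesis using bad_covered[OF steep_mono[OF m True], of M] unfolding B_def by blast
    next
      case False
      then show ?thesis by (intro exI[of _ "{}"]) simp
    qed
  qed
  then obtain S where S: "\<And>j. S j \<in> fmeasurable lborel"
    "\<And>j. m \<le> j \<Longrightarrow> \<Union>(P (j + M)) - clear M j \<subseteq> S j" "\<And>j. m \<le> j \<Longrightarrow> len (S j) \<le> B * (1 / lam) ^ j"
    by blast
  have "summable (\<lambda>j. B * (1 / lam) ^ j)"
    using lam_gt by (intro summable_mult summable_geometric) simp
  then have "summable (\<lambda>j. len (S j))"
    by (rule summable_comparison_test'[of _ m]) (use S(3) in simp)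
  then have "AE a in lborel. \<forall>\<^sub>F j in sequentially. a \<in> space lborel - S j"
    using S(1) by (intro borel_cantelli_AE1) (auto simp: fmeasurable_def)
  then show ?thesis
  proof eventually_elim
    case (elim a)
    show ?case
    proof
      assume a: "covered a"
      show "\<forall>\<^sub>F j in sequentially. a \<in> clear M j"
        using elim eventually_ge_at_top[of m]
      proof eventually_elim
        case (elim j)
        then show ?case using S(2)[of j] a by blast
      qed
    qed
  qed
qed


subsection \<open>Comparison with a single map\<close>

lemma finite_preimage:
  assumes "a \<in> I" "finite F"
  shows "finite {y \<in> {0..1}. T a y \<in> F}"
proof -
  have 1: "{y \<in> {0..1}. T a y \<in> F} \<subseteq> Z a \<union> (\<Union>k\<in>{1..p}. \<Union>f\<in>F. {y \<in> {0..1} \<inter> {b (k - 1) a<..<b k a}. T a y = f})"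
  proof
    fix y assume y: "y \<in> {y \<in> {0..1}. T a y \<in> F}"
    show "y \<in> Z a \<union> (\<Union>k\<in>{1..p}. \<Union>f\<in>F. {y \<in> {0..1} \<inter> {b (k - 1) a<..<b k a}. T a y = f})"
    proof (cases "y \<in> Z a")
      case False
      then obtain k where "k \<in> {1..p}" "y \<in> {b (k - 1) a<..<b k a}"
        using segment_branch[OF assms(1), of y y] y by auto
      then show ?thesis using y by blast
    qed blast
  qed
  have 2: "finite {y \<in> {0..1} \<inter> {b (k - 1) a<..<b k a}. T a y = f}" if k: "k \<in> {1..p}" for k f
  proof -
    let ?Y = "{y \<in> {0..1} \<inter> {b (k - 1) a<..<b k a}. T a y = f}"
    have one: "u = v" if uv: "u \<in> ?Y" "v \<in> ?Y" for u v
    proof -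
      have u: "u \<in> {0..1}" "u \<in> {b (k - 1) a<..<b k a}" and v: "v \<in> {0..1}" "v \<in> {b (k - 1) a<..<b k a}"
        and eq: "T a u = T a v" using uv by auto
      have mono: "b i a \<le> b j a" if "i \<le> j" "j \<le> p" for i j
        using that
      proof (induction j)
        case (Suc j)
        have "\<forall>k\<in>{1..p}. b (k - 1) a < b k a" using expanding[OF assms(1)] by (simp add: expanding_map_def)
        then have "b j a < b (Suc j) a" using Suc.prems(2) by (auto dest: bspec[of _ _ "Suc j"])
        then show ?case using Suc by (cases "i = Suc j") auto
      qed auto
      have "b i a \<notin> {b (k - 1) a<..<b k a}" if "i \<le> p" for i
      proof (cases "i \<le> k - 1")
        case True
        moreover have "k - 1 \<le> p" using k by auto
        ultimately have "b i a \<le> b (k - 1) a" by (rule mono)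
        then show ?thesis by simp
      next
        case False
        then have "k \<le> i" by linarith
        then have "b k a \<le> b i a" using that by (rule mono)
        then show ?thesis by simp
      qed
      moreover have seg: "closed_segment u v \<subseteq> {b (k - 1) a<..<b k a}"
        using u(2) v(2) by (auto simp: closed_segment_eq_real_ivl split: if_splits)
      ultimately have noZ: "closed_segment u v \<inter> Z a = {}" unfolding cuts_def by blast
      obtain \<xi> where \<xi>: "\<xi> \<in> closed_segment u v" "T a u - T a v = deriv (T a) \<xi> * (u - v)"
        using T_mvt[OF assms(1) u(1) v(1) noZ] by blast
      have "\<xi> \<in> {0..1} - Z a" using \<xi>(1) segment01[OF u(1) v(1)] noZ by blast
      then have "deriv (T a) \<xi> \<noteq> 0" using deriv_T_bounds[OF assms(1)] lam_gt by fastforce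
      then show ?thesis using \<xi>(2) eq by simp
    qed
    show ?thesis
    proof (cases "?Y = {}")
      case False
      then obtain w where w: "w \<in> ?Y" by blast
      have "?Y \<subseteq> {w}" using one[OF _ w] by blast
      then show ?thesis by (rule finite_subset) simp
    qed (simp only: finite.emptyI)
  qed
  show ?thesis
    by (rule finite_subset[OF 1]) (intro finite_UnI finite_Z finite_UN_I finite_atLeastAtMost assms(2) 2)
qed

lemma iterate01: "a \<in> I \<Longrightarrow> y \<in> {0..1} \<Longrightarrow> (T a ^^ i) y \<in> {0..1}"
proof (induction i)
  case (Suc i)
  then show ?case using T01[of a "(T a ^^ i) y"] by simp
qed simp

text \<open>The points where smoothness of the \<open>M\<close>-th iterate of the single map
  \<open>T a\<close> can fail.\<close>

definition precuts :: "nat \<Rightarrow> real \<Rightarrow> real set" where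
  "precuts M a = {y \<in> {0..1}. \<exists>i<M. (T a ^^ i) y \<in> Z a}"

lemma finite_precuts:
  assumes "a \<in> I"
  shows "finite (precuts M a)"
proof -
  have fin: "finite {y \<in> {0..1}. (T a ^^ i) y \<in> Z a}" for i
  proof (induction i)
    case 0
    show ?case by (rule finite_subset[OF _ finite_Z[of a]]) auto
  next
    case (Suc i)
    have "{y \<in> {0..1}. (T a ^^ Suc i) y \<in> Z a} \<subseteq> {y \<in> {0..1}. T a y \<in> {y \<in> {0..1}. (T a ^^ i) y \<in> Z a}}"
      using T01[OF assms] by (auto simp: funpow_swap1)
    then show ?case using finite_preimage[OF assms Suc.IH] by (rule finite_subset)
  qed
  have "precuts M a \<subseteq> (\<Union>i<M. {y \<in> {0..1}. (T a ^^ i) y \<in> Z a})" by (auto simp: precuts_def)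
  then show ?thesis by (rule finite_subset) (intro finite_UN_I finite_lessThan fin)
qed

lemma iterate_isCont:
  assumes "a \<in> I" "y \<in> {0..1}" "\<And>i'. i' < i \<Longrightarrow> (T a ^^ i') y \<notin> Z a"
  shows "isCont (T a ^^ i) y"
  using assms(3)
proof (induction i)
  case (Suc i)
  have "isCont (T a ^^ i) y" using Suc by simp
  moreover have "(T a ^^ i) y \<in> {0..1} - Z a" using Suc.prems[of i] iterate01[OF assms(1,2)] by simp
  then have "isCont (T a) ((T a ^^ i) y)" by (rule DERIV_isCont[OF T_deriv[OF assms(1)]])
  ultimately have "isCont (\<lambda>z. T a ((T a ^^ i) z)) y" by (rule isCont_o2)
  moreover have "T a ^^ Suc i = (\<lambda>z. T a ((T a ^^ i) z))" by (simp add: fun_eq_iff)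
  ultimately show ?case by (simp only:)
qed (simp add: id_def)

definition margin :: "nat \<Rightarrow> real \<Rightarrow> real" where "margin M d = (1 + L + Lam) ^ M * d"

lemma clearance_margin: "clearance M * d = margin M d + L * d"
  by (simp add: clearance_def margin_def distrib_right)

text \<open>Replacing the parameter \<open>a1\<close> by \<open>a\<close> costs at most
  \<open>L * len U\<close> per step, and earlier errors are multiplied by at most
  \<open>Lam\<close>. The total stays below the distance from the cuts that \<open>clear\<close>
  guarantees, so both orbits lie on the same side of every cut, each relative to its own
  parameter.\<close>

lemma shadowing:
  assumes "U \<in> P j" "a \<in> U" "a1 \<in> U" "a1 \<in> clear M j" "i \<le> M"
  shows "\<bar>x (j + i) a1 - (T a ^^ i) (x j a1)\<bar> \<le> ((1 + L + Lam) ^ i - 1) * len U"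
    and "i < M \<Longrightarrow> (T a ^^ i) (x j a1) \<notin> Z a"
    and "i < M \<Longrightarrow> k \<le> p \<Longrightarrow> b k a < (T a ^^ i) (x j a1) \<longleftrightarrow> b k a1 < x (j + i) a1"
proof -
  define d where "d = len U"
  have d: "0 < d" using measure_P_pos[OF assms(1)] by (simp add: d_def)
  have aI: "a \<in> I" and a1I: "a1 \<in> I" using good_I[OF P_good[OF assms(1)]] assms(2,3) by blast+
  have xI: "x j a1 \<in> {0..1}" by (rule x01[OF a1I])
  have dist: "\<bar>s - a1\<bar> \<le> d" and sI: "s \<in> I" if "s \<in> closed_segment a a1" for s
  proof -
    have s: "s \<in> U" using P_segment[OF assms(1-3)] that by blast
    then show "s \<in> I" using good_I[OF P_good[OF assms(1)]] by blast
    obtain l r where "U = {l<..<r}" "l < r" using P_interval[OF assms(1)] by blast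
    then show "\<bar>s - a1\<bar> \<le> d" using s assms(3) by (auto simp: d_def)
  qed
  have cell: "cell (P j) a1 = U" by (rule cell_eq[OF assms(1,3)])
  \<comment> \<open>Needed for all parameters \<open>s\<close> between \<open>a\<close> and
    \<open>a1\<close>: property (ii) compares the two maps at a point only if no cut passes through
    it on the way.\<close>
  have far: "margin M d < \<bar>x (j + i) a1 - b k s\<bar>" if "i < M" "k \<le> p" "s \<in> closed_segment a a1" for i k s
  proof -
    have "margin M d + L * d < \<bar>x (j + i) a1 - b k a1\<bar>"
      using assms(4) that(1,2) by (simp add: clear_def cell clearance_margin d_def)
    moreover have "\<bar>b k s - b k a1\<bar> \<le> L * d"
      using b_lipschitz[OF that(2) sI[OF that(3)] a1I] mult_left_mono[OF dist[OF that(3)] less_imp_le[OF L_pos]]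
      by linarith
    ultimately show ?thesis by linarith
  qed
  \<comment> \<open>The \<open>- 1\<close> makes the inequality strict even at \<open>i = M\<close>
    and matches the zero error at \<open>i = 0\<close>.\<close>
  have err: "((1 + L + Lam) ^ i - 1) * d < margin M d" if "i \<le> M" for i
  proof -
    have "(1 + L + Lam) ^ i \<le> (1 + L + Lam) ^ M"
      using that L_pos lam_gt lam_le by (intro power_increasing) auto
    then have "(1 + L + Lam) ^ i * d \<le> margin M d" unfolding margin_def using d by (intro mult_right_mono) auto
    then show ?thesis using d by (simp add: left_diff_distrib)
  qed
  have close: "\<bar>x (j + i) a1 - (T a ^^ i) (x j a1)\<bar> \<le> ((1 + L + Lam) ^ i - 1) * d" if "i \<le> M" for i
    using that
  proof (induction i)
    case (Suc i)
    define z w where "z = x (j + i) a1" and "w = (T a ^^ i) (x j a1)"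
    have i: "i < M" and IH: "\<bar>z - w\<bar> \<le> ((1 + L + Lam) ^ i - 1) * d"
      using Suc unfolding z_def w_def by simp_all
    have zI: "z \<in> {0..1}" unfolding z_def by (rule x01[OF a1I])
    have wI: "w \<in> {0..1}" unfolding w_def by (rule iterate01[OF aI xI])
    have seg: "closed_segment z w \<inter> Z a = {}"
    proof -
      have "b k a \<notin> closed_segment z w" if "k \<le> p" for k
      proof
        assume "b k a \<in> closed_segment z w"
        then have "\<bar>z - b k a\<bar> \<le> \<bar>z - w\<bar>" by (auto simp: closed_segment_eq_real_ivl split: if_splits)
        then show False using far[OF i that, of a] IH err[of i] i unfolding z_def[symmetric] by simp
      qed
      then show ?thesis unfolding cuts_def by blast
    qed
    have "\<bar>T a1 z - T a z\<bar> \<le> L * \<bar>a1 - a\<bar>"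
    proof (rule param_lipschitz(1)[OF a1I aI zI])
      fix s assume "s \<in> closed_segment a1 a"
      then have s: "s \<in> closed_segment a a1" by (simp add: closed_segment_commute)
      have "0 \<le> margin M d" using L_pos lam_gt lam_le d by (simp add: margin_def)
      then have "b k s \<noteq> z" if "k \<le> p" for k using far[OF i that s] by (auto simp: z_def)
      then show "z \<notin> Z s" by (auto simp: cuts_def)
    qed
    also have "\<dots> \<le> L * d" using dist[of a] L_pos by (intro mult_left_mono) (auto simp: abs_minus_commute)
    finally have 1: "\<bar>T a1 z - T a z\<bar> \<le> L * d" .
    have "\<bar>T a z - T a w\<bar> \<le> Lam * \<bar>z - w\<bar>" by (rule T_lipschitz[OF aI zI wI seg])
    also have "\<dots> \<le> Lam * (((1 + L + Lam) ^ i - 1) * d)" using IH lam_gt lam_le by (intro mult_left_mono) auto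
    finally have 2: "\<bar>T a z - T a w\<bar> \<le> Lam * (((1 + L + Lam) ^ i - 1) * d)" .
    have 3: "L * d + Lam * (((1 + L + Lam) ^ i - 1) * d) \<le> ((1 + L + Lam) ^ Suc i - 1) * d"
    proof -
      have q: "1 \<le> (1 + L + Lam) ^ i" using L_pos lam_gt lam_le by (intro one_le_power) auto
      have "L + Lam * ((1 + L + Lam) ^ i - 1) \<le> (1 + L + Lam) ^ Suc i - 1"
        using mult_left_mono[OF q less_imp_le[OF L_pos]] q lam_gt lam_le by (simp add: algebra_simps)
      from mult_right_mono[OF this, of d] show ?thesis using d by (simp add: algebra_simps)
    qed
    have "x (j + Suc i) a1 = T a1 z" "(T a ^^ Suc i) (x j a1) = T a w"
      by (simp_all add: x_Suc z_def w_def)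
    then show ?case using 1 2 3 by linarith
  qed simp
  show "\<bar>x (j + i) a1 - (T a ^^ i) (x j a1)\<bar> \<le> ((1 + L + Lam) ^ i - 1) * len U"
    using close[OF assms(5)] by (simp add: d_def)
  have near: "\<bar>x (j + i) a1 - (T a ^^ i) (x j a1)\<bar> < margin M d"
    using close[OF assms(5)] err[OF assms(5)] by linarith
  show "(T a ^^ i) (x j a1) \<notin> Z a" if "i < M"
  proof
    assume "(T a ^^ i) (x j a1) \<in> Z a"
    then obtain k where "k \<le> p" "(T a ^^ i) (x j a1) = b k a" by (auto simp: cuts_def)
    then show False using far[OF that, of k a] near by simp
  qed
  show "b k a < (T a ^^ i) (x j a1) \<longleftrightarrow> b k a1 < x (j + i) a1" if "i < M" "k \<le> p"
  proof -
    have "margin M d + L * d < \<bar>x (j + i) a1 - b k a1\<bar>"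
      using assms(4) that by (simp add: clear_def cell clearance_margin d_def)
    moreover have "\<bar>b k a - b k a1\<bar> \<le> L * d"
      using b_lipschitz[OF that(2) aI a1I] mult_left_mono[OF dist[of a, OF ends_in_segment(1)] less_imp_le[OF L_pos]]
      by linarith
    moreover have "margin M d < \<bar>x (j + i) a1 - b k a\<bar>" using far[OF that, of a] by simp
    ultimately show ?thesis using near by argo
  qed
qed

text \<open>Induction over the steps. Without precuts in between, the iterates of \<open>T a\<close>
  send both points to the same side of every cut of \<open>T a\<close>; by shadowing this holds for
  the true orbits and their own cuts. Since a moving cut can be crossed only once, it is then not
  crossed between \<open>a1\<close> and \<open>a2\<close> at all.\<close>

lemma same_itinerary:
  assumes j: "steep j" and U: "U \<in> P j" "a \<in> U"
    and a1: "a1 \<in> U" "a1 \<in> clear M j" and a2: "a2 \<in> U" "a2 \<in> clear M j" and le: "a1 \<le> a2"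
    and seg: "closed_segment (x j a1) (x j a2) \<inter> precuts M a = {}"
  shows "i \<le> M \<Longrightarrow> \<exists>U'\<in>P (j + i). a1 \<in> U' \<and> a2 \<in> U'"
proof (induction i)
  case 0
  show ?case using U(1) a1(1) a2(1) by auto
next
  case (Suc i)
  then have i: "i < M" by simp
  obtain U' where U': "U' \<in> P (j + i)" "a1 \<in> U'" "a2 \<in> U'" using Suc by auto
  have st: "steep (j + i)" by (rule steep_mono[OF j]) simp
  then have m1: "1 \<le> j + i" by (simp add: steep_def)
  have aI: "a \<in> I" by (rule good_I[OF P_good[OF U]])
  have y01: "x j a1 \<in> {0..1}" "x j a2 \<in> {0..1}"
    using x01 good_I[OF P_good[OF U(1)]] a1(1) a2(1) by blast+
  define Q where "Q = closed_segment (x j a1) (x j a2)"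
  have avoid: "(T a ^^ i') y \<notin> Z a" "y \<in> {0..1}" if "y \<in> Q" "i' < M" for y i'
  proof -
    show "y \<in> {0..1}" using that(1) segment01[OF y01] by (auto simp: Q_def)
    then show "(T a ^^ i') y \<notin> Z a" using seg that by (auto simp: precuts_def Q_def)
  qed
  have "continuous_on Q (T a ^^ i)"
    using avoid i by (intro continuous_at_imp_continuous_on ballI iterate_isCont[OF aI]) auto
  then have "connected ((T a ^^ i) ` Q)" by (rule connected_continuous_image) (simp add: Q_def)
  then have conv: "is_interval ((T a ^^ i) ` Q)" by (simp add: is_interval_connected_1)
  have side: "b k a1 < x (j + i) a1 \<longleftrightarrow> b k a2 < x (j + i) a2" if k: "k \<le> p" for k
  proof -
    let ?w1 = "(T a ^^ i) (x j a1)" and ?w2 = "(T a ^^ i) (x j a2)"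
    have w: "?w1 \<in> (T a ^^ i) ` Q" "?w2 \<in> (T a ^^ i) ` Q" by (auto simp: Q_def)
    have "b k a \<notin> (T a ^^ i) ` Q" using avoid(1)[OF _ i] k by (auto simp: cuts_def)
    then have "b k a < ?w1 \<longleftrightarrow> b k a < ?w2"
      using mem_is_interval_1_I[OF conv w] mem_is_interval_1_I[OF conv w(2,1)] by (meson linear not_le)
    then show ?thesis
      using shadowing(3)[OF U a1 less_imp_le[OF i] i k] shadowing(3)[OF U a2 less_imp_le[OF i] i k] by simp
  qed
  have no_cross: "x (j + i) s \<notin> Z s" if s: "a1 < s" "s < a2" for s
  proof
    assume "x (j + i) s \<in> Z s"
    then obtain k where k: "k \<le> p" "x (j + i) s = b k s" by (auto simp: cuts_def)
    have sU: "s \<in> U'" using P_segment[OF U'] s by (auto simp: closed_segment_eq_real_ivl)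
    have pos: "0 < lam ^ (j + i) / (2 * C0)" using lam_gt C0_ge by simp
    \<comment> \<open>If the orbit met the cut at \<open>s\<close>, it would outrun the cut in both
      directions from there. As \<open>x (j + i)\<close> is monotone, it would be on opposite sides
      of the cut at \<open>a1\<close> and \<open>a2\<close>, against \<open>side\<close>.\<close>
    have 1: "\<bar>b k a1 - b k s\<bar> < \<bar>x (j + i) a1 - x (j + i) s\<bar>"
      using relative_expansion(1)[OF st U'(1,2) sU k(1)] cut_motion[OF U'(1,2) sU k(1)]
        mult_pos_pos[OF pos, of "\<bar>a1 - s\<bar>"] s by simp
    have 2: "\<bar>b k a2 - b k s\<bar> < \<bar>x (j + i) a2 - x (j + i) s\<bar>"
      using relative_expansion(1)[OF st U'(1,3) sU k(1)] cut_motion[OF U'(1,3) sU k(1)]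
        mult_pos_pos[OF pos, of "\<bar>a2 - s\<bar>"] s by simp
    show False
      using x_strict_between[OF m1 U' s] side[OF k(1)] 1 2 k(2) by argo
  qed
  have in_next: "\<exists>U1\<in>P (Suc (j + i)). a' \<in> U1" if a': "a' \<in> clear M j" for a'
  proof -
    obtain U1 where "U1 \<in> P (j + M)" "a' \<in> U1" using a' by (auto simp: clear_def)
    then show ?thesis using nested_le[of "Suc (j + i)" "j + M" U1] i by auto
  qed
  obtain U1 where U1: "U1 \<in> P (Suc (j + i))" "a1 \<in> U1" using in_next[OF a1(2)] by blast
  obtain U2 where U2: "U2 \<in> P (Suc (j + i))" "a2 \<in> U2" using in_next[OF a2(2)] by blast
  have "U1 = U2" by (rule same_child[OF m1 U' le U1(1) U2(1) U1(2) U2(2) no_cross])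
  then show ?case using U1 U2 by auto
qed

lemma precuts_between:
  assumes j: "steep j" and U: "U \<in> P j" "a \<in> U"
    and a1: "a1 \<in> U1" "a1 \<in> clear M j" "U1 \<in> P (j + M)" "U1 \<subseteq> U"
    and a2: "a2 \<in> U2" "a2 \<in> clear M j" "U2 \<in> P (j + M)" "U2 \<subseteq> U"
    and "U1 \<noteq> U2" "x j a1 < x j a2"
  shows "\<exists>s\<in>precuts M a. x j a1 < s \<and> s < x j a2"
proof (rule ccontr)
  assume no: "\<not> ?thesis"
  have a1U: "a1 \<in> U" and a2U: "a2 \<in> U" using a1 a2 by auto
  have "x j a1 \<notin> precuts M a"
    using shadowing(2)[OF U a1U a1(2) less_imp_le] by (auto simp: precuts_def)
  moreover have "x j a2 \<notin> precuts M a"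
    using shadowing(2)[OF U a2U a2(2) less_imp_le] by (auto simp: precuts_def)
  ultimately have seg: "closed_segment (x j a1) (x j a2) \<inter> precuts M a = {}"
    using no assms(13) by (force simp: closed_segment_eq_real_ivl less_le)
  have "\<exists>U'\<in>P (j + M). a1 \<in> U' \<and> a2 \<in> U'"
  \<comment> \<open>The map \<open>x j\<close> may reverse orientation, so the order of the images
    does not fix that of the parameters.\<close>
  proof (cases "a1 \<le> a2")
    case True
    show ?thesis by (rule same_itinerary[OF j U a1U a1(2) a2U a2(2) True seg]) simp
  next
    case False
    have "closed_segment (x j a2) (x j a1) \<inter> precuts M a = {}" using seg by (simp add: closed_segment_commute)
    then have "\<exists>U'\<in>P (j + M). a2 \<in> U' \<and> a1 \<in> U'"
      using False by (intro same_itinerary[OF j U a2U a2(2) a1U a1(2)]) auto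
    then show ?thesis by blast
  qed
  then obtain U' where "U' \<in> P (j + M)" "a1 \<in> U'" "a2 \<in> U'" by blast
  then have "U1 = U'" "U2 = U'"
    using P_disjoint[OF a1(3) _ a1(1)] P_disjoint[OF a2(3) _ a2(1)] by simp_all
  then show False using assms(12) by simp
qed

text \<open>One clear point is chosen in each child. Their images under \<open>x j\<close> are
  distinct, and any two are separated by a point of \<open>precuts M a\<close>.\<close>

lemma clear_children_le:
  assumes j: "steep j" and U: "U \<in> P j" "a \<in> U"
  shows "clear_children M (clear M) j U \<le> card {s \<in> precuts M a. \<exists>u\<in>U. \<exists>v\<in>U. x j u < s \<and> s < x j v} + 1"
proof -
  have aI: "a \<in> I" by (rule good_I[OF P_good[OF U]])
  have j1: "1 \<le> j" using j by (simp add: steep_def)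
  let ?g = "{U' \<in> P (j + M). U' \<subseteq> U \<and> U' \<inter> clear M j \<noteq> {}}"
  let ?S = "{s \<in> precuts M a. \<exists>u\<in>U. \<exists>v\<in>U. x j u < s \<and> s < x j v}"
  define r where "r U' = (SOME a. a \<in> U' \<inter> clear M j)" for U'
  have r: "r U' \<in> U'" "r U' \<in> clear M j" "U' \<in> P (j + M)" "U' \<subseteq> U" if "U' \<in> ?g" for U'
  proof -
    have "\<exists>a. a \<in> U' \<inter> clear M j" using that by blast
    then have "r U' \<in> U' \<inter> clear M j" unfolding r_def by (rule someI_ex)
    then show "r U' \<in> U'" "r U' \<in> clear M j" by auto
    show "U' \<in> P (j + M)" "U' \<subseteq> U" using that by auto
  qed
  have "inj_on (\<lambda>U'. x j (r U')) ?g"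
  proof (rule inj_onI)
    fix U1 U2 assume *: "U1 \<in> ?g" "U2 \<in> ?g" "x j (r U1) = x j (r U2)"
    have "r U1 \<in> U" "r U2 \<in> U" using r[OF *(1)] r[OF *(2)] by auto
    then have "r U1 = r U2" using inj_onD[OF x_inj[OF j1 U(1)] *(3)] by simp
    then show "U1 = U2" using r[OF *(1)] r[OF *(2)] P_disjoint[of U1 "j + M" U2 "r U1"] by simp
  qed
  then have "card ?g = card ((\<lambda>U'. x j (r U')) ` ?g)" by (simp add: card_image)
  also have "\<dots> \<le> card ?S + 1"
  proof (rule card_le_separators[THEN conjunct2])
    show "finite ?S" using finite_precuts[OF aI] by simp
    fix y y' assume "y \<in> (\<lambda>U'. x j (r U')) ` ?g" "y' \<in> (\<lambda>U'. x j (r U')) ` ?g" and yy: "y < y'"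
    then obtain U1 U2 where w: "U1 \<in> ?g" "y = x j (r U1)" "U2 \<in> ?g" "y' = x j (r U2)" by blast
    have lt: "x j (r U1) < x j (r U2)" using yy w by simp
    have ne: "U1 \<noteq> U2" using lt by auto
    obtain s where s: "s \<in> precuts M a" "x j (r U1) < s" "s < x j (r U2)"
      using precuts_between[OF j U r[OF w(1)] r[OF w(3)] ne lt] by blast
    have "r U1 \<in> U" "r U2 \<in> U" using r[OF w(1)] r[OF w(3)] by auto
    then show "\<exists>s\<in>?S. y < s \<and> s < y'" using s w(2,4) by (intro bexI[of _ s]) auto
  qed
  finally show ?thesis by (simp add: clear_children_def)
qed

text \<open>The finitely many points of \<open>precuts M a\<close> are at least
  \<open>\<delta>\<close> apart, so an image shorter than \<open>\<delta>\<close> contains at most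
  one of them in its interior and its cell has at most two clear children. Any other cell has at
  most \<open>card (precuts M a) + 1\<close>.\<close>

lemma eventually_tame:
  assumes "covered a"
  shows "\<exists>\<kappa> J. \<forall>j\<ge>J. tame M (clear M) \<kappa> j (cell (P j) a)"
proof -
  have aI: "a \<in> I" using assms P_good good_I by blast
  have fin: "finite (precuts M a)" by (rule finite_precuts[OF aI])
  obtain \<delta> where \<delta>: "\<delta> > 0" "\<And>s s'. s \<in> precuts M a \<Longrightarrow> s' \<in> precuts M a \<Longrightarrow> s \<noteq> s' \<Longrightarrow> \<delta> \<le> \<bar>s - s'\<bar>"
    using finite_set_gap[OF fin] by blast
  obtain m where m: "steep m" using ex_steep by blast
  obtain \<kappa>0 :: nat where "C0 * distort / \<delta> < \<kappa>0" using reals_Archimedean2 by blast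
  \<comment> \<open>The first entry forces images with \<open>inv_length j U > \<kappa>\<close> to
    be shorter than \<open>\<delta>\<close>; the second bounds the number of clear children in the
    remaining case.\<close>
  define \<kappa> where "\<kappa> = max \<kappa>0 (card (precuts M a) + 1)"
  have \<kappa>: "C0 * distort / \<delta> < \<kappa>" "card (precuts M a) + 1 \<le> \<kappa>"
    using \<open>C0 * distort / \<delta> < \<kappa>0\<close> by (auto simp: \<kappa>_def)
  have "tame M (clear M) \<kappa> j (cell (P j) a)" if "m \<le> j" for j
  proof -
    define U where "U = cell (P j) a"
    have U: "U \<in> P j" "a \<in> U" using cell_in[of a j] assms by (auto simp: U_def)
    have st: "steep j" by (rule steep_mono[OF m that])
    then have j1: "1 \<le> j" by (simp add: steep_def)
    let ?S = "{s \<in> precuts M a. \<exists>u\<in>U. \<exists>v\<in>U. x j u < s \<and> s < x j v}"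
    have ng: "clear_children M (clear M) j U \<le> card ?S + 1" by (rule clear_children_le[OF st U])
    show ?thesis
    proof (cases "inv_length j U \<le> \<kappa>")
      case True
      have "card ?S \<le> card (precuts M a)" using fin by (intro card_mono) auto
      then show ?thesis using True ng \<kappa>(2) unfolding tame_def U_def[symmetric] by linarith
    next
      case False
      have "0 < C0 * distort / \<delta>" using C0_ge distort_ge \<delta>(1) by simp
      then have "C0 * distort / \<delta> < inv_length j U" "0 < inv_length j U" using False \<kappa>(1) by linarith+
      then have diam: "C0 * distort / inv_length j U < \<delta>" using \<delta>(1) by (simp add: field_simps)
      have one: "s = s'" if ss: "s \<in> ?S" "s' \<in> ?S" for s s'
      proof (rule ccontr)
        assume "s \<noteq> s'"
        then have gap: "\<delta> \<le> \<bar>s - s'\<bar>" using ss by (intro \<delta>(2)) simp_all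
        obtain u v u' v' where uv: "u \<in> U" "v \<in> U" "u' \<in> U" "v' \<in> U"
          "x j u < s" "s < x j v" "x j u' < s'" "s' < x j v'" using ss by blast
        have "\<bar>x j v - x j u'\<bar> < \<delta>" "\<bar>x j v' - x j u\<bar> < \<delta>"
          using x_diameter[OF j1 U(1) uv(2,3)] x_diameter[OF j1 U(1) uv(4,1)] diam by linarith+
        then show False using uv(5-8) gap by linarith
      qed
      have finS: "finite ?S" using fin by simp
      have "card ?S \<le> Suc 0" unfolding card_le_Suc0_iff_eq[OF finS] by (intro ballI one)
      then show ?thesis using ng unfolding tame_def U_def[symmetric] by linarith
    qed
  qed
  then show ?thesis by blast
qed

subsection \<open>Almost sure frequencies\<close>

lemma AE_sparse:
  "AE a in lborel. covered a \<longrightarrow> no_concentration (\<lambda>j. x j a)"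
proof -
  obtain M0 where M0: "4 * distort < lam ^ M0" using real_arch_pow[OF lam_gt] by blast
  define M where "M = Suc M0"
  have "lam ^ M0 \<le> lam ^ M" using lam_gt by (intro power_increasing) (auto simp: M_def)
  then have M: "4 * distort \<le> lam ^ M" "1 \<le> M" using M0 by (auto simp: M_def)
  \<comment> \<open>Rational end points and integer \<open>H\<close> keep the number of exceptional
    null sets countable.\<close>
  have "AE a in lborel. \<forall>u\<in>\<rat>. \<forall>v\<in>\<rat>. \<forall>H::nat. u < v \<and> 0 < real H \<longrightarrow> covered a \<longrightarrow>
    freq_le (\<lambda>j. inv_length_at j a \<le> H \<and> x j a \<in> {u..v}) (C0 * distort * (3 * (v - u)) * H / ln 2)"
    unfolding AE_ball_countable[OF countable_rat] AE_all_countable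
  proof (intro ballI allI)
    fix u v :: real and H :: nat
    show "AE a in lborel. u < v \<and> 0 < real H \<longrightarrow> covered a \<longrightarrow>
      freq_le (\<lambda>j. inv_length_at j a \<le> H \<and> x j a \<in> {u..v}) (C0 * distort * (3 * (v - u)) * H / ln 2)"
      using visits[of u v "real H"] by (cases "u < v \<and> 0 < real H") auto
  qed
  with growth[OF M, of "clear M"] eventually_clear[of M] show ?thesis
  proof eventually_elim
    case (elim a)
    show ?case
      unfolding no_concentration_def
    proof (intro impI allI)
      fix \<epsilon> :: real
      assume a: "covered a" and e: "0 < \<epsilon>"
      obtain \<kappa> J1 where J1: "\<forall>j\<ge>J1. tame M (clear M) \<kappa> j (cell (P j) a)" using eventually_tame[OF a] by blast
      obtain J2 where J2: "\<forall>j\<ge>J2. a \<in> clear M j" using elim(2) a unfolding eventually_sequentially by blast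
      have J: "\<forall>j\<ge>max J1 J2. tame M (clear M) \<kappa> j (cell (P j) a) \<and> a \<in> clear M j" using J1 J2 by simp
      \<comment> \<open>\<open>H\<close> is chosen last, after \<open>\<kappa>\<close> and
        \<open>\<epsilon>\<close>, to make the frequency of images with
        \<open>inv_length_at j a > H\<close> at most \<open>\<epsilon>\<close>. The concentration
        constant is then proportional to \<open>H\<close>.\<close>
      obtain H :: nat where H: "(real \<kappa>)\<^sup>2 / (\<epsilon> * ln (4/3)) < H" using reals_Archimedean2 by blast
      have l: "0 < ln (4/3 :: real)" by simp
      have "0 \<le> (real \<kappa>)\<^sup>2 / (\<epsilon> * ln (4/3))" using e l by simp
      then have H0: "0 < real H" using H by linarith
      have le: "(real \<kappa>)\<^sup>2 / H / ln (4/3) \<le> \<epsilon>"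
      proof -
        have "(real \<kappa>)\<^sup>2 < H * (\<epsilon> * ln (4/3))" using H e l by (simp add: pos_divide_less_eq)
        then show ?thesis using H0 l by (simp add: pos_divide_le_eq mult_ac)
      qed
      have freq: "freq_le (\<lambda>j. inv_length_at j a > H) ((real \<kappa>)\<^sup>2 / H / ln (4/3))"
        by (rule elim(1)[THEN mp, OF a, THEN spec[of _ \<kappa>], THEN spec[of _ "max J1 J2"], THEN mp, OF J,
              THEN spec[of _ H], THEN mp, OF H0])
      have "freq_le (\<lambda>j. \<not> inv_length_at j a \<le> H) \<epsilon>"
        by (rule freq_le_mono[OF freq _ le]) simp
      moreover have "freq_le (\<lambda>j. inv_length_at j a \<le> H \<and> x j a \<in> {u..v}) (C0 * distort * 3 * H / ln 2 * (v - u))"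
        if "u \<in> \<rat>" "v \<in> \<rat>" "u < v" for u v
      proof -
        have freq: "freq_le (\<lambda>j. inv_length_at j a \<le> H \<and> x j a \<in> {u..v}) (C0 * distort * (3 * (v - u)) * H / ln 2)"
          by (rule elim(3)[THEN bspec[of _ _ u], OF that(1), THEN bspec[of _ _ v], OF that(2), THEN spec[of _ H],
                THEN mp, OF conjI[OF that(3) H0], THEN mp, OF a])
        have eq: "C0 * distort * (3 * (v - u)) * H / ln 2 = C0 * distort * 3 * H / ln 2 * (v - u)" by simp
        show ?thesis using freq unfolding eq .
      qed
      ultimately show "\<exists>C A. freq_le (\<lambda>j. \<not> A j) \<epsilon> \<and>
        (\<forall>u\<in>\<rat>. \<forall>v\<in>\<rat>. u < v \<longrightarrow> freq_le (\<lambda>j. A j \<and> x j a \<in> {u..v}) (C * (v - u)))"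
        by (intro exI[of _ "C0 * distort * 3 * H / ln 2"] exI[of _ "\<lambda>j. inv_length_at j a \<le> H"]) blast
    qed
  qed
qed

lemma AE_covered: "AE a in lborel. a \<in> I \<longrightarrow> covered a"
proof -
  have "countable (\<Union>n. I - \<Union>(P n))" using finite_uncovered by (intro countable_UN) (auto intro: countable_finite)
  then have "(\<Union>n. I - \<Union>(P n)) \<in> null_sets lborel" by (rule countable_imp_null_set_lborel)
  then have "AE a in lborel. a \<notin> (\<Union>n. I - \<Union>(P n))" by (rule AE_not_in)
  then show ?thesis by eventually_elim blast
qed

lemma typical_if_sparse:
  assumes a: "covered a" and acip: "acip (T a) \<mu>" and unique: "\<And>M. acip (T a) M \<Longrightarrow> M = \<mu>"
    and sparse: "no_concentration (\<lambda>j. x j a)"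
  shows "typical (T a) \<mu> (X a)"
proof -
  have g: "a \<in> good j" for j using a P_good by blast
  have aI: "a \<in> I" by (rule good_I[OF g])
  interpret sparse_orbit "T a" "Z a" \<mu> "X a"
  proof
    show "T a \<in> {0..1} \<rightarrow> {0..1}" using T01[OF aI] by blast
    show "isCont (T a) y" if "y \<in> {0..1} - Z a" for y by (rule DERIV_isCont[OF T_deriv[OF aI that]])
    show "X a \<in> {0..1}" using x01[OF aI, of 0] by simp
    show "(T a ^^ j) (X a) \<notin> Z a" for j using good_Z[OF g, of j "Suc j"] by (simp add: orbit_def)
    show "no_concentration (\<lambda>j. (T a ^^ j) (X a))" using sparse by (simp add: orbit_def)
    show "finite (Z a)" by (rule finite_Z)
    show "0 \<in> Z a" "1 \<in> Z a" by (rule Z01[OF aI])+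
    show "acip (T a) \<mu>" by (rule acip)
    show "\<And>M. acip (T a) M \<Longrightarrow> M = \<mu>" by (rule unique)
  qed
  show ?thesis by (rule typical)
qed

end

section \<open>Invariance of the support and conclusion\<close>

text \<open>A neighbourhood of \<open>f y\<close> contains the image of a neighbourhood of
  \<open>y\<close>, which has positive mass; invariance of \<open>M\<close> transfers this mass. It
  supplies \<open>K_invariant\<close>, since \<open>T a\<close> is continuous off the cuts.\<close>

lemma supp_invariant:
  assumes acip: "acip f M" and f01: "f \<in> {0..1} \<rightarrow> {0..1}" and y: "y \<in> supp M" and cont: "isCont f y"
  shows "f y \<in> supp M"
proof -
  have sM: "sets M = sets lborel01" and fM: "f \<in> measurable M M" and inv: "distr M M f = M"
    using acip by (simp_all add: acip_def)
  have sp: "space M = {0..1}"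
    using sets_eq_imp_space_eq[OF sM] by (simp add: lborel01_def space_restrict_space)
  have openM: "U \<inter> space M \<in> sets M" if "open U" for U
    using that unfolding sM sp lborel01_def by (simp add: sets_restrict_space_iff borel_open sets.Int)
  have yM: "y \<in> space M" and pos: "\<And>U. open U \<Longrightarrow> y \<in> U \<Longrightarrow> 0 < emeasure M (U \<inter> space M)"
    using y by (auto simp: supp_def)
  have fy: "f y \<in> space M" using f01 yM sp by auto
  show ?thesis
    unfolding supp_def
  proof (intro CollectI conjI allI impI fy)
    fix U assume U: "open U \<and> f y \<in> U"
    obtain V where V: "open V" "y \<in> V" "\<forall>z\<in>V. f z \<in> U"
      using cont[unfolded continuous_at_open, THEN spec, THEN mp, OF U] by (elim exE conjE)
    have "0 < emeasure M (V \<inter> space M)" by (rule pos[OF V(1,2)])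
    also have "\<dots> \<le> emeasure M (f -` (U \<inter> space M) \<inter> space M)"
      using V(3) f01 sp measurable_sets[OF fM openM] U by (intro emeasure_mono) auto
    also have "\<dots> = emeasure (distr M M f) (U \<inter> space M)"
      using fM openM U by (simp add: emeasure_distr)
    finally show "0 < emeasure M (U \<inter> space M)" by (simp add: inv)
  qed
qed

theorem theorem2p4:
  fixes I :: "real set" and L lam Lam :: real
    and T :: "real \<Rightarrow> real \<Rightarrow> real"
    and p\<^sub>0 :: nat and b :: "nat \<Rightarrow> real \<Rightarrow> real"
    and \<mu> :: "real \<Rightarrow> real measure" and \<phi> :: "real \<Rightarrow> real \<Rightarrow> real" and K :: "real \<Rightarrow> real set"
    and p\<^sub>1 :: nat and D :: "nat \<Rightarrow> real \<Rightarrow> real set"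
    and X :: "real \<Rightarrow> real"
  assumes "is_interval I" and "bounded I"
    and "0 < L" and "1 < lam" and "lam \<le> Lam"
    and "\<And>a. a \<in> I \<Longrightarrow> expanding_map L lam Lam (T a) p\<^sub>0 (\<lambda>k. b k a)"
    and "\<And>a. a \<in> I \<Longrightarrow> acip (T a) (\<mu> a)"
    and "\<And>a M. a \<in> I \<Longrightarrow> acip (T a) M \<Longrightarrow> M = \<mu> a"
    and "\<And>a. a \<in> I \<Longrightarrow> density_of (\<mu> a) (\<phi> a)"
    and "\<And>a. a \<in> I \<Longrightarrow> K a = supp (\<mu> a)"
    and "property_i I L p\<^sub>0 b"
    and "property_ii I L T p\<^sub>0 b"
    and "property_iii I K p\<^sub>0 b p\<^sub>1 D"
    and "condition_II I \<mu> \<phi>"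
    and "condition_III I T K p\<^sub>0 b p\<^sub>1 D"
    and "X \<in> I \<rightarrow> {0..1}" and "piecewise_C1 X I"
    and "condition_I I T K p\<^sub>0 b X"
  shows "AE a in lebesgue. a \<in> I \<longrightarrow> typical (T a) (\<mu> a) (X a)"
proof -
  obtain C0 where C0: "1 \<le> C0" and C: "\<forall>j\<ge>1. \<forall>U\<in>parameter_partition I T K p\<^sub>0 b X j. \<forall>a\<in>U.
        1 / C0 \<le> \<bar>deriv (orbit T X j) a / deriv (T a ^^ j) (X a)\<bar> \<and>
        \<bar>deriv (orbit T X j) a / deriv (T a ^^ j) (X a)\<bar> \<le> C0"
    using assms(18) unfolding condition_I_def by blast
  interpret expanding_maps I L lam Lam T p\<^sub>0 b
  proof
    show "L-lipschitz_on I (b k)" if "k \<le> p\<^sub>0" for k using assms(11) that by (simp add: property_i_def)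
  qed (fact assms(1-6,12))+
  have K_inv: "T a y \<in> K a" if a: "a \<in> I" and y: "y \<in> K a - cuts b p\<^sub>0 a" for a y
  proof -
    have "sets (\<mu> a) = sets lborel01" using assms(7)[OF a] by (simp add: acip_def)
    then have "space (\<mu> a) = {0..1}"
      by (auto dest: sets_eq_imp_space_eq simp: lborel01_def space_restrict_space)
    then have y01: "y \<in> {0..1}" using y assms(10)[OF a] by (auto simp: supp_def)
    have "T a \<in> {0..1} \<rightarrow> {0..1}" using T01[OF a] by blast
    moreover have "isCont (T a) y" by (rule DERIV_isCont[OF T_deriv[OF a]]) (use y y01 in auto)
    ultimately have "T a y \<in> supp (\<mu> a)"
      using supp_invariant[OF assms(7)[OF a]] y assms(10)[OF a] by auto
    then show ?thesis using assms(10)[OF a] by simp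
  qed
  interpret expanding_family I L lam Lam T p\<^sub>0 b K X C0
  proof
    show "finite (I - \<Union>(parameter_partition I T K p\<^sub>0 b X j))" if "1 \<le> j" for j
      using assms(18) that by (simp add: condition_I_def)
    show "1 / C0 \<le> \<bar>deriv (orbit T X j) a / deriv (T a ^^ j) (X a)\<bar> \<and>
        \<bar>deriv (orbit T X j) a / deriv (T a ^^ j) (X a)\<bar> \<le> C0"
      if "1 \<le> j" "U \<in> parameter_partition I T K p\<^sub>0 b X j" "a \<in> U" for j U a
      using C that by blast
  qed (fact assms(16) C0 K_inv)+
  \<comment> \<open>Proved for \<open>lborel\<close> and transferred to its completion at the
    end.\<close>
  have "AE a in lborel. a \<in> I \<longrightarrow> typical (T a) (\<mu> a) (X a)"
    using AE_sparse AE_covered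
  proof eventually_elim
    case (elim a)
    show ?case
    proof
      assume a: "a \<in> I"
      show "typical (T a) (\<mu> a) (X a)"
        using elim a by (intro typical_if_sparse[OF _ assms(7)[OF a] assms(8)[OF a]]) blast+
    qed
  qed
  then show ?thesis by (rule AE_completion)
qed

end
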